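(* Let $R$ be a commutative ring and $\mathcal{P}$ an operad over $R$. Let $\mathsf{T},\mathsf{T}^\circ:\mathsf{ALG}_{\mathcal{P}}\to\mathsf{ALG}_{\mathcal{P}}$ be the functors with $\mathsf{T}(A)=A\ltimes A$ and $\mathsf{T}^\circ(A)=\mathsf{Free}_A(\Omega_A)$. Let $\eta_A:A\to\mathsf{T}\mathsf{T}^\circ(A)=\mathsf{T}^\circ(A)\ltimes\mathsf{T}^\circ(A)$ be the $\mathcal{P}$-algebra morphism $\eta_A(a)=(a,\mathsf{d}(a))$, and let $\varepsilon_A:\mathsf{T}^\circ\mathsf{T}(A)=\mathsf{T}^\circ(A\ltimes A)\to A$ be the $\mathcal{P}$-algebra morphism defined on generators by $\varepsilon_A(a,b)=a$ and $\varepsilon_A(\mathsf{d}(a,b))=b$ for all $(a,b)\in A\ltimes A$. Then $(\eta,\varepsilon):\mathsf{T}^\circ\dashv\mathsf{T}$ is an adjunction.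
   Context: $R$ is a commutative ring. An operad $\mathcal{P}$ is a symmetric operad in $R$-modules: $R$-modules $\mathcal{P}(n)$, $n\ge0$, with right $\Sigma(n)$-actions, unit $1_{\mathcal{P}}\in\mathcal{P}(1)$ and partial compositions with the usual axioms. For an $R$-module $V$, $\mathsf{S}(\mathcal{P},V)=\bigoplus_{n\ge0}(\mathcal{P}(n)\otimes V^{\otimes n})_{\Sigma(n)}$ is the free $\mathcal{P}$-algebra on $V$. $\mathsf{ALG}_{\mathcal{P}}$ is the category of $\mathcal{P}$-algebras; operations are written $\mu(a_1,\dots,a_n)$ for $\mu\in\mathcal{P}(n)$. $A\ltimes A$ is the $R$-module $A\times A$ with operations $\mu((a_1,b_1),\dots,(a_n,b_n))=\big(\mu(a_1,\dots,a_n),\sum_{i=1}^n\mu(a_1,\dots,b_i,\dots,a_n)\big)$, and $\mathsf{T}(f)=f\times f$. $\Omega_A$ is the module of Kähler differentials of $A$ (the $A$-module, in the operadic sense, representing derivations out of $A$) and $\mathsf{Free}_A$ is the left adjoint of the forgetful functor from $\mathcal{P}$-algebras under $A$ to $A$-modules. Concretely, $\mathsf{T}^\circ(A)=\mathsf{Free}_A(\Omega_A)$ is the quotient of $\mathsf{S}(\mathcal{P},A\times A)$ by the ideal generated by the relations, for all $n\ge 0$, $\mu\in\mathcal{P}(n)$, $a_i\in A$: $\mu((a_1,0),\dots,(a_n,0))=(\mu(a_1,\dots,a_n),0)$ and $(0,\mu(a_1,\dots,a_n))=\sum_{i=1}^n\mu((a_1,0),\dots,(0,a_i),\dots,(a_n,0))$.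 One writes $a:=(a,0)$ and $\mathsf{d}(a):=(0,a)$ in $\mathsf{T}^\circ(A)$; these generate $\mathsf{T}^\circ(A)$. On morphisms, $\mathsf{T}^\circ(f)(a)=f(a)$ and $\mathsf{T}^\circ(f)(\mathsf{d}(a))=\mathsf{d}(f(a))$. $(\eta,\varepsilon):\mathsf{L}\dashv\mathsf{R}$ being an adjunction means that $\eta,\varepsilon$ are natural and $\varepsilon_{\mathsf{L}(A)}\circ\mathsf{L}(\eta_A)=1$, $\mathsf{R}(\varepsilon_A)\circ\eta_{\mathsf{R}(A)}=1$. *)

theory Defs
  imports
    "HOL-Algebra.Module"
    "HOL-Algebra.AbelCoset"
    "HOL-Combinatorics.Permutations"
    "HOL-Library.FuncSet"
begin

text \<open>
  Everything is relative to carriers in the style of HOL-Algebra.  A module record extends the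
  ring record; its fields \<open>mult\<close> and \<open>one\<close> play no role in the locale \<open>module\<close> and are
  left unspecified in the constructions below.
\<close>

section \<open>Module constructions\<close>

definition prod_module :: "('r, 'a, 'x) module_scheme \<Rightarrow> ('r, 'b, 'y) module_scheme \<Rightarrow> ('r, 'a \<times> 'b) module"
  where "prod_module M N =
    \<lparr>carrier = carrier M \<times> carrier N, monoid.mult = undefined, one = undefined,
     zero = (\<zero>\<^bsub>M\<^esub>, \<zero>\<^bsub>N\<^esub>),
     add = (\<lambda>p q. (fst p \<oplus>\<^bsub>M\<^esub> fst q, snd p \<oplus>\<^bsub>N\<^esub> snd q)),
     smult = (\<lambda>r p. (r \<odot>\<^bsub>M\<^esub> fst p, r \<odot>\<^bsub>N\<^esub> snd p))\<rparr>"

definition free_module :: "('r, 's) ring_scheme \<Rightarrow> 'x set \<Rightarrow> ('r, 'x \<Rightarrow> 'r) module"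
  where "free_module R X =
    \<lparr>carrier = {f. (\<forall>x. f x \<in> carrier R) \<and> finite {x. f x \<noteq> \<zero>\<^bsub>R\<^esub>} \<and> {x. f x \<noteq> \<zero>\<^bsub>R\<^esub>} \<subseteq> X},
     monoid.mult = undefined, one = undefined,
     zero = (\<lambda>x. \<zero>\<^bsub>R\<^esub>),
     add = (\<lambda>f g x. f x \<oplus>\<^bsub>R\<^esub> g x),
     smult = (\<lambda>r f x. r \<otimes>\<^bsub>R\<^esub> f x)\<rparr>"

definition basis_elt :: "('r, 's) ring_scheme \<Rightarrow> 'x \<Rightarrow> 'x \<Rightarrow> 'r"
  where "basis_elt R x = (\<lambda>y. if y = x then \<one>\<^bsub>R\<^esub> else \<zero>\<^bsub>R\<^esub>)"

definition lin_ext :: "('r, 's) ring_scheme \<Rightarrow> ('r, 'm, 't) module_scheme \<Rightarrow> ('x \<Rightarrow> 'r) \<Rightarrow> ('x \<Rightarrow> 'm) \<Rightarrow> 'm"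
  where "lin_ext R M f h = finsum M (\<lambda>x. f x \<odot>\<^bsub>M\<^esub> h x) {x. f x \<noteq> \<zero>\<^bsub>R\<^esub>}"

text \<open>The multilinear extension to \<open>free_module R X\<close> of a function on lists of elements of \<open>X\<close>.\<close>

primrec multilin_ext ::
    "('r, 's) ring_scheme \<Rightarrow> ('r, 'm, 't) module_scheme \<Rightarrow> ('x \<Rightarrow> 'r) list \<Rightarrow> ('x list \<Rightarrow> 'm) \<Rightarrow> 'm"
  where
    "multilin_ext R M [] h = h []"
  | "multilin_ext R M (f # fs) h = lin_ext R M f (\<lambda>x. multilin_ext R M fs (\<lambda>xs. h (x # xs)))"

definition submodule_gen :: "('r, 's) ring_scheme \<Rightarrow> ('r, 'm, 't) module_scheme \<Rightarrow> 'm set \<Rightarrow> 'm set"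
  where "submodule_gen R M X = \<Inter>{N. submodule N R M \<and> X \<subseteq> N}"

definition quot_module :: "('r, 'm, 't) module_scheme \<Rightarrow> 'm set \<Rightarrow> ('r, 'm set) module"
  where "quot_module M N =
    \<lparr>carrier = a_rcosets\<^bsub>M\<^esub> N, monoid.mult = undefined, one = undefined,
     zero = N,
     add = (\<lambda>C D. C <+>\<^bsub>M\<^esub> D),
     smult = (\<lambda>r C. \<Union>x\<in>C. N +>\<^bsub>M\<^esub> (r \<odot>\<^bsub>M\<^esub> x))\<rparr>"


section \<open>Operads\<close>

text \<open>
  The modules \<open>P(n)\<close> share a carrier type but need not be disjoint as sets, so arities are passed
  explicitly.  Slots are numbered from 0: \<open>pcomp P m i n \<mu> \<nu>\<close> is the result of inserting
  \<open>\<nu> \<in> P(n)\<close> into slot \<open>i < m\<close> of \<open>\<mu> \<in> P(m)\<close>.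
\<close>

record ('r, 'p) operad =
  opmod :: "nat \<Rightarrow> ('r, 'p) module"
  act :: "nat \<Rightarrow> 'p \<Rightarrow> (nat \<Rightarrow> nat) \<Rightarrow> 'p"
  opunit :: 'p
  pcomp :: "nat \<Rightarrow> nat \<Rightarrow> nat \<Rightarrow> 'p \<Rightarrow> 'p \<Rightarrow> 'p"

abbreviation arity_ops :: "('r, 'p) operad \<Rightarrow> nat \<Rightarrow> 'p set"
  where "arity_ops P n \<equiv> carrier (opmod P n)"

text \<open>
  The right action is normalised by
  \<open>(\<mu>\<sigma>)(a\<^sub>0, \<dots>, a\<^sub>n\<^sub>-\<^sub>1) = \<mu>(a\<^bsub>\<sigma>\<inverse>(0)\<^esub>, \<dots>, a\<^bsub>\<sigma>\<inverse>(n-1)\<^esub>)\<close>, so input \<open>k\<close> of \<open>\<mu>\<sigma>\<close> is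
  input \<open>\<sigma>(k)\<close> of \<open>\<mu>\<close>.  The two permutations below act on the inputs of \<open>\<mu> \<circ>\<^sub>i \<nu>\<close>, where the
  inputs of \<open>\<nu>\<close> are numbered \<open>i, \<dots>, i+n-1\<close>.
\<close>

definition inner_perm :: "nat \<Rightarrow> nat \<Rightarrow> (nat \<Rightarrow> nat) \<Rightarrow> nat \<Rightarrow> nat"
  where "inner_perm i n \<tau> = (\<lambda>t. if i \<le> t \<and> t < i + n then i + \<tau> (t - i) else t)"

definition outer_perm :: "nat \<Rightarrow> nat \<Rightarrow> (nat \<Rightarrow> nat) \<Rightarrow> nat \<Rightarrow> nat"
  where "outer_perm i n \<sigma> = (\<lambda>t.
    if i \<le> t \<and> t < i + n then \<sigma> i + (t - i)
    else let s = \<sigma> (if t < i then t else t + 1 - n) in (if s < \<sigma> i then s else s + n - 1))"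

locale symmetric_operad = R?: cring R
  for R :: "('r, 's) ring_scheme" (structure) and P :: "('r, 'p) operad" +
  assumes opmod_module: "module R (opmod P n)"
    and act_closed: "\<lbrakk>\<mu> \<in> arity_ops P n; \<sigma> permutes {..<n}\<rbrakk> \<Longrightarrow> act P n \<mu> \<sigma> \<in> arity_ops P n"
    and act_add: "\<lbrakk>\<mu> \<in> arity_ops P n; \<nu> \<in> arity_ops P n; \<sigma> permutes {..<n}\<rbrakk> \<Longrightarrow>
      act P n (\<mu> \<oplus>\<^bsub>opmod P n\<^esub> \<nu>) \<sigma> = act P n \<mu> \<sigma> \<oplus>\<^bsub>opmod P n\<^esub> act P n \<nu> \<sigma>"
    and act_smult: "\<lbrakk>r \<in> carrier R; \<mu> \<in> arity_ops P n; \<sigma> permutes {..<n}\<rbrakk> \<Longrightarrow>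
      act P n (r \<odot>\<^bsub>opmod P n\<^esub> \<mu>) \<sigma> = r \<odot>\<^bsub>opmod P n\<^esub> act P n \<mu> \<sigma>"
    and act_id: "\<mu> \<in> arity_ops P n \<Longrightarrow> act P n \<mu> id = \<mu>"
    and act_comp: "\<lbrakk>\<mu> \<in> arity_ops P n; \<sigma> permutes {..<n}; \<tau> permutes {..<n}\<rbrakk> \<Longrightarrow>
      act P n (act P n \<mu> \<sigma>) \<tau> = act P n \<mu> (\<sigma> \<circ> \<tau>)"
    and opunit_closed: "opunit P \<in> arity_ops P 1"
    and pcomp_closed: "\<lbrakk>\<mu> \<in> arity_ops P m; \<nu> \<in> arity_ops P n; i < m\<rbrakk> \<Longrightarrow>
      pcomp P m i n \<mu> \<nu> \<in> arity_ops P (m + n - 1)"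
    and pcomp_add_left: "\<lbrakk>\<mu> \<in> arity_ops P m; \<mu>' \<in> arity_ops P m; \<nu> \<in> arity_ops P n; i < m\<rbrakk> \<Longrightarrow>
      pcomp P m i n (\<mu> \<oplus>\<^bsub>opmod P m\<^esub> \<mu>') \<nu>
        = pcomp P m i n \<mu> \<nu> \<oplus>\<^bsub>opmod P (m + n - 1)\<^esub> pcomp P m i n \<mu>' \<nu>"
    and pcomp_smult_left: "\<lbrakk>r \<in> carrier R; \<mu> \<in> arity_ops P m; \<nu> \<in> arity_ops P n; i < m\<rbrakk> \<Longrightarrow>
      pcomp P m i n (r \<odot>\<^bsub>opmod P m\<^esub> \<mu>) \<nu> = r \<odot>\<^bsub>opmod P (m + n - 1)\<^esub> pcomp P m i n \<mu> \<nu>"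
    and pcomp_add_right: "\<lbrakk>\<mu> \<in> arity_ops P m; \<nu> \<in> arity_ops P n; \<nu>' \<in> arity_ops P n; i < m\<rbrakk> \<Longrightarrow>
      pcomp P m i n \<mu> (\<nu> \<oplus>\<^bsub>opmod P n\<^esub> \<nu>')
        = pcomp P m i n \<mu> \<nu> \<oplus>\<^bsub>opmod P (m + n - 1)\<^esub> pcomp P m i n \<mu> \<nu>'"
    and pcomp_smult_right: "\<lbrakk>r \<in> carrier R; \<mu> \<in> arity_ops P m; \<nu> \<in> arity_ops P n; i < m\<rbrakk> \<Longrightarrow>
      pcomp P m i n \<mu> (r \<odot>\<^bsub>opmod P n\<^esub> \<nu>) = r \<odot>\<^bsub>opmod P (m + n - 1)\<^esub> pcomp P m i n \<mu> \<nu>"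
    and opunit_left: "\<nu> \<in> arity_ops P n \<Longrightarrow> pcomp P 1 0 n (opunit P) \<nu> = \<nu>"
    and opunit_right: "\<lbrakk>\<mu> \<in> arity_ops P m; i < m\<rbrakk> \<Longrightarrow> pcomp P m i 1 \<mu> (opunit P) = \<mu>"
    and pcomp_sequential:
      "\<lbrakk>\<kappa> \<in> arity_ops P l; \<mu> \<in> arity_ops P m; \<nu> \<in> arity_ops P n; i < l; j < m\<rbrakk> \<Longrightarrow>
      pcomp P (l + m - 1) (i + j) n (pcomp P l i m \<kappa> \<mu>) \<nu>
        = pcomp P l i (m + n - 1) \<kappa> (pcomp P m j n \<mu> \<nu>)"
    and pcomp_parallel:
      "\<lbrakk>\<kappa> \<in> arity_ops P l; \<mu> \<in> arity_ops P m; \<nu> \<in> arity_ops P n; i < k; k < l\<rbrakk> \<Longrightarrow>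
      pcomp P (l + m - 1) (k + m - 1) n (pcomp P l i m \<kappa> \<mu>) \<nu>
        = pcomp P (l + n - 1) i m (pcomp P l k n \<kappa> \<nu>) \<mu>"
    and pcomp_act_right:
      "\<lbrakk>\<mu> \<in> arity_ops P m; \<nu> \<in> arity_ops P n; i < m; \<tau> permutes {..<n}\<rbrakk> \<Longrightarrow>
      pcomp P m i n \<mu> (act P n \<nu> \<tau>)
        = act P (m + n - 1) (pcomp P m i n \<mu> \<nu>) (inner_perm i n \<tau>)"
    and pcomp_act_left:
      "\<lbrakk>\<mu> \<in> arity_ops P m; \<nu> \<in> arity_ops P n; i < m; \<sigma> permutes {..<m}\<rbrakk> \<Longrightarrow>
      pcomp P m i n (act P m \<mu> \<sigma>) \<nu>
        = act P (m + n - 1) (pcomp P m (\<sigma> i) n \<mu> \<nu>) (outer_perm i n \<sigma>)"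


section \<open>Algebras over an operad\<close>

text \<open>The arity of the operation applied by \<open>oper\<close> is the length of the argument list.\<close>

record ('r, 'p, 'a) operad_alg = "('r, 'a) module" +
  oper :: "'p \<Rightarrow> 'a list \<Rightarrow> 'a"

locale operad_algebra = symmetric_operad R P + module R A
  for R :: "('r, 's) ring_scheme" (structure) and P :: "('r, 'p) operad"
    and A :: "('r, 'p, 'a) operad_alg" +
  assumes oper_closed: "\<lbrakk>set as \<subseteq> carrier A; \<mu> \<in> arity_ops P (length as)\<rbrakk> \<Longrightarrow>
      oper A \<mu> as \<in> carrier A"
    and oper_add_op: "\<lbrakk>set as \<subseteq> carrier A; \<mu> \<in> arity_ops P (length as); \<nu> \<in> arity_ops P (length as)\<rbrakk> \<Longrightarrow>
      oper A (\<mu> \<oplus>\<^bsub>opmod P (length as)\<^esub> \<nu>) as = oper A \<mu> as \<oplus>\<^bsub>A\<^esub> oper A \<nu> as"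
    and oper_smult_op: "\<lbrakk>r \<in> carrier R; set as \<subseteq> carrier A; \<mu> \<in> arity_ops P (length as)\<rbrakk> \<Longrightarrow>
      oper A (r \<odot>\<^bsub>opmod P (length as)\<^esub> \<mu>) as = r \<odot>\<^bsub>A\<^esub> oper A \<mu> as"
    and oper_add_arg:
      "\<lbrakk>set as \<subseteq> carrier A; \<mu> \<in> arity_ops P (length as); i < length as; x \<in> carrier A; y \<in> carrier A\<rbrakk> \<Longrightarrow>
      oper A \<mu> (as[i := x \<oplus>\<^bsub>A\<^esub> y]) = oper A \<mu> (as[i := x]) \<oplus>\<^bsub>A\<^esub> oper A \<mu> (as[i := y])"
    and oper_smult_arg:
      "\<lbrakk>set as \<subseteq> carrier A; \<mu> \<in> arity_ops P (length as); i < length as; r \<in> carrier R; x \<in> carrier A\<rbrakk> \<Longrightarrow>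
      oper A \<mu> (as[i := r \<odot>\<^bsub>A\<^esub> x]) = r \<odot>\<^bsub>A\<^esub> oper A \<mu> (as[i := x])"
    and oper_act: "\<lbrakk>set as \<subseteq> carrier A; \<mu> \<in> arity_ops P (length as); \<sigma> permutes {..<length as}\<rbrakk> \<Longrightarrow>
      oper A (act P (length as) \<mu> \<sigma>) as = oper A \<mu> (permute_list (inv_into UNIV \<sigma>) as)"
    and oper_unit: "a \<in> carrier A \<Longrightarrow> oper A (opunit P) [a] = a"
    and oper_pcomp:
      "\<lbrakk>set xs \<subseteq> carrier A; set ys \<subseteq> carrier A; set zs \<subseteq> carrier A;
        \<mu> \<in> arity_ops P (length xs + 1 + length zs); \<nu> \<in> arity_ops P (length ys)\<rbrakk> \<Longrightarrow>
      oper A (pcomp P (length xs + 1 + length zs) (length xs) (length ys) \<mu> \<nu>) (xs @ ys @ zs)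
        = oper A \<mu> (xs @ [oper A \<nu> ys] @ zs)"

definition alg_hom :: "('r, 's) ring_scheme \<Rightarrow> ('r, 'p) operad \<Rightarrow>
    ('r, 'p, 'a) operad_alg \<Rightarrow> ('r, 'p, 'b) operad_alg \<Rightarrow> ('a \<Rightarrow> 'b) set"
  where "alg_hom R P A B = {f.
    f \<in> carrier A \<rightarrow> carrier B \<and>
    (\<forall>x\<in>carrier A. \<forall>y\<in>carrier A. f (x \<oplus>\<^bsub>A\<^esub> y) = f x \<oplus>\<^bsub>B\<^esub> f y) \<and>
    (\<forall>r\<in>carrier R. \<forall>x\<in>carrier A. f (r \<odot>\<^bsub>A\<^esub> x) = r \<odot>\<^bsub>B\<^esub> f x) \<and>
    (\<forall>as \<mu>. set as \<subseteq> carrier A \<longrightarrow> \<mu> \<in> arity_ops P (length as) \<longrightarrow>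
      f (oper A \<mu> as) = oper B \<mu> (map f as))}"

definition alg_ideal :: "('r, 's) ring_scheme \<Rightarrow> ('r, 'p) operad \<Rightarrow> ('r, 'p, 'a) operad_alg \<Rightarrow> 'a set \<Rightarrow> bool"
  where "alg_ideal R P A I \<longleftrightarrow> submodule I R A \<and>
    (\<forall>as \<mu>. set as \<subseteq> carrier A \<longrightarrow> \<mu> \<in> arity_ops P (length as) \<longrightarrow> set as \<inter> I \<noteq> {} \<longrightarrow>
      oper A \<mu> as \<in> I)"

definition alg_ideal_gen ::
    "('r, 's) ring_scheme \<Rightarrow> ('r, 'p) operad \<Rightarrow> ('r, 'p, 'a) operad_alg \<Rightarrow> 'a set \<Rightarrow> 'a set"
  where "alg_ideal_gen R P A X = \<Inter>{I. alg_ideal R P A I \<and> X \<subseteq> I}"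

definition with_oper :: "('r, 'a) module \<Rightarrow> ('p \<Rightarrow> 'a list \<Rightarrow> 'a) \<Rightarrow> ('r, 'p, 'a) operad_alg"
  where "with_oper M f =
    \<lparr>carrier = carrier M, monoid.mult = monoid.mult M, one = one M, zero = zero M, add = add M, smult = smult M,
     oper = f\<rparr>"

definition quot_alg :: "('r, 'p, 'a) operad_alg \<Rightarrow> 'a set \<Rightarrow> ('r, 'p, 'a set) operad_alg"
  where "quot_alg A I = with_oper (quot_module A I) (\<lambda>\<mu> Cs. \<Union>as\<in>listset Cs. I +>\<^bsub>A\<^esub> oper A \<mu> as)"


section \<open>The free algebra on a module\<close>

text \<open>
  \<open>S(P,V) = \<Oplus>\<^sub>n (P(n) \<otimes> V\<^bsup>\<otimes>n\<^esup>)\<^bsub>\<Sigma>(n)\<^esub>\<close> is built as the free \<open>R\<close>-module on all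
  \<open>(\<mu>, vs)\<close> with \<open>\<mu> \<in> P(n)\<close> and \<open>vs \<in> V\<^sup>n\<close>, \<open>n \<ge> 0\<close>, standing for the pure tensors
  \<open>\<mu> \<otimes> v\<^sub>0 \<otimes> \<dots> \<otimes> v\<^sub>n\<^sub>-\<^sub>1\<close>, modulo multilinearity and \<open>\<mu>\<sigma> \<otimes> v = \<mu> \<otimes> \<sigma>v\<close>.  All relations
  are homogeneous in \<open>n = length vs\<close>, which gives the direct sum; balancedness
  \<open>r\<mu> \<otimes> v = \<mu> \<otimes> rv\<close> follows from homogeneity in each factor.
\<close>

type_synonym ('p, 'v) tensor = "'p \<times> 'v list"

definition pure_tensors :: "('r, 'p) operad \<Rightarrow> ('r, 'v, 't) module_scheme \<Rightarrow> ('p, 'v) tensor set"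
  where "pure_tensors P V = {(\<mu>, vs). set vs \<subseteq> carrier V \<and> \<mu> \<in> arity_ops P (length vs)}"

abbreviation tensor_free_module :: "('r, 's) ring_scheme \<Rightarrow> ('r, 'p) operad \<Rightarrow>
    ('r, 'v, 't) module_scheme \<Rightarrow> ('r, ('p, 'v) tensor \<Rightarrow> 'r) module"
  where "tensor_free_module R P V \<equiv> free_module R (pure_tensors P V)"

definition tensor_relations :: "('r, 's) ring_scheme \<Rightarrow> ('r, 'p) operad \<Rightarrow>
    ('r, 'v, 't) module_scheme \<Rightarrow> (('p, 'v) tensor \<Rightarrow> 'r) set"
  where "tensor_relations R P V = (let F = tensor_free_module R P V; \<delta> = basis_elt R in
    {\<delta> (\<mu> \<oplus>\<^bsub>opmod P (length vs)\<^esub> \<nu>, vs) \<ominus>\<^bsub>F\<^esub> (\<delta> (\<mu>, vs) \<oplus>\<^bsub>F\<^esub> \<delta> (\<nu>, vs)) | \<mu> \<nu> vs.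
       set vs \<subseteq> carrier V \<and> \<mu> \<in> arity_ops P (length vs) \<and> \<nu> \<in> arity_ops P (length vs)}
    \<union> {\<delta> (r \<odot>\<^bsub>opmod P (length vs)\<^esub> \<mu>, vs) \<ominus>\<^bsub>F\<^esub> (r \<odot>\<^bsub>F\<^esub> \<delta> (\<mu>, vs)) | r \<mu> vs.
       r \<in> carrier R \<and> set vs \<subseteq> carrier V \<and> \<mu> \<in> arity_ops P (length vs)}
    \<union> {\<delta> (\<mu>, vs[i := x \<oplus>\<^bsub>V\<^esub> y]) \<ominus>\<^bsub>F\<^esub> (\<delta> (\<mu>, vs[i := x]) \<oplus>\<^bsub>F\<^esub> \<delta> (\<mu>, vs[i := y])) | \<mu> vs i x y.
       set vs \<subseteq> carrier V \<and> \<mu> \<in> arity_ops P (length vs) \<and> i < length vs \<and>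
       x \<in> carrier V \<and> y \<in> carrier V}
    \<union> {\<delta> (\<mu>, vs[i := r \<odot>\<^bsub>V\<^esub> x]) \<ominus>\<^bsub>F\<^esub> (r \<odot>\<^bsub>F\<^esub> \<delta> (\<mu>, vs[i := x])) | \<mu> vs i r x.
       set vs \<subseteq> carrier V \<and> \<mu> \<in> arity_ops P (length vs) \<and> i < length vs \<and>
       r \<in> carrier R \<and> x \<in> carrier V}
    \<union> {\<delta> (act P (length vs) \<mu> \<sigma>, vs) \<ominus>\<^bsub>F\<^esub> \<delta> (\<mu>, permute_list (inv_into UNIV \<sigma>) vs) | \<mu> \<sigma> vs.
       set vs \<subseteq> carrier V \<and> \<mu> \<in> arity_ops P (length vs) \<and> \<sigma> permutes {..<length vs}})"

text \<open>
  \<open>full_comp P 0 \<mu> ts\<close> is the total composition \<open>\<mu>(\<nu>\<^sub>0, \<dots>, \<nu>\<^sub>k\<^sub>-\<^sub>1)\<close> where \<open>ts ! i = (\<nu>\<^sub>i, vs\<^sub>i)\<close> and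
  \<open>\<nu>\<^sub>i\<close> has arity \<open>length vs\<^sub>i\<close>.  It is computed from left to right; \<open>q\<close> is the number of inputs
  in front of the next slot, so that the current operation has arity \<open>q + length ts\<close>.
\<close>

primrec full_comp :: "('r, 'p) operad \<Rightarrow> nat \<Rightarrow> 'p \<Rightarrow> ('p, 'v) tensor list \<Rightarrow> 'p"
  where
    "full_comp P q \<mu> [] = \<mu>"
  | "full_comp P q \<mu> (t # ts) =
      full_comp P (q + length (snd t))
        (pcomp P (q + 1 + length ts) q (length (snd t)) \<mu> (fst t)) ts"

definition tensor_free_oper :: "('r, 's) ring_scheme \<Rightarrow> ('r, 'p) operad \<Rightarrow> ('r, 'v, 't) module_scheme \<Rightarrow>
    'p \<Rightarrow> (('p, 'v) tensor \<Rightarrow> 'r) list \<Rightarrow> ('p, 'v) tensor \<Rightarrow> 'r"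
  where "tensor_free_oper R P V \<mu> fs = multilin_ext R (tensor_free_module R P V) fs
    (\<lambda>ts. basis_elt R (full_comp P 0 \<mu> ts, concat (map snd ts)))"

definition free_alg :: "('r, 's) ring_scheme \<Rightarrow> ('r, 'p) operad \<Rightarrow> ('r, 'v, 't) module_scheme \<Rightarrow>
    ('r, 'p, (('p, 'v) tensor \<Rightarrow> 'r) set) operad_alg"
  where "free_alg R P V =
    (let F = tensor_free_module R P V; K = submodule_gen R F (tensor_relations R P V)
     in with_oper (quot_module F K)
          (\<lambda>\<mu> Cs. \<Union>fs\<in>listset Cs. K +>\<^bsub>F\<^esub> tensor_free_oper R P V \<mu> fs))"

definition free_incl :: "('r, 's) ring_scheme \<Rightarrow> ('r, 'p) operad \<Rightarrow> ('r, 'v, 't) module_scheme \<Rightarrow>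
    'v \<Rightarrow> (('p, 'v) tensor \<Rightarrow> 'r) set"
  where "free_incl R P V v =
    (let F = tensor_free_module R P V; K = submodule_gen R F (tensor_relations R P V)
     in K +>\<^bsub>F\<^esub> basis_elt R (opunit P, [v]))"


section \<open>The tangent functor\<close>

definition tangent :: "('r, 'p, 'a) operad_alg \<Rightarrow> ('r, 'p, 'a \<times> 'a) operad_alg"
  where "tangent A = with_oper (prod_module A A)
    (\<lambda>\<mu> ps. (oper A \<mu> (map fst ps),
             finsum A (\<lambda>i. oper A \<mu> ((map fst ps)[i := snd (ps ! i)])) {..<length ps}))"

definition tangent_map :: "('a \<Rightarrow> 'b) \<Rightarrow> 'a \<times> 'a \<Rightarrow> 'b \<times> 'b"
  where "tangent_map f = map_prod f f"


section \<open>The adjoint tangent functor\<close>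

text \<open>
  \<open>T\<degree>(A) = Free\<^sub>A(\<Omega>\<^sub>A)\<close>, presented as a quotient of \<open>S(P, A \<times> A)\<close>: \<open>(a, 0)\<close> is written \<open>a\<close>
  (\<open>adj_pt\<close>) and \<open>(0, a)\<close> is written \<open>d(a)\<close> (\<open>adj_d\<close>).
\<close>

type_synonym ('r, 'p, 'a) adj = "(('p, 'a \<times> 'a) tensor \<Rightarrow> 'r) set set"

definition adj_relations :: "('r, 's) ring_scheme \<Rightarrow> ('r, 'p) operad \<Rightarrow> ('r, 'p, 'a) operad_alg \<Rightarrow>
    (('p, 'a \<times> 'a) tensor \<Rightarrow> 'r) set set"
  where "adj_relations R P A =
    (let V = prod_module A A; S = free_alg R P V; j = free_incl R P V in
    {oper S \<mu> (map (\<lambda>a. j (a, \<zero>\<^bsub>A\<^esub>)) as) \<ominus>\<^bsub>S\<^esub> j (oper A \<mu> as, \<zero>\<^bsub>A\<^esub>) | \<mu> as.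
       set as \<subseteq> carrier A \<and> \<mu> \<in> arity_ops P (length as)}
    \<union> {j (\<zero>\<^bsub>A\<^esub>, oper A \<mu> as) \<ominus>\<^bsub>S\<^esub>
         finsum S (\<lambda>i. oper S \<mu> ((map (\<lambda>a. j (a, \<zero>\<^bsub>A\<^esub>)) as)[i := j (\<zero>\<^bsub>A\<^esub>, as ! i)])) {..<length as} | \<mu> as.
       set as \<subseteq> carrier A \<and> \<mu> \<in> arity_ops P (length as)})"

definition adj_ideal :: "('r, 's) ring_scheme \<Rightarrow> ('r, 'p) operad \<Rightarrow> ('r, 'p, 'a) operad_alg \<Rightarrow>
    (('p, 'a \<times> 'a) tensor \<Rightarrow> 'r) set set"
  where "adj_ideal R P A = alg_ideal_gen R P (free_alg R P (prod_module A A)) (adj_relations R P A)"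

definition adj_tangent :: "('r, 's) ring_scheme \<Rightarrow> ('r, 'p) operad \<Rightarrow> ('r, 'p, 'a) operad_alg \<Rightarrow>
    ('r, 'p, ('r, 'p, 'a) adj) operad_alg"
  where "adj_tangent R P A = quot_alg (free_alg R P (prod_module A A)) (adj_ideal R P A)"

definition adj_pt :: "('r, 's) ring_scheme \<Rightarrow> ('r, 'p) operad \<Rightarrow> ('r, 'p, 'a) operad_alg \<Rightarrow>
    'a \<Rightarrow> ('r, 'p, 'a) adj"
  where "adj_pt R P A a = adj_ideal R P A +>\<^bsub>free_alg R P (prod_module A A)\<^esub>
    free_incl R P (prod_module A A) (a, \<zero>\<^bsub>A\<^esub>)"

definition adj_d :: "('r, 's) ring_scheme \<Rightarrow> ('r, 'p) operad \<Rightarrow> ('r, 'p, 'a) operad_alg \<Rightarrow>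
    'a \<Rightarrow> ('r, 'p, 'a) adj"
  where "adj_d R P A a = adj_ideal R P A +>\<^bsub>free_alg R P (prod_module A A)\<^esub>
    free_incl R P (prod_module A A) (\<zero>\<^bsub>A\<^esub>, a)"

text \<open>
  The algebra morphism out of \<open>adj_tangent R P A\<close> with prescribed values on the generators,
  extensional so that the description is unique as a HOL function.
\<close>

definition adj_rec :: "('r, 's) ring_scheme \<Rightarrow> ('r, 'p) operad \<Rightarrow> ('r, 'p, 'a) operad_alg \<Rightarrow>
    ('r, 'p, 'b) operad_alg \<Rightarrow> ('a \<Rightarrow> 'b) \<Rightarrow> ('a \<Rightarrow> 'b) \<Rightarrow> ('r, 'p, 'a) adj \<Rightarrow> 'b"
  where "adj_rec R P A B u v = (THE h.
    h \<in> extensional (carrier (adj_tangent R P A)) \<and> h \<in> alg_hom R P (adj_tangent R P A) B \<and>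
    (\<forall>a\<in>carrier A. h (adj_pt R P A a) = u a \<and> h (adj_d R P A a) = v a))"

definition adj_tangent_map :: "('r, 's) ring_scheme \<Rightarrow> ('r, 'p) operad \<Rightarrow>
    ('r, 'p, 'a) operad_alg \<Rightarrow> ('r, 'p, 'b) operad_alg \<Rightarrow> ('a \<Rightarrow> 'b) \<Rightarrow>
    ('r, 'p, 'a) adj \<Rightarrow> ('r, 'p, 'b) adj"
  where "adj_tangent_map R P A B f =
    adj_rec R P A (adj_tangent R P B) (\<lambda>a. adj_pt R P B (f a)) (\<lambda>a. adj_d R P B (f a))"

definition adj_unit :: "('r, 's) ring_scheme \<Rightarrow> ('r, 'p) operad \<Rightarrow> ('r, 'p, 'a) operad_alg \<Rightarrow>
    'a \<Rightarrow> ('r, 'p, 'a) adj \<times> ('r, 'p, 'a) adj"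
  where "adj_unit R P A a = (adj_pt R P A a, adj_d R P A a)"

definition adj_counit :: "('r, 's) ring_scheme \<Rightarrow> ('r, 'p) operad \<Rightarrow> ('r, 'p, 'a) operad_alg \<Rightarrow>
    ('r, 'p, 'a \<times> 'a) adj \<Rightarrow> 'a"
  where "adj_counit R P A = adj_rec R P (tangent A) A fst snd"

end

theory Submission
  imports Defs
begin

text \<open>
  The crux is that \<open>S(P, V)\<close> is an algebra.  Total composition is strictly associative, and its
  equivariance is reduced, tensor by tensor, to the defining relation \<open>\<mu>\<sigma> \<otimes> v = \<mu> \<otimes> \<sigma>v\<close>: an
  argument \<open>\<nu> \<otimes> v\<^sub>0 \<otimes> \<dots> \<otimes> v\<^sub>k\<^sub>-\<^sub>1\<close> can be traded for composing with \<open>\<nu>\<close> and inserting the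
  arguments \<open>1 \<otimes> v\<^sub>i\<close>, which turns the operadic equivariance axiom into an induction step.
  All other axioms follow by multilinearity from the case of pure tensors.

  The relations of \<open>T\<degree>(A)\<close> say exactly that \<open>a \<mapsto> (u a, v a)\<close> is a morphism from \<open>A\<close> to the
  tangent algebra of \<open>B\<close> if and only if \<open>a \<mapsto> u a\<close>, \<open>d(a) \<mapsto> v a\<close> extends to a morphism from \<open>T\<degree>(A)\<close> to \<open>B\<close>.
  The unit and counit correspond to identities under this bijection, and every equation between
  morphisms out of \<open>T\<degree>(A)\<close> can be checked on the generators.
\<close>

section \<open>Linear and multilinear maps\<close>

text \<open>The operations of \<open>S(P, V)\<close> are defined on formal sums of tensors by total
  composition and only then pushed to the quotient. On formal sums equivariance fails, since
  \<open>\<mu>\<sigma>\<close> with a list and \<open>\<mu>\<close> with the permuted list are in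
  general different basis elements. So the axioms are demanded modulo a submodule only, and that the
  operations respect this submodule is a separate claim; equivariance in an inner operation
  \<open>\<nu>\<tau>\<close> enters there.

  A direct treatment of equivariance would need permutations that move blocks of varying lengths all
  at once. Arguments \<open>1 \<otimes> v\<close> are blocks of length one: on them the block
  permutation is \<open>\<sigma>\<close> itself. Opening one argument at a time involves a single
  longer block, which is the situation of the axioms for partial composition.

  Operations on classes are unions over representatives, hence usable only after all members of such
  a union have been shown equal.\<close>

definition lin_map :: "('r, 's) ring_scheme \<Rightarrow> ('r, 'a, 'x) module_scheme \<Rightarrow> ('r, 'b, 'y) module_scheme \<Rightarrow>
    ('a \<Rightarrow> 'b) \<Rightarrow> bool"
  where "lin_map R M N f \<longleftrightarrow> f \<in> carrier M \<rightarrow> carrier N \<and>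
    (\<forall>x\<in>carrier M. \<forall>y\<in>carrier M. f (x \<oplus>\<^bsub>M\<^esub> y) = f x \<oplus>\<^bsub>N\<^esub> f y) \<and>
    (\<forall>r\<in>carrier R. \<forall>x\<in>carrier M. f (r \<odot>\<^bsub>M\<^esub> x) = r \<odot>\<^bsub>N\<^esub> f x)"

text \<open>Generation is phrased as an induction principle over submodules: a property holds for
  all elements as soon as it cuts out a submodule containing \<open>X\<close>, and no linear
  combinations have to be written down.\<close>

definition spans :: "('r, 's) ring_scheme \<Rightarrow> ('r, 'a, 'x) module_scheme \<Rightarrow> 'a set \<Rightarrow> bool"
  where "spans R M X \<longleftrightarrow> X \<subseteq> carrier M \<and> (\<forall>N. submodule N R M \<longrightarrow> X \<subseteq> N \<longrightarrow> carrier M \<subseteq> N)"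

lemma lin_mapI:
  assumes "\<And>x. x \<in> carrier M \<Longrightarrow> f x \<in> carrier N"
    and "\<And>x y. x \<in> carrier M \<Longrightarrow> y \<in> carrier M \<Longrightarrow> f (x \<oplus>\<^bsub>M\<^esub> y) = f x \<oplus>\<^bsub>N\<^esub> f y"
    and "\<And>r x. r \<in> carrier R \<Longrightarrow> x \<in> carrier M \<Longrightarrow> f (r \<odot>\<^bsub>M\<^esub> x) = r \<odot>\<^bsub>N\<^esub> f x"
  shows "lin_map R M N f"
  using assms by (simp add: lin_map_def)

lemma lin_mapD:
  assumes "lin_map R M N f"
  shows "x \<in> carrier M \<Longrightarrow> f x \<in> carrier N"
    and "x \<in> carrier M \<Longrightarrow> y \<in> carrier M \<Longrightarrow> f (x \<oplus>\<^bsub>M\<^esub> y) = f x \<oplus>\<^bsub>N\<^esub> f y"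
    and "r \<in> carrier R \<Longrightarrow> x \<in> carrier M \<Longrightarrow> f (r \<odot>\<^bsub>M\<^esub> x) = r \<odot>\<^bsub>N\<^esub> f x"
  using assms by (auto simp: lin_map_def)

lemma lin_map_cong:
  assumes "\<And>x. x \<in> carrier M \<Longrightarrow> f x = g x" "lin_map R M N f" "module R M"
  shows "lin_map R M N g"
proof -
  interpret M: module R M by fact
  show ?thesis
    using lin_mapD[OF assms(2)] assms(1)[symmetric] by (intro lin_mapI) simp_all
qed

lemma lin_map_compose:
  "lin_map R M N f \<Longrightarrow> lin_map R N L g \<Longrightarrow> lin_map R M L (\<lambda>x. g (f x))"
  by (auto simp: lin_map_def Pi_iff)

lemma lin_map_id: "lin_map R M M (\<lambda>x. x)"
  by (auto simp: lin_map_def)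

context
  fixes R :: "('r, 's) ring_scheme" (structure)
    and M :: "('r, 'a, 'x) module_scheme"
    and N :: "('r, 'b, 'y) module_scheme"
  assumes M: "module R M" and N: "module R N"
begin

interpretation M: module R M by (rule M)
interpretation N: module R N by (rule N)

lemma lin_map_zero:
  assumes "lin_map R M N f"
  shows "f \<zero>\<^bsub>M\<^esub> = \<zero>\<^bsub>N\<^esub>"
proof -
  \<comment> \<open>\<open>lin_map\<close> asks for additivity and homogeneity only; the value at
    zero comes from homogeneity with the scalar zero.\<close>
  have "f (\<zero> \<odot>\<^bsub>M\<^esub> \<zero>\<^bsub>M\<^esub>) = \<zero> \<odot>\<^bsub>N\<^esub> f \<zero>\<^bsub>M\<^esub>"
    by (rule lin_mapD[OF assms]) auto
  then show ?thesis using lin_mapD(1)[OF assms M.M.zero_closed] by simp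
qed

lemma lin_map_uminus:
  assumes "lin_map R M N f" "x \<in> carrier M"
  shows "f (\<ominus>\<^bsub>M\<^esub> x) = \<ominus>\<^bsub>N\<^esub> f x"
proof -
  have "f (\<ominus>\<^bsub>M\<^esub> x) \<oplus>\<^bsub>N\<^esub> f x = \<zero>\<^bsub>N\<^esub>"
    using assms by (simp flip: lin_mapD(2)[OF assms(1)] add: M.M.l_neg lin_map_zero)
  then show ?thesis
    using lin_mapD(1)[OF assms(1)] assms(2) by (metis M.M.a_inv_closed N.M.minus_equality)
qed

lemma lin_map_minus:
  assumes "lin_map R M N f" "x \<in> carrier M" "y \<in> carrier M"
  shows "f (x \<ominus>\<^bsub>M\<^esub> y) = f x \<ominus>\<^bsub>N\<^esub> f y"
  using assms by (simp add: a_minus_def lin_mapD lin_map_uminus)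

lemma lin_map_finsum:
  assumes "lin_map R M N f" "finite A" "\<And>i. i \<in> A \<Longrightarrow> g i \<in> carrier M"
  shows "f (finsum M g A) = finsum N (\<lambda>i. f (g i)) A"
  using assms(2,3)
proof (induction A rule: finite_induct)
  case empty
  then show ?case by (simp add: lin_map_zero[OF assms(1)])
next
  case (insert a A)
  then have "g \<in> A \<rightarrow> carrier M" "(\<lambda>i. f (g i)) \<in> A \<rightarrow> carrier N"
    using lin_mapD(1)[OF assms(1)] by auto
  with insert show ?case
    by (simp add: lin_mapD[OF assms(1)] M.M.finsum_insert N.M.finsum_insert)
qed

lemma submodule_equalizer:
  assumes "lin_map R M N f" "lin_map R M N g"
  shows "submodule {x \<in> carrier M. f x = g x} R M"
  by (rule M.submoduleI)
    (auto simp: lin_map_zero lin_mapD[OF assms(1)] lin_mapD[OF assms(2)] assms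
      lin_map_uminus[OF assms(1)] lin_map_uminus[OF assms(2)])

lemma submodule_kernel:
  assumes "lin_map R M N f"
  shows "submodule {x \<in> carrier M. f x = \<zero>\<^bsub>N\<^esub>} R M"
  by (rule M.submoduleI) (auto simp: lin_map_zero lin_mapD[OF assms] assms lin_map_uminus[OF assms])

text \<open>The equalizer of two linear maps is a submodule, and it contains \<open>X\<close>, so it
  is the whole carrier. The later comparisons on bases and pure tensors rest on this.\<close>

lemma lin_map_ext:
  assumes "spans R M X" "lin_map R M N f" "lin_map R M N g" "\<And>x. x \<in> X \<Longrightarrow> f x = g x" "x \<in> carrier M"
  shows "f x = g x"
proof -
  have "X \<subseteq> {x \<in> carrier M. f x = g x}" using assms(1,4) by (auto simp: spans_def)
  then have "carrier M \<subseteq> {x \<in> carrier M. f x = g x}"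
    using assms(1) submodule_equalizer[OF assms(2,3)] by (auto simp: spans_def)
  then show ?thesis using assms(5) by auto
qed

lemma lin_map_add:
  assumes "lin_map R M N f" "lin_map R M N g"
  shows "lin_map R M N (\<lambda>x. f x \<oplus>\<^bsub>N\<^esub> g x)"
  using lin_mapD[OF assms(1)] lin_mapD[OF assms(2)]
  by (intro lin_mapI) (simp_all add: N.M.a_ac N.smult_r_distr)

lemma lin_map_smult:
  assumes "lin_map R M N f" "r \<in> carrier R"
  shows "lin_map R M N (\<lambda>x. r \<odot>\<^bsub>N\<^esub> f x)"
  using lin_mapD[OF assms(1)] assms(2)
  by (intro lin_mapI) (simp_all add: N.smult_r_distr M.R.m_comm flip: N.smult_assoc1)

lemma lin_map_const_zero: "lin_map R M N (\<lambda>x. \<zero>\<^bsub>N\<^esub>)"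
  by (intro lin_mapI) simp_all

lemma lin_map_sum:
  assumes "finite A" "\<And>i. i \<in> A \<Longrightarrow> lin_map R M N (f i)"
  shows "lin_map R M N (\<lambda>x. finsum N (\<lambda>i. f i x) A)"
  using assms
proof (induction A rule: finite_induct)
  case empty
  then show ?case by (simp add: lin_map_const_zero)
next
  case (insert a A)
  have "lin_map R M N (\<lambda>x. f a x \<oplus>\<^bsub>N\<^esub> finsum N (\<lambda>i. f i x) A)"
    using insert by (intro lin_map_add) auto
  then show ?case
  \<comment> \<open>\<open>finsum\<close> obeys its recursion only for summands in the carrier, so
    the two functions are compared on \<open>carrier M\<close> alone.\<close>
  proof (rule lin_map_cong[rotated, OF _ M])
    fix x assume "x \<in> carrier M"
    then have "f i x \<in> carrier N" if "i \<in> insert a A" for i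
      using insert.prems[OF that] by (auto simp: lin_map_def)
    then show "f a x \<oplus>\<^bsub>N\<^esub> finsum N (\<lambda>i. f i x) A = finsum N (\<lambda>i. f i x) (insert a A)"
      using insert.hyps by (subst N.M.finsum_insert) auto
  qed
qed

end

text \<open>\<open>J\<close> is the set of positions in which \<open>G\<close> is required to be
  linear. Full multilinearity is \<open>J = {..<n}\<close>; a smaller \<open>J\<close> describes a
  map with some entries frozen, as happens when one argument is a fixed element of a
  submodule.\<close>

definition multilin :: "('r, 's) ring_scheme \<Rightarrow> ('r, 'a, 'x) module_scheme \<Rightarrow> ('r, 'b, 'y) module_scheme \<Rightarrow>
    nat \<Rightarrow> nat set \<Rightarrow> ('a list \<Rightarrow> 'b) \<Rightarrow> bool"
  where "multilin R M N n J G \<longleftrightarrow> (\<forall>as. set as \<subseteq> carrier M \<and> length as = n \<longrightarrow>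
    G as \<in> carrier N \<and> (\<forall>j\<in>J. lin_map R M N (\<lambda>x. G (as[j := x]))))"

lemma multilinI:
  assumes "\<And>as. set as \<subseteq> carrier M \<Longrightarrow> length as = n \<Longrightarrow> G as \<in> carrier N"
    and "\<And>as j. set as \<subseteq> carrier M \<Longrightarrow> length as = n \<Longrightarrow> j \<in> J \<Longrightarrow> lin_map R M N (\<lambda>x. G (as[j := x]))"
  shows "multilin R M N n J G"
  using assms by (simp add: multilin_def)

lemma multilinD:
  assumes "multilin R M N n J G" "set as \<subseteq> carrier M" "length as = n"
  shows "G as \<in> carrier N" "j \<in> J \<Longrightarrow> lin_map R M N (\<lambda>x. G (as[j := x]))"
  using assms by (auto simp: multilin_def)

lemma set_update_subset: "set as \<subseteq> A \<Longrightarrow> x \<in> A \<Longrightarrow> set (as[i := x]) \<subseteq> A"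
  by (rule order_trans[OF set_update_subset_insert]) simp

lemma multilin_update:
  assumes "multilin R M N n J G" "c \<in> carrier M" "i \<notin> J'" "J' \<subseteq> J"
  shows "multilin R M N n J' (\<lambda>as. G (as[i := c]))"
proof (rule multilinI)
  fix as j assume as: "set as \<subseteq> carrier M" "length as = n" and "j \<in> J'"
  then have "lin_map R M N (\<lambda>x. G (as[i := c, j := x]))"
    using assms by (intro multilinD(2)[OF assms(1)] set_update_subset) auto
  moreover have "as[j := x, i := c] = as[i := c, j := x]" for x
    using \<open>j \<in> J'\<close> \<open>i \<notin> J'\<close> by (metis list_update_swap)
  ultimately show "lin_map R M N (\<lambda>x. G (as[j := x, i := c]))" by simp
next
  fix as assume "set as \<subseteq> carrier M" "length as = n"
  then show "G (as[i := c]) \<in> carrier N"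
    using assms(2) by (intro multilinD(1)[OF assms(1)] set_update_subset) auto
qed

lemma multilin_compose:
  assumes "multilin R M N n J G" "lin_map R N L f"
  shows "multilin R M L n J (\<lambda>as. f (G as))"
proof (rule multilinI)
  fix as j assume "set as \<subseteq> carrier M" "length as = n" "j \<in> J"
  from lin_map_compose[OF multilinD(2)[OF assms(1) this] assms(2)]
  show "lin_map R M L (\<lambda>x. f (G (as[j := x])))" .
qed (use lin_mapD(1)[OF assms(2)] multilinD(1)[OF assms(1)] in blast)

lemma multilin_map:
  assumes "multilin R N L n J G" "lin_map R M N f"
  shows "multilin R M L n J (\<lambda>as. G (map f as))"
proof (rule multilinI)
  fix as j assume as: "set as \<subseteq> carrier M" "length as = n" and j: "j \<in> J"
  have "set (map f as) \<subseteq> carrier N" using as lin_mapD(1)[OF assms(2)] by auto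
  then have "lin_map R N L (\<lambda>x. G ((map f as)[j := x]))"
    using as j by (intro multilinD(2)[OF assms(1)]) auto
  from lin_map_compose[OF assms(2) this]
  show "lin_map R M L (\<lambda>x. G (map f (as[j := x])))" by (simp add: map_update)
next
  fix as assume as: "set as \<subseteq> carrier M" "length as = n"
  have "set (map f as) \<subseteq> carrier N" using as lin_mapD(1)[OF assms(2)] by auto
  then show "G (map f as) \<in> carrier L"
    using as by (intro multilinD(1)[OF assms(1)]) auto
qed

text \<open>In the normalisation of the right action,
  \<open>permute_list (inv_into UNIV \<sigma>)\<close> carries the entry at \<open>j\<close> to
  position \<open>\<sigma> j\<close>, so an update travels with its entry.\<close>

lemma permute_list_update:
  assumes "\<sigma> permutes {..<length as}" "j < length as"
  shows "permute_list (inv_into UNIV \<sigma>) (as[j := x]) = (permute_list (inv_into UNIV \<sigma>) as)[\<sigma> j := x]"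
proof (rule nth_equalityI)
  fix i assume i: "i < length (permute_list (inv_into UNIV \<sigma>) (as[j := x]))"
  have p: "inv_into UNIV \<sigma> permutes {..<length as}" using assms permutes_inv by blast
  have "inv_into UNIV \<sigma> i < length as" using permutes_in_image[OF p] i by auto
  moreover have "\<sigma> j < length as" using permutes_in_image[OF assms(1)] assms(2) by auto
  moreover have "inv_into UNIV \<sigma> i = j \<longleftrightarrow> i = \<sigma> j" using permutes_inverses[OF assms(1)] by metis
  ultimately show "permute_list (inv_into UNIV \<sigma>) (as[j := x]) ! i = (permute_list (inv_into UNIV \<sigma>) as)[\<sigma> j := x] ! i"
    using i p by (auto simp: permute_list_nth nth_list_update)
qed simp

lemma multilin_permute:
  assumes "multilin R M N n {..<n} G" "\<sigma> permutes {..<n}"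
  shows "multilin R M N n {..<n} (\<lambda>as. G (permute_list (inv_into UNIV \<sigma>) as))"
proof (rule multilinI)
  fix as j assume as: "set as \<subseteq> carrier M" "length as = n" and j: "j \<in> {..<n}"
  have p: "inv_into UNIV \<sigma> permutes {..<n}" using assms permutes_inv by blast
  have "lin_map R M N (\<lambda>x. G ((permute_list (inv_into UNIV \<sigma>) as)[\<sigma> j := x]))"
    using as j p assms permutes_in_image[OF assms(2)]
    by (intro multilinD(2)[OF assms(1)]) auto
  then show "lin_map R M N (\<lambda>x. G (permute_list (inv_into UNIV \<sigma>) (as[j := x])))"
    using assms(2) as j by (simp add: permute_list_update)
next
  fix as assume as: "set as \<subseteq> carrier M" "length as = n"
  have p: "inv_into UNIV \<sigma> permutes {..<n}" using assms permutes_inv by blast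
  then show "G (permute_list (inv_into UNIV \<sigma>) as) \<in> carrier N"
    using as by (intro multilinD(1)[OF assms(1)]) auto
qed

text \<open>The map is \<open>G\<close> with \<open>H\<close> plugged into slot \<open>i\<close>,
  read as a function of one undivided argument list; in this shape both sides of the composition law
  can be compared on a spanning set. A position lies before, inside or after the block of length
  \<open>m\<close>, and the map is linear there through \<open>f\<close>, through \<open>H\<close>
  followed by slot \<open>i\<close> of \<open>G\<close>, or through \<open>f\<close> again.\<close>

lemma multilin_insert:
  assumes G: "multilin R N L (i + 1 + k) {..<i + 1 + k} G" and H: "multilin R M N m {..<m} H"
    and MN: "lin_map R M N f"
  shows "multilin R M L (i + m + k) {..<i + m + k}
    (\<lambda>as. G (map f (take i as) @ [H (take m (drop i as))] @ map f (drop (i + m) as)))"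
proof (rule multilinI)
  have f: "f x \<in> carrier N" if "x \<in> carrier M" for x using that lin_mapD(1)[OF MN] by auto
  fix as assume as: "set as \<subseteq> carrier M" "length as = i + m + k"
  have 1: "set (take i as) \<subseteq> carrier M" "set (take m (drop i as)) \<subseteq> carrier M"
    "set (drop (i + m) as) \<subseteq> carrier M"
    using as by (meson order_trans set_take_subset set_drop_subset)+
  have Hc: "H (take m (drop i as)) \<in> carrier N"
    using 1 as by (intro multilinD(1)[OF H]) auto
  have sub: "set (map f (take i as) @ [H (take m (drop i as))] @ map f (drop (i + m) as)) \<subseteq> carrier N"
    using Hc 1 f by auto
  show "G (map f (take i as) @ [H (take m (drop i as))] @ map f (drop (i + m) as)) \<in> carrier L"
    using sub as by (intro multilinD(1)[OF G]) auto
  fix j assume j: "j \<in> {..<i + m + k}"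
  let ?l = "map f (take i as) @ [H (take m (drop i as))] @ map f (drop (i + m) as)"
  have lin: "lin_map R N L (\<lambda>x. G (?l[j' := x]))" if "j' < i + 1 + k" for j'
    using sub as that by (intro multilinD(2)[OF G]) auto
  consider "j < i" | "i \<le> j" "j < i + m" | "i + m \<le> j" by linarith
  then show "lin_map R M L (\<lambda>x. G (map f (take i (as[j := x])) @ [H (take m (drop i (as[j := x])))]
      @ map f (drop (i + m) (as[j := x]))))"
  proof cases
    case 1
    have "map f (take i (as[j := x])) @ [H (take m (drop i (as[j := x])))] @ map f (drop (i + m) (as[j := x]))
      = ?l[j := f x]" for x
      using 1 as by (simp add: list_update_append take_update_swap map_update)
    then show ?thesis using lin_map_compose[OF MN lin, of j] 1 by simp
  next
    case 2
    have e: "map f (take i (as[j := x])) @ [H (take m (drop i (as[j := x])))] @ map f (drop (i + m) (as[j := x]))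
      = ?l[i := H ((take m (drop i as))[j - i := x])]" for x
      using 2 as by (simp add: list_update_append take_update_swap map_update drop_update_swap list_update_beyond)
    have "lin_map R M N (\<lambda>x. H ((take m (drop i as))[j - i := x]))"
      using 2 as \<open>set (take m (drop i as)) \<subseteq> carrier M\<close> by (intro multilinD(2)[OF H]) auto
    from lin_map_compose[OF this lin, of i] show ?thesis unfolding e by simp
  next
    case 3
    \<comment> \<open>The block of length \<open>m\<close> is replaced by one entry, so later
      positions move left by \<open>m - 1\<close>; for \<open>m = 0\<close> they move right by one,
      which \<open>j + 1 - m\<close> also covers.\<close>
    have "map f (take i (as[j := x])) @ [H (take m (drop i (as[j := x])))] @ map f (drop (i + m) (as[j := x]))
      = ?l[j + 1 - m := f x]" for x
    proof -
      obtain d where d: "j = i + m + d" using 3 le_Suc_ex by blast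
      show ?thesis unfolding d using as j d
        by (simp add: list_update_append drop_update_swap map_update Suc_diff_le)
    qed
    then show ?thesis using lin_map_compose[OF MN lin, of "j + 1 - m"] 3 j by auto
  qed
qed

context
  fixes R :: "('r, 's) ring_scheme" (structure)
    and M :: "('r, 'a, 'x) module_scheme"
    and N :: "('r, 'b, 'y) module_scheme"
  assumes M: "module R M" and N: "module R N"
begin

interpretation M: module R M by (rule M)
interpretation N: module R N by (rule N)

lemma multilin_add:
  assumes "multilin R M N n J G" "multilin R M N n J H"
  shows "multilin R M N n J (\<lambda>as. G as \<oplus>\<^bsub>N\<^esub> H as)"
  using multilinD[OF assms(1)] multilinD[OF assms(2)]
  by (intro multilinI lin_map_add[OF M N] N.M.a_closed) auto

lemma multilin_smult:
  assumes "multilin R M N n J G" "r \<in> carrier R"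
  shows "multilin R M N n J (\<lambda>as. r \<odot>\<^bsub>N\<^esub> G as)"
  using multilinD[OF assms(1)] assms(2)
  by (intro multilinI lin_map_smult[OF M N] N.smult_closed) auto

text \<open>Induction on \<open>K \<subseteq> J\<close>, the coordinates whose entry need no longer lie in \<open>X\<close>.\<close>

lemma multilin_agree:
  assumes X: "spans R M X" and G: "multilin R M N n J G" and H: "multilin R M N n J H"
    and "J \<subseteq> {..<n}"
    and eq: "\<And>as. set as \<subseteq> carrier M \<Longrightarrow> length as = n \<Longrightarrow> (\<forall>j\<in>J. as ! j \<in> X) \<Longrightarrow> G as = H as"
    and as: "set as \<subseteq> carrier M" "length as = n"
  shows "G as = H as"
proof -
  have "finite J" using assms(4) finite_subset by blast
  have "G as = H as" if "K \<subseteq> J" "set as \<subseteq> carrier M" "length as = n" "\<forall>j\<in>J - K. as ! j \<in> X" for K as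
    using finite_subset[OF that(1) \<open>finite J\<close>] that
  proof (induction K arbitrary: as rule: finite_induct)
    case empty
    then show ?case using eq by simp
  next
    case (insert k K)
    have k: "k \<in> J" "k < length as" using insert assms(4) by auto
    have "G (as[k := x]) = H (as[k := x])" if "x \<in> X" for x
    proof (rule insert.IH)
      have "x \<in> carrier M" using that X by (auto simp: spans_def)
      then show "set (as[k := x]) \<subseteq> carrier M" using insert.prems by (intro set_update_subset) auto
      show "\<forall>j\<in>J - K. as[k := x] ! j \<in> X"
        using that insert.prems assms(4) by (auto simp: nth_list_update)
    qed (use insert in auto)
    moreover have "as ! k \<in> carrier M" using insert.prems k by auto
    \<comment> \<open>Writing \<open>as\<close> as its own update at \<open>k\<close> makes both
      sides linear functions of the entry at \<open>k\<close>; they agree for entries in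
      \<open>X\<close> by the induction hypothesis.\<close>
    ultimately have "G (as[k := as ! k]) = H (as[k := as ! k])"
      using multilinD(2)[OF G insert.prems(2,3)] multilinD(2)[OF H insert.prems(2,3)] k(1)
        lin_map_ext[OF M N X, of "\<lambda>x. G (as[k := x])" "\<lambda>x. H (as[k := x])" "as ! k"] by blast
    then show ?case by simp
  qed
  from this[of J as] as show ?thesis by auto
qed

end

section \<open>Free modules\<close>

lemma free_module_simps:
  "carrier (free_module R X) =
    {f. (\<forall>x. f x \<in> carrier R) \<and> finite {x. f x \<noteq> \<zero>\<^bsub>R\<^esub>} \<and> {x. f x \<noteq> \<zero>\<^bsub>R\<^esub>} \<subseteq> X}"
  "\<zero>\<^bsub>free_module R X\<^esub> = (\<lambda>x. \<zero>\<^bsub>R\<^esub>)"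
  "f \<oplus>\<^bsub>free_module R X\<^esub> g = (\<lambda>x. f x \<oplus>\<^bsub>R\<^esub> g x)"
  "r \<odot>\<^bsub>free_module R X\<^esub> f = (\<lambda>x. r \<otimes>\<^bsub>R\<^esub> f x)"
  by (simp_all add: free_module_def)

context cring
begin

lemma free_module_add_closed:
  assumes "f \<in> carrier (free_module R X)" "g \<in> carrier (free_module R X)"
  shows "f \<oplus>\<^bsub>free_module R X\<^esub> g \<in> carrier (free_module R X)"
proof -
  have "{x. f x \<oplus> g x \<noteq> \<zero>} \<subseteq> {x. f x \<noteq> \<zero>} \<union> {x. g x \<noteq> \<zero>}" by auto
  then show ?thesis using assms
    by (auto simp: free_module_simps intro: finite_subset[of _ "{x. f x \<noteq> \<zero>} \<union> {x. g x \<noteq> \<zero>}"])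
qed

lemma free_module_smult_closed:
  assumes "r \<in> carrier R" "f \<in> carrier (free_module R X)"
  shows "r \<odot>\<^bsub>free_module R X\<^esub> f \<in> carrier (free_module R X)"
proof -
  have "{x. r \<otimes> f x \<noteq> \<zero>} \<subseteq> {x. f x \<noteq> \<zero>}" using assms by auto
  then show ?thesis using assms
    by (auto simp: free_module_simps intro: finite_subset[of _ "{x. f x \<noteq> \<zero>}"])
qed

lemma module_free_module: "module R (free_module R X)"
proof (rule moduleI)
  show "cring R" by (rule is_cring)
  show "abelian_group (free_module R X)"
  proof (rule abelian_groupI)
    fix f assume f: "f \<in> carrier (free_module R X)"
    have "{x. \<ominus> f x \<noteq> \<zero>} \<subseteq> {x. f x \<noteq> \<zero>}" by auto
    with f have "(\<lambda>x. \<ominus> f x) \<in> carrier (free_module R X)"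
      by (auto simp: free_module_simps intro: finite_subset[of _ "{x. f x \<noteq> \<zero>}"])
    moreover have "(\<lambda>x. \<ominus> f x) \<oplus>\<^bsub>free_module R X\<^esub> f = \<zero>\<^bsub>free_module R X\<^esub>"
      using f by (auto simp: free_module_simps l_neg)
    ultimately show "\<exists>g\<in>carrier (free_module R X). g \<oplus>\<^bsub>free_module R X\<^esub> f = \<zero>\<^bsub>free_module R X\<^esub>" by blast
  qed (auto simp: free_module_add_closed, auto simp: free_module_simps a_ac)
qed (auto simp: free_module_smult_closed, auto simp: free_module_simps l_distr r_distr m_assoc)

lemma basis_elt_closed: "x \<in> X \<Longrightarrow> basis_elt R x \<in> carrier (free_module R X)"
  by (auto simp: free_module_simps basis_elt_def intro: finite_subset[of _ "{x}"])

lemma spans_basis: "spans R (free_module R X) (basis_elt R ` X)"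
  unfolding spans_def
proof (intro conjI allI impI)
  let ?F = "free_module R X"
  interpret F: module R ?F by (rule module_free_module)
  show "basis_elt R ` X \<subseteq> carrier ?F" using basis_elt_closed by auto
  fix N assume N: "submodule N R ?F" and b: "basis_elt R ` X \<subseteq> N"
  \<comment> \<open>Induction on a finite set \<open>S\<close> containing the support, not on the
    support itself: clearing the coordinate \<open>a\<close> then gives a smaller instance whether
    or not \<open>f\<close> vanishes there.\<close>
  have "f \<in> N" if "f \<in> carrier ?F" "{x. f x \<noteq> \<zero>} \<subseteq> S" "finite S" "S \<subseteq> X" for f S
    using that(3,1,2,4)
  proof (induction S arbitrary: f rule: finite_induct)
    case empty
    then have "f = \<zero>\<^bsub>?F\<^esub>" by (auto simp: free_module_simps)
    then show ?case using F.submoduleE[OF N] by (metis F.M.r_neg ex_in_conv subsetD)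
  next
    case (insert a S)
    let ?g = "f(a := \<zero>)"
    have fa: "f a \<in> carrier R" using insert by (auto simp: free_module_simps)
    have g: "?g \<in> carrier ?F"
      using insert.prems(1) by (auto simp: free_module_simps intro: finite_subset[of _ "{x. f x \<noteq> \<zero>}"])
    have "?g \<in> N" using insert.prems by (intro insert.IH g) auto
    moreover have "f a \<odot>\<^bsub>?F\<^esub> basis_elt R a \<in> N"
      using b insert.prems fa by (intro F.submoduleE(4)[OF N]) auto
    moreover have "f = ?g \<oplus>\<^bsub>?F\<^esub> (f a \<odot>\<^bsub>?F\<^esub> basis_elt R a)"
      using insert.prems(1) fa by (auto simp: free_module_simps basis_elt_def)
    ultimately show ?case using F.submoduleE(5)[OF N] by metis
  qed
  then show "carrier ?F \<subseteq> N" by (auto simp: free_module_simps)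
qed

end

section \<open>Linear and multilinear extension of functions on a basis\<close>

context module
begin

text \<open>\<open>lin_ext\<close> sums over the support of \<open>f\<close>, which changes when
  functions are added or scaled. Zero coefficients contribute nothing, so the sums can be moved to a
  common finite index set before they are compared.\<close>

lemma lin_ext_superset:
  assumes "f \<in> carrier (free_module R X)" "\<And>x. x \<in> X \<Longrightarrow> h x \<in> carrier M"
    and "finite S" "{x. f x \<noteq> \<zero>} \<subseteq> S" "S \<subseteq> X"
  shows "lin_ext R M f h = finsum M (\<lambda>x. f x \<odot>\<^bsub>M\<^esub> h x) S"
  unfolding lin_ext_def
  using assms by (intro M.add.finprod_mono_neutral_cong_left) (auto simp: free_module_simps)

lemma lin_ext_closed:
  assumes "f \<in> carrier (free_module R X)" "\<And>x. x \<in> X \<Longrightarrow> h x \<in> carrier M"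
  shows "lin_ext R M f h \<in> carrier M"
  unfolding lin_ext_def using assms by (intro M.finsum_closed) (auto simp: free_module_simps)

lemma lin_ext_linear:
  assumes h: "\<And>x. x \<in> X \<Longrightarrow> h x \<in> carrier M"
  shows "lin_map R (free_module R X) M (\<lambda>f. lin_ext R M f h)"
proof (rule lin_mapI)
  let ?F = "free_module R X"
  fix f assume f: "f \<in> carrier ?F"
  then show "lin_ext R M f h \<in> carrier M" using h by (rule lin_ext_closed)
  let ?Sf = "{x. f x \<noteq> \<zero>}"
  have Sf: "finite ?Sf" "?Sf \<subseteq> X" and fc: "\<And>x. f x \<in> carrier R"
    using f by (auto simp: free_module_simps)
  { fix g assume g: "g \<in> carrier ?F"
    let ?S = "?Sf \<union> {x. g x \<noteq> \<zero>}"
    have S: "finite ?S" "?S \<subseteq> X" and gc: "\<And>x. g x \<in> carrier R"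
      using f g by (auto simp: free_module_simps)
    have fg: "f \<oplus>\<^bsub>?F\<^esub> g \<in> carrier ?F" using f g by (rule free_module_add_closed)
    have "lin_ext R M (f \<oplus>\<^bsub>?F\<^esub> g) h = finsum M (\<lambda>x. (f \<oplus>\<^bsub>?F\<^esub> g) x \<odot>\<^bsub>M\<^esub> h x) ?S"
      using S by (intro lin_ext_superset[OF fg h]) (auto simp: free_module_simps)
    also have "\<dots> = finsum M (\<lambda>x. f x \<odot>\<^bsub>M\<^esub> h x \<oplus>\<^bsub>M\<^esub> g x \<odot>\<^bsub>M\<^esub> h x) ?S"
      using S fc gc h by (intro M.finsum_cong') (auto simp: free_module_simps smult_l_distr)
    also have "\<dots> = finsum M (\<lambda>x. f x \<odot>\<^bsub>M\<^esub> h x) ?S \<oplus>\<^bsub>M\<^esub> finsum M (\<lambda>x. g x \<odot>\<^bsub>M\<^esub> h x) ?S"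
      using S fc gc h by (intro M.finsum_addf) auto
    also have "\<dots> = lin_ext R M f h \<oplus>\<^bsub>M\<^esub> lin_ext R M g h"
      using S by (subst (1 2) lin_ext_superset[where S = ?S and X = X]) (auto simp: f g h)
    finally show "lin_ext R M (f \<oplus>\<^bsub>?F\<^esub> g) h = lin_ext R M f h \<oplus>\<^bsub>M\<^esub> lin_ext R M g h" . }
  fix r assume r: "r \<in> carrier R"
  have rf: "r \<odot>\<^bsub>?F\<^esub> f \<in> carrier ?F" using r f by (rule free_module_smult_closed)
  have "lin_ext R M (r \<odot>\<^bsub>?F\<^esub> f) h = finsum M (\<lambda>x. (r \<odot>\<^bsub>?F\<^esub> f) x \<odot>\<^bsub>M\<^esub> h x) ?Sf"
    using Sf r by (intro lin_ext_superset[OF rf h]) (auto simp: free_module_simps)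
  also have "\<dots> = finsum M (\<lambda>x. r \<odot>\<^bsub>M\<^esub> (f x \<odot>\<^bsub>M\<^esub> h x)) ?Sf"
    using Sf fc h r by (intro M.finsum_cong') (auto simp: free_module_simps smult_assoc1)
  also have "\<dots> = r \<odot>\<^bsub>M\<^esub> lin_ext R M f h"
    unfolding lin_ext_def using Sf fc h r by (intro finsum_smult_ldistr[symmetric]) auto
  finally show "lin_ext R M (r \<odot>\<^bsub>?F\<^esub> f) h = r \<odot>\<^bsub>M\<^esub> lin_ext R M f h" .
qed

lemma lin_ext_basis:
  assumes "x \<in> X" "\<And>x. x \<in> X \<Longrightarrow> h x \<in> carrier M"
  shows "lin_ext R M (basis_elt R x) h = h x"
proof -
  have "lin_ext R M (basis_elt R x) h = finsum M (\<lambda>y. basis_elt R x y \<odot>\<^bsub>M\<^esub> h y) {x}"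
    using assms by (intro lin_ext_superset[of _ X] basis_elt_closed) (auto simp: basis_elt_def)
  then show ?thesis using assms by (simp add: basis_elt_def)
qed

text \<open>Induction along the list. The first entry enters through \<open>lin_ext\<close>; a later
  entry enters through a sum whose coefficients \<open>f x\<close> are fixed and whose terms are
  linear in it by the induction hypothesis, used for \<open>h\<close> with its first argument
  \<open>x\<close> held fixed.\<close>

lemma multilin_ext_multilin:
  assumes "\<And>xs. set xs \<subseteq> X \<Longrightarrow> length xs = n \<Longrightarrow> h xs \<in> carrier M"
  shows "multilin R (free_module R X) M n {..<n} (\<lambda>fs. multilin_ext R M fs h)"
  using assms
proof (induction n arbitrary: h)
  case 0
  then show ?case by (auto intro!: multilinI)
next
  case (Suc n)
  let ?F = "free_module R X"
  note F = module_free_module[of X]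
  have IH: "multilin R ?F M n {..<n} (\<lambda>fs. multilin_ext R M fs (\<lambda>xs. h (x # xs)))" if "x \<in> X" for x
    using that Suc.prems by (intro Suc.IH) auto
  show ?case
  proof (rule multilinI)
    fix as assume as: "set as \<subseteq> carrier ?F" "length as = Suc n"
    then obtain f fs where e: "as = f # fs" by (cases as) auto
    have f: "f \<in> carrier ?F" "set fs \<subseteq> carrier ?F" "length fs = n" using as e by auto
    have c: "multilin_ext R M fs (\<lambda>xs. h (x # xs)) \<in> carrier M" if "x \<in> X" for x
      using multilinD(1)[OF IH f(2,3)] that .
    show "multilin_ext R M as h \<in> carrier M" unfolding e using lin_ext_closed[OF f(1)] c by simp
    fix j assume j: "j \<in> {..<Suc n}"
    show "lin_map R ?F M (\<lambda>x. multilin_ext R M (as[j := x]) h)"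
    proof (cases j)
      case 0
      then show ?thesis unfolding e using lin_ext_linear[of X] c by simp
    next
      case (Suc k)
      have "lin_map R ?F M (\<lambda>y. f x \<odot>\<^bsub>M\<^esub> multilin_ext R M (fs[k := y]) (\<lambda>xs. h (x # xs)))"
        if "x \<in> {x. f x \<noteq> \<zero>}" for x
        using that Suc j f
        by (intro lin_map_smult[OF F module_axioms] multilinD(2)[OF IH]) (auto simp: free_module_simps)
      then show ?thesis
        using Suc f unfolding e
        by (auto simp: lin_ext_def free_module_simps intro!: lin_map_sum[OF F module_axioms])
    qed
  qed
qed

lemma multilin_ext_basis:
  assumes "\<And>ys. set ys \<subseteq> X \<Longrightarrow> length ys = length xs \<Longrightarrow> h ys \<in> carrier M" "set xs \<subseteq> X"
  shows "multilin_ext R M (map (basis_elt R) xs) h = h xs"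
  using assms
proof (induction xs arbitrary: h)
  case (Cons x xs)
  note ml = multilinD(1)[OF multilin_ext_multilin[where n = "length xs" and X = X]]
  have "multilin_ext R M (map (basis_elt R) xs) (\<lambda>xs. h (y # xs)) \<in> carrier M" if "y \<in> X" for y
    using that Cons.prems by (intro ml) (auto simp: basis_elt_closed)
  then have "multilin_ext R M (map (basis_elt R) (x # xs)) h
    = multilin_ext R M (map (basis_elt R) xs) (\<lambda>xs. h (x # xs))"
    using lin_ext_basis[of x X "\<lambda>x. multilin_ext R M (map (basis_elt R) xs) (\<lambda>xs. h (x # xs))"] Cons.prems
    by simp
  also have "\<dots> = h (x # xs)" using Cons.prems by (intro Cons.IH) auto
  finally show ?case .
qed simp

end

section \<open>Quotients\<close>

lemma quot_module_simps:
  "carrier (quot_module M N) = a_rcosets\<^bsub>M\<^esub> N" "\<zero>\<^bsub>quot_module M N\<^esub> = N"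
  "C \<oplus>\<^bsub>quot_module M N\<^esub> D = C <+>\<^bsub>M\<^esub> D"
  "r \<odot>\<^bsub>quot_module M N\<^esub> C = (\<Union>x\<in>C. N +>\<^bsub>M\<^esub> (r \<odot>\<^bsub>M\<^esub> x))"
  by (simp_all add: quot_module_def)

lemma with_oper_simps [simp]:
  "carrier (with_oper M f) = carrier M" "\<zero>\<^bsub>with_oper M f\<^esub> = \<zero>\<^bsub>M\<^esub>"
  "x \<oplus>\<^bsub>with_oper M f\<^esub> y = x \<oplus>\<^bsub>M\<^esub> y" "r \<odot>\<^bsub>with_oper M f\<^esub> x = r \<odot>\<^bsub>M\<^esub> x"
  "oper (with_oper M f) = f"
  by (simp_all add: with_oper_def)

lemma module_with_oper: "module R M \<Longrightarrow> module R (with_oper M f)"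
proof -
  assume "module R M"
  then interpret M: module R M .
  show ?thesis
    by (rule moduleI, rule M.is_cring, rule abelian_groupI)
      (auto simp: M.M.a_ac M.smult_l_distr M.smult_r_distr M.smult_assoc1 intro: M.M.l_neg)
qed

lemma lin_map_with_oper [simp]:
  "lin_map R M (with_oper N f) g = lin_map R M N g"
  "lin_map R (with_oper N f) M h = lin_map R N M h"
  by (simp_all add: lin_map_def)

lemma minus_eq_zero_iff:
  assumes "abelian_group G" "x \<in> carrier G" "y \<in> carrier G"
  shows "x \<ominus>\<^bsub>G\<^esub> y = \<zero>\<^bsub>G\<^esub> \<longleftrightarrow> x = y"
proof -
  interpret G: abelian_group G by fact
  show ?thesis using assms(2,3)
    by (metis G.add.inv_closed G.add.inv_inv G.minus_equality G.minus_eq G.r_neg)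
qed

lemma set_Cons_iff: "x # xs \<in> set_Cons A B \<longleftrightarrow> x \<in> A \<and> xs \<in> B"
  by (auto simp: set_Cons_def)

text \<open>Operations on classes range over lists of representatives by means of
  \<open>listset\<close>; entrywise membership is the form in which this can be used.\<close>

lemma listset_iff: "xs \<in> listset As \<longleftrightarrow> list_all2 (\<in>) xs As"
proof (induction As arbitrary: xs)
  case (Cons A As)
  then show ?case by (cases xs) (auto simp: set_Cons_iff, auto simp: set_Cons_def)
qed simp

section \<open>Cosets of a submodule\<close>

locale submodule_of_module = M?: module R M for R :: "('r, 's) ring_scheme" (structure)
    and M :: "('r, 'a, 'x) module_scheme" +
  fixes N :: "'a set"
  assumes N: "submodule N R M"
begin

lemma abelian_subgroup: "abelian_subgroup N M"
  using N M.abelian_group_axioms unfolding submodule_def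
  by (intro abelian_subgroupI3 additive_subgroupI) auto

sublocale N: abelian_subgroup N M by (rule abelian_subgroup)

abbreviation (input) cls where "cls x \<equiv> N +>\<^bsub>M\<^esub> x"

abbreviation (input) Q where "Q \<equiv> quot_module M N"

lemma cls_eq_iff:
  assumes "x \<in> carrier M" "y \<in> carrier M"
  shows "cls x = cls y \<longleftrightarrow> x \<ominus>\<^bsub>M\<^esub> y \<in> N"
  using N.a_rcos_module[OF assms(2,1)] N.a_repr_independence'[of x y] N.a_repr_independenceD[of x y] assms
  by (metis a_minus_def)

lemma cls_zero: "cls \<zero>\<^bsub>M\<^esub> = N"
  by (simp add: N.a_rcos_const)

lemma cls_eq_zero_iff: "x \<in> carrier M \<Longrightarrow> cls x = N \<longleftrightarrow> x \<in> N"
  using cls_eq_iff[of x "\<zero>\<^bsub>M\<^esub>"] M.minus_equality[of "\<zero>\<^bsub>M\<^esub>" "\<zero>\<^bsub>M\<^esub>"]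
  by (simp add: cls_zero a_minus_def)

lemma carrier_Q: "carrier Q = (\<lambda>x. cls x) ` carrier M"
  by (auto simp: quot_module_simps A_RCOSETS_def' )

lemma cls_add: "x \<in> carrier M \<Longrightarrow> y \<in> carrier M \<Longrightarrow> cls x \<oplus>\<^bsub>Q\<^esub> cls y = cls (x \<oplus>\<^bsub>M\<^esub> y)"
  by (simp add: quot_module_simps N.a_rcos_sum)

text \<open>The scalar multiple of a class is a union over its representatives. Every member of the
  union is the same coset because \<open>N\<close> is closed under scalars, and the index set is not
  empty, so the union collapses.\<close>

lemma cls_smult:
  assumes "r \<in> carrier R" "x \<in> carrier M"
  shows "r \<odot>\<^bsub>Q\<^esub> cls x = cls (r \<odot>\<^bsub>M\<^esub> x)"
proof -
  have "cls (r \<odot>\<^bsub>M\<^esub> y) = cls (r \<odot>\<^bsub>M\<^esub> x)" if "y \<in> cls x" for y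
  proof -
    have y: "y \<in> carrier M" using that assms N.a_elemrcos_carrier by blast
    have "cls y = cls x" using N.a_repr_independence' that assms by blast
    then have "y \<ominus>\<^bsub>M\<^esub> x \<in> N" using y assms by (simp add: cls_eq_iff)
    then have "r \<odot>\<^bsub>M\<^esub> (y \<ominus>\<^bsub>M\<^esub> x) \<in> N" using assms N by (simp add: submoduleE)
    then have "r \<odot>\<^bsub>M\<^esub> y \<ominus>\<^bsub>M\<^esub> r \<odot>\<^bsub>M\<^esub> x \<in> N"
      using assms y by (simp add: a_minus_def smult_r_distr smult_r_minus)
    then show ?thesis using assms y by (simp add: cls_eq_iff)
  qed
  moreover have "x \<in> cls x" using assms N.a_rcos_self by blast
  ultimately have "(\<Union>y\<in>cls x. cls (r \<odot>\<^bsub>M\<^esub> y)) = cls (r \<odot>\<^bsub>M\<^esub> x)" by blast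
  then show ?thesis by (simp only: quot_module_simps)
qed

lemma module_Q: "module R Q"
proof (rule moduleI)
  show "cring R" by (rule is_cring)
  show "abelian_group Q"
  proof (rule abelian_groupI)
    fix C assume "C \<in> carrier Q"
    then obtain x where x: "x \<in> carrier M" "C = cls x" by (auto simp: carrier_Q)
    then have "cls (\<ominus>\<^bsub>M\<^esub> x) \<oplus>\<^bsub>Q\<^esub> C = \<zero>\<^bsub>Q\<^esub>"
      using cls_zero by (simp add: cls_add M.l_neg) (simp add: quot_module_simps(2))
    with x show "\<exists>D\<in>carrier Q. D \<oplus>\<^bsub>Q\<^esub> C = \<zero>\<^bsub>Q\<^esub>" by (auto simp: carrier_Q)
  next
    show "\<zero>\<^bsub>Q\<^esub> \<in> carrier Q" using cls_zero by (auto simp: carrier_Q quot_module_simps(2))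
    fix C assume "C \<in> carrier Q"
    then obtain x where x: "x \<in> carrier M" "C = cls x" by (auto simp: carrier_Q)
    have "\<zero>\<^bsub>Q\<^esub> = cls \<zero>\<^bsub>M\<^esub>" using cls_zero by (simp add: quot_module_simps(2))
    then show "\<zero>\<^bsub>Q\<^esub> \<oplus>\<^bsub>Q\<^esub> C = C" using x by (simp only: cls_add M.zero_closed M.l_zero)
  qed (auto simp: carrier_Q cls_add M.a_ac)
qed (auto simp: carrier_Q cls_add cls_smult smult_l_distr smult_r_distr smult_assoc1)

lemma cls_linear: "lin_map R M Q (\<lambda>x. cls x)"
  by (rule lin_mapI) (auto simp: carrier_Q cls_add cls_smult)

text \<open>The preimage of a submodule of the quotient is a submodule of \<open>M\<close>; once it
  contains \<open>X\<close> it is everything, and the classes exhaust the quotient.\<close>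

lemma cls_spans: "spans R M X \<Longrightarrow> spans R Q ((\<lambda>x. cls x) ` X)"
proof -
  assume "spans R M X"
  then have X: "X \<subseteq> carrier M \<and> (\<forall>N. submodule N R M \<longrightarrow> X \<subseteq> N \<longrightarrow> carrier M \<subseteq> N)"
    by (simp add: spans_def)
  interpret Q: module R Q by (rule module_Q)
  have "carrier Q \<subseteq> L" if L: "submodule L R Q" and sub: "(\<lambda>x. cls x) ` X \<subseteq> L" for L
  proof -
    have "submodule {x \<in> carrier M. cls x \<in> L} R M"
    proof (rule submoduleI)
      show "\<zero>\<^bsub>M\<^esub> \<in> {x \<in> carrier M. cls x \<in> L}"
        using submodule.axioms(1)[OF L] by (auto simp: cls_zero quot_module_simps(2) dest: subgroup.one_closed)
    next
      fix x assume "x \<in> {x \<in> carrier M. cls x \<in> L}"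
      then show "\<ominus>\<^bsub>M\<^esub> x \<in> {x \<in> carrier M. cls x \<in> L}"
        using Q.submoduleE(3)[OF L] by (auto simp: lin_map_uminus[OF module_axioms module_Q cls_linear])
    qed (auto simp: cls_add[symmetric] cls_smult[symmetric] Q.submoduleE[OF L])
    then have "carrier M \<subseteq> {x \<in> carrier M. cls x \<in> L}" using X sub by blast
    then show "carrier Q \<subseteq> L" by (auto simp: carrier_Q)
  qed
  moreover have "(\<lambda>x. cls x) ` X \<subseteq> carrier Q" using X by (auto simp: carrier_Q)
  ultimately show ?thesis by (simp add: spans_def)
qed

text \<open>The lift evaluates \<open>f\<close> on a chosen representative. Two representatives
  differ by an element of \<open>N\<close>, where \<open>f\<close> vanishes, so the choice is
  invisible.\<close>

lemma cls_lift:
  assumes L: "module R L" and f: "lin_map R M L f" and ker: "\<And>x. x \<in> N \<Longrightarrow> f x = \<zero>\<^bsub>L\<^esub>"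
  obtains g where "lin_map R Q L g" "\<And>x. x \<in> carrier M \<Longrightarrow> g (cls x) = f x"
proof -
  interpret L: module R L by (rule L)
  define g where "g C = f (SOME x. x \<in> carrier M \<and> cls x = C)" for C
  have g: "g (cls x) = f x" if x: "x \<in> carrier M" for x
  proof -
    define y where "y = (SOME y. y \<in> carrier M \<and> cls y = cls x)"
    have "y \<in> carrier M \<and> cls y = cls x" unfolding y_def by (rule someI[of _ x]) (simp add: x)
    then have y: "y \<in> carrier M" "y \<ominus>\<^bsub>M\<^esub> x \<in> N" using x cls_eq_iff by blast+
    have "f y \<ominus>\<^bsub>L\<^esub> f x = \<zero>\<^bsub>L\<^esub>"
      using ker[OF y(2)] x y by (simp add: lin_map_minus[OF module_axioms L f])
    then have "f y = f x" using x y lin_mapD(1)[OF f] by (simp add: minus_eq_zero_iff[OF L.M.abelian_group_axioms])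
    then show ?thesis by (simp add: g_def y_def)
  qed
  have "lin_map R Q L g"
    by (rule lin_mapI) (auto simp: carrier_Q cls_add cls_smult g lin_mapD[OF f])
  with g that show ?thesis by blast
qed

text \<open>Replace the entries one at a time. Changing one entry within its class changes
  \<open>G\<close> by its value on a list with an element of \<open>N\<close> in that slot, and that
  value is zero.\<close>

lemma multilin_cls_cong:
  assumes G: "multilin R M L n {..<n} G" and L: "module R L"
    and ker: "\<And>as i. set as \<subseteq> carrier M \<Longrightarrow> length as = n \<Longrightarrow> i < n \<Longrightarrow> as ! i \<in> N \<Longrightarrow> G as = \<zero>\<^bsub>L\<^esub>"
    and as: "set as \<subseteq> carrier M" "length as = n" and bs: "set bs \<subseteq> carrier M" "length bs = n"
    and eq: "\<And>i. i < n \<Longrightarrow> cls (as ! i) = cls (bs ! i)"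
  shows "G as = G bs"
proof -
  interpret L: module R L by (rule L)
  \<comment> \<open>The hybrid list has its first \<open>k\<close> entries from \<open>bs\<close>
    and the others from \<open>as\<close>; \<open>k = 0\<close> and \<open>k = n\<close> give the
    two lists to be compared.\<close>
  have "G (take k bs @ drop k as) = G as" if "k \<le> n" for k
    using that
  proof (induction k)
    case (Suc k)
    let ?l = "take k bs @ drop k as"
    have c: "as ! k \<in> carrier M" "bs ! k \<in> carrier M" using as bs Suc.prems by auto
    have l: "set ?l \<subseteq> carrier M" "length ?l = n"
      using as bs Suc.prems by (auto dest: in_set_takeD in_set_dropD)
    have e1: "?l[k := as ! k] = ?l"
      using as bs Suc.prems by (simp add: list_update_append Cons_nth_drop_Suc[symmetric])
    have e2: "?l[k := bs ! k] = take (Suc k) bs @ drop (Suc k) as"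
      using as bs Suc.prems by (simp add: list_update_append take_Suc_conv_app_nth Cons_nth_drop_Suc[symmetric])
    have lin: "lin_map R M L (\<lambda>x. G (?l[k := x]))"
      using l Suc.prems by (intro multilinD(2)[OF G]) auto
    have "bs ! k \<ominus>\<^bsub>M\<^esub> as ! k \<in> N" using eq[of k] c Suc.prems by (metis cls_eq_iff Suc_le_lessD)
    then have "G (?l[k := bs ! k \<ominus>\<^bsub>M\<^esub> as ! k]) = \<zero>\<^bsub>L\<^esub>"
      using l Suc.prems c by (intro ker[of _ k] set_update_subset) auto
    then have "G (?l[k := bs ! k]) \<ominus>\<^bsub>L\<^esub> G (?l[k := as ! k]) = \<zero>\<^bsub>L\<^esub>"
      using lin_map_minus[OF module_axioms L lin c(2,1)] by simp
    then have "G (?l[k := bs ! k]) = G (?l[k := as ! k])"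
      using lin_mapD(1)[OF lin] c by (simp add: minus_eq_zero_iff[OF L.M.abelian_group_axioms])
    with Suc show ?case unfolding e1 e2 by simp
  qed simp
  from this[of n] show ?thesis using as bs by simp
qed

end

text \<open>The quotient of an algebra \<open>F\<close> that satisfies the algebra axioms only modulo \<open>K\<close>; it covers both
  the free algebra, where \<open>F\<close> is spanned by formal tensors, and quotients by ideals.\<close>

locale operad_quotient = symmetric_operad R P + Q?: submodule_of_module R F K
  for R :: "('r, 's) ring_scheme" (structure) and P :: "('r, 'p) operad"
    and F :: "('r, 'a, 'x) module_scheme" and K +
  fixes opr :: "'p \<Rightarrow> 'a list \<Rightarrow> 'a"
  assumes opr_closed: "\<lbrakk>set as \<subseteq> carrier F; \<mu> \<in> arity_ops P (length as)\<rbrakk> \<Longrightarrow> opr \<mu> as \<in> carrier F"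
    and opr_multilin: "\<mu> \<in> arity_ops P n \<Longrightarrow> multilin R F F n {..<n} (opr \<mu>)"
    and opr_absorb: "\<lbrakk>set as \<subseteq> carrier F; \<mu> \<in> arity_ops P (length as); i < length as; as ! i \<in> K\<rbrakk> \<Longrightarrow>
      opr \<mu> as \<in> K"
    and opr_add_op: "\<lbrakk>set as \<subseteq> carrier F; \<mu> \<in> arity_ops P (length as); \<nu> \<in> arity_ops P (length as)\<rbrakk> \<Longrightarrow>
      K +>\<^bsub>F\<^esub> opr (\<mu> \<oplus>\<^bsub>opmod P (length as)\<^esub> \<nu>) as = K +>\<^bsub>F\<^esub> (opr \<mu> as \<oplus>\<^bsub>F\<^esub> opr \<nu> as)"
    and opr_smult_op: "\<lbrakk>r \<in> carrier R; set as \<subseteq> carrier F; \<mu> \<in> arity_ops P (length as)\<rbrakk> \<Longrightarrow>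
      K +>\<^bsub>F\<^esub> opr (r \<odot>\<^bsub>opmod P (length as)\<^esub> \<mu>) as = K +>\<^bsub>F\<^esub> (r \<odot>\<^bsub>F\<^esub> opr \<mu> as)"
    and opr_act: "\<lbrakk>set as \<subseteq> carrier F; \<mu> \<in> arity_ops P (length as); \<sigma> permutes {..<length as}\<rbrakk> \<Longrightarrow>
      K +>\<^bsub>F\<^esub> opr (act P (length as) \<mu> \<sigma>) as = K +>\<^bsub>F\<^esub> opr \<mu> (permute_list (inv_into UNIV \<sigma>) as)"
    and opr_unit: "a \<in> carrier F \<Longrightarrow> K +>\<^bsub>F\<^esub> opr (opunit P) [a] = K +>\<^bsub>F\<^esub> a"
    and opr_pcomp:
      "\<lbrakk>set xs \<subseteq> carrier F; set ys \<subseteq> carrier F; set zs \<subseteq> carrier F;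
        \<mu> \<in> arity_ops P (length xs + 1 + length zs); \<nu> \<in> arity_ops P (length ys)\<rbrakk> \<Longrightarrow>
      K +>\<^bsub>F\<^esub> opr (pcomp P (length xs + 1 + length zs) (length xs) (length ys) \<mu> \<nu>) (xs @ ys @ zs)
        = K +>\<^bsub>F\<^esub> opr \<mu> (xs @ [opr \<nu> ys] @ zs)"
begin

abbreviation quot where
  "quot \<equiv> with_oper (quot_module F K) (\<lambda>\<mu> Cs. \<Union>as\<in>listset Cs. K +>\<^bsub>F\<^esub> opr \<mu> as)"

text \<open>Two lists of representatives of the same classes give the same class of results:
  \<open>opr \<mu>\<close> followed by the projection is multilinear and, by
  \<open>opr_absorb\<close>, zero once an entry lies in \<open>K\<close>. Hence the defining union
  has one member only, and \<open>quot\<close> may be computed on any representatives.\<close>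

lemma quot_oper:
  assumes as: "set as \<subseteq> carrier F" and \<mu>: "\<mu> \<in> arity_ops P (length as)"
  shows "oper quot \<mu> (map (\<lambda>x. K +>\<^bsub>F\<^esub> x) as) = K +>\<^bsub>F\<^esub> opr \<mu> as"
proof -
  have "K +>\<^bsub>F\<^esub> opr \<mu> bs = K +>\<^bsub>F\<^esub> opr \<mu> as" if "bs \<in> listset (map (\<lambda>x. K +>\<^bsub>F\<^esub> x) as)" for bs
  proof -
    from that have len: "length bs = length as"
      and mem: "\<And>i. i < length as \<Longrightarrow> bs ! i \<in> K +>\<^bsub>F\<^esub> as ! i"
      by (auto simp: listset_iff list_all2_conv_all_nth)
    have "bs ! i \<in> carrier F" if "i < length as" for i
      using mem[OF that] as that N.a_elemrcos_carrier by (meson nth_mem subsetD)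
    then have bs: "set bs \<subseteq> carrier F" using len by (auto simp: in_set_conv_nth)
    have eq: "K +>\<^bsub>F\<^esub> bs ! i = K +>\<^bsub>F\<^esub> as ! i" if "i < length as" for i
      using mem[OF that] as that N.a_repr_independence' by (metis nth_mem subsetD)
    show ?thesis
    proof (rule multilin_cls_cong[where G = "\<lambda>as. K +>\<^bsub>F\<^esub> opr \<mu> as", OF multilin_compose[OF opr_multilin[OF \<mu>] cls_linear] module_Q])
      fix cs i assume "set cs \<subseteq> carrier F" "length cs = length as" "i < length as" "cs ! i \<in> K"
      then show "K +>\<^bsub>F\<^esub> opr \<mu> cs = \<zero>\<^bsub>quot_module F K\<^esub>"
        using opr_absorb[of cs \<mu> i] opr_closed[of cs \<mu>] \<mu>
        by (simp add: quot_module_simps(2) N.a_rcos_const)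
    qed (use bs len as eq in auto)
  qed
  \<comment> \<open>The union of a constant family equals its value only over a nonempty index set;
    \<open>as\<close> itself is an index.\<close>
  moreover have "as \<in> listset (map (\<lambda>x. K +>\<^bsub>F\<^esub> x) as)"
    using as by (auto simp: listset_iff list_all2_conv_all_nth intro!: N.a_rcos_self)
  ultimately have "(\<Union>bs\<in>listset (map (\<lambda>x. K +>\<^bsub>F\<^esub> x) as). K +>\<^bsub>F\<^esub> opr \<mu> bs) = K +>\<^bsub>F\<^esub> opr \<mu> as"
    by (intro SUP_eq_const) blast+
  then show ?thesis by (simp only: with_oper_simps)
qed

lemma quot_lists:
  assumes "set Cs \<subseteq> carrier quot"
  obtains as where "set as \<subseteq> carrier F" "Cs = map (\<lambda>x. K +>\<^bsub>F\<^esub> x) as"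
proof -
  have "Cs \<in> lists ((\<lambda>x. K +>\<^bsub>F\<^esub> x) ` carrier F)" using assms by (simp add: carrier_Q in_lists_conv_set subset_iff)
  then show ?thesis using that by (auto simp: lists_image)
qed

lemma quot_oper_closed:
  assumes "set Cs \<subseteq> carrier quot" "\<mu> \<in> arity_ops P (length Cs)"
  shows "oper quot \<mu> Cs \<in> carrier quot"
proof -
  obtain as where as: "set as \<subseteq> carrier F" "Cs = map (\<lambda>x. K +>\<^bsub>F\<^esub> x) as"
    using quot_lists[OF assms(1)] .
  have "\<mu> \<in> arity_ops P (length as)" using assms(2) as(2) by simp
  from quot_oper[OF as(1) this] opr_closed[OF as(1) this] show ?thesis
    unfolding as(2) by (simp only: with_oper_simps(1) carrier_Q) simp
qed

lemma quot_operad_algebra: "operad_algebra R P quot"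
proof (intro operad_algebra.intro symmetric_operad_axioms module_with_oper module_Q operad_algebra_axioms.intro)
  \<comment> \<open>Unfolding \<open>oper\<close> here would expose the union over representatives
    and hide the left side of \<open>quot_oper\<close>.\<close>
  note [simp del] = with_oper_simps(5)
  have Q: "carrier quot = (\<lambda>x. K +>\<^bsub>F\<^esub> x) ` carrier F" by (simp add: carrier_Q)
  fix Cs \<mu> assume Cs: "set Cs \<subseteq> carrier quot" and \<mu>: "\<mu> \<in> arity_ops P (length Cs)"
  then obtain as where as: "set as \<subseteq> carrier F" "Cs = map (\<lambda>x. K +>\<^bsub>F\<^esub> x) as" using quot_lists by metis
  have \<mu>': "\<mu> \<in> arity_ops P (length as)" using as \<mu> by simp
  show "oper quot \<mu> Cs \<in> carrier quot" using Cs \<mu> by (rule quot_oper_closed)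
  interpret Pm: module R "opmod P (length as)" by (rule opmod_module)
  { fix \<nu> assume "\<nu> \<in> arity_ops P (length Cs)"
    then show "oper quot (\<mu> \<oplus>\<^bsub>opmod P (length Cs)\<^esub> \<nu>) Cs = oper quot \<mu> Cs \<oplus>\<^bsub>quot\<^esub> oper quot \<nu> Cs"
      using as \<mu>' by (simp add: quot_oper opr_add_op cls_add opr_closed) }
  { fix r assume "r \<in> carrier R"
    then show "oper quot (r \<odot>\<^bsub>opmod P (length Cs)\<^esub> \<mu>) Cs = r \<odot>\<^bsub>quot\<^esub> oper quot \<mu> Cs"
      using as \<mu>' by (simp add: quot_oper opr_smult_op cls_smult opr_closed) }
  { fix \<sigma> assume s: "\<sigma> permutes {..<length Cs}"
    then have "permute_list (inv_into UNIV \<sigma>) Cs = map (\<lambda>x. K +>\<^bsub>F\<^esub> x) (permute_list (inv_into UNIV \<sigma>) as)"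
      using as by (simp add: permute_list_map permutes_inv)
    moreover have "set (permute_list (inv_into UNIV \<sigma>) as) \<subseteq> carrier F"
      using s as by (simp add: permutes_inv)
    ultimately show "oper quot (act P (length Cs) \<mu> \<sigma>) Cs = oper quot \<mu> (permute_list (inv_into UNIV \<sigma>) Cs)"
      using as \<mu>' s quot_oper[of "permute_list (inv_into UNIV \<sigma>) as" \<mu>]
      by (simp add: quot_oper act_closed opr_act) }
  { fix i x y assume i: "i < length Cs" and "x \<in> carrier quot" "y \<in> carrier quot"
    then obtain a b where ab: "a \<in> carrier F" "b \<in> carrier F" "x = K +>\<^bsub>F\<^esub> a" "y = K +>\<^bsub>F\<^esub> b"
      unfolding Q by blast
    have u: "oper quot \<mu> (Cs[i := K +>\<^bsub>F\<^esub> c]) = K +>\<^bsub>F\<^esub> opr \<mu> (as[i := c])" if "c \<in> carrier F" for c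
      using quot_oper[of "as[i := c]" \<mu>] that as \<mu>' by (simp add: map_update set_update_subset)
    have "i \<in> {..<length as}" using i as by simp
    note lin = lin_mapD[OF multilinD(2)[OF opr_multilin[OF \<mu>'] as(1) refl this]]
    show "oper quot \<mu> (Cs[i := x \<oplus>\<^bsub>quot\<^esub> y]) = oper quot \<mu> (Cs[i := x]) \<oplus>\<^bsub>quot\<^esub> oper quot \<mu> (Cs[i := y])"
      using ab lin by (simp add: cls_add u)
    fix r assume r: "r \<in> carrier R"
    show "oper quot \<mu> (Cs[i := r \<odot>\<^bsub>quot\<^esub> x]) = r \<odot>\<^bsub>quot\<^esub> oper quot \<mu> (Cs[i := x])"
      using r ab lin by (simp add: cls_smult u) }
next
  note [simp del] = with_oper_simps(5)
  fix x assume "x \<in> carrier quot"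
  then obtain a where "a \<in> carrier F" "x = K +>\<^bsub>F\<^esub> a" by (auto simp: carrier_Q)
  then show "oper quot (opunit P) [x] = x"
    using quot_oper[of "[a]" "opunit P"] opunit_closed by (simp add: opr_unit)
next
  note [simp del] = with_oper_simps(5)
  fix xs ys zs \<mu> \<nu>
  assume c: "set xs \<subseteq> carrier quot" "set ys \<subseteq> carrier quot" "set zs \<subseteq> carrier quot"
    and o: "\<mu> \<in> arity_ops P (length xs + 1 + length zs)" "\<nu> \<in> arity_ops P (length ys)"
  obtain as where as: "set as \<subseteq> carrier F" "xs = map (\<lambda>x. K +>\<^bsub>F\<^esub> x) as" using quot_lists c by metis
  obtain bs where bs: "set bs \<subseteq> carrier F" "ys = map (\<lambda>x. K +>\<^bsub>F\<^esub> x) bs" using quot_lists c by metis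
  obtain cs where cs: "set cs \<subseteq> carrier F" "zs = map (\<lambda>x. K +>\<^bsub>F\<^esub> x) cs" using quot_lists c by metis
  have o': "\<mu> \<in> arity_ops P (length as + 1 + length cs)" "\<nu> \<in> arity_ops P (length bs)"
    using o as bs cs by simp_all
  \<comment> \<open>Filling a slot uses that slot up: the arity \<open>m + n - 1\<close> of the
    axiom is the total length of the three blocks.\<close>
  have pc: "pcomp P (length as + 1 + length cs) (length as) (length bs) \<mu> \<nu> \<in> arity_ops P (length (as @ bs @ cs))"
    using pcomp_closed[OF o', of "length as"] by (simp add: ac_simps)
  have "oper quot (pcomp P (length xs + 1 + length zs) (length xs) (length ys) \<mu> \<nu>) (xs @ ys @ zs)
    = K +>\<^bsub>F\<^esub> opr (pcomp P (length as + 1 + length cs) (length as) (length bs) \<mu> \<nu>) (as @ bs @ cs)"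
    using quot_oper[OF _ pc] as bs cs by simp
  also have "\<dots> = K +>\<^bsub>F\<^esub> opr \<mu> (as @ [opr \<nu> bs] @ cs)" using as bs cs o' by (intro opr_pcomp) auto
  also have "\<dots> = oper quot \<mu> (map (\<lambda>x. K +>\<^bsub>F\<^esub> x) (as @ [opr \<nu> bs] @ cs))"
    using as bs cs o' by (intro quot_oper[symmetric]) (auto intro: opr_closed)
  also have "\<dots> = oper quot \<mu> (xs @ [oper quot \<nu> ys] @ zs)"
    using as bs cs o' by (simp add: quot_oper)
  finally show "oper quot (pcomp P (length xs + 1 + length zs) (length xs) (length ys) \<mu> \<nu>) (xs @ ys @ zs)
    = oper quot \<mu> (xs @ [oper quot \<nu> ys] @ zs)" .
qed

end

section \<open>Block permutations\<close>

text \<open>States where each entry goes instead of where it comes from, so the inverses of block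
  permutations need not be evaluated on lists.\<close>

lemma permute_list_invI:
  assumes "\<tau> permutes {..<length as}" "length bs = length as" "\<And>k. k < length as \<Longrightarrow> bs ! \<tau> k = as ! k"
  shows "permute_list (inv_into UNIV \<tau>) as = bs"
proof (rule nth_equalityI)
  have p: "inv_into UNIV \<tau> permutes {..<length as}" using assms(1) by (rule permutes_inv)
  fix k assume "k < length (permute_list (inv_into UNIV \<tau>) as)"
  then have k: "k < length as" by simp
  then have "inv_into UNIV \<tau> k < length as" using permutes_in_image[OF p] by simp
  from assms(3)[OF this] show "permute_list (inv_into UNIV \<tau>) as ! k = bs ! k"
    using k p by (simp add: permute_list_nth permutes_inverses(1)[OF assms(1)])
qed (simp add: assms(2))

lemma permutesI:
  assumes "\<And>x. x \<notin> S \<Longrightarrow> p x = x" "\<And>x. q (p x) = x" "\<And>x. p (q x) = x"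
  shows "p permutes S"
  unfolding permutes_def
proof (intro conjI allI impI)
  fix y
  show "\<exists>!x. p x = y"
  proof (rule ex1I)
    show "p (q y) = y" by (rule assms(3))
    show "x = q y" if "p x = y" for x using assms(2)[of x] that by simp
  qed
qed (rule assms(1))

text \<open>The inverse is the same construction on the inverse of \<open>\<tau>\<close>: the block
  \<open>i, ..., i + n - 1\<close> is preserved and everything else is fixed.\<close>

lemma inner_perm_permutes:
  assumes "\<tau> permutes {..<n}" "i + n \<le> m"
  shows "inner_perm i n \<tau> permutes {..<m}"
proof -
  let ?\<rho> = "inv_into UNIV \<tau>"
  note inv = permutes_inverses[OF assms(1)]
  have 1: "\<tau> k < n" "?\<rho> k < n" if "k < n" for k
    using that permutes_in_image[OF assms(1)] permutes_in_image[OF permutes_inv[OF assms(1)]] by auto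
  show ?thesis
  proof (rule permutesI[where q = "inner_perm i n ?\<rho>"])
    fix x
    show "inner_perm i n ?\<rho> (inner_perm i n \<tau> x) = x"
      using 1(1)[of "x - i"] by (cases "i \<le> x \<and> x < i + n") (auto simp: inner_perm_def inv)
    show "inner_perm i n \<tau> (inner_perm i n ?\<rho> x) = x"
      using 1(2)[of "x - i"] by (cases "i \<le> x \<and> x < i + n") (auto simp: inner_perm_def inv)
  qed (use assms(2) in \<open>simp add: inner_perm_def\<close>)
qed

lemma permute_list_inner:
  assumes "\<tau> permutes {..<length us}"
  shows "permute_list (inv_into UNIV (inner_perm (length xs) (length us) \<tau>)) (xs @ us @ zs)
    = xs @ permute_list (inv_into UNIV \<tau>) us @ zs"
proof (rule permute_list_invI)
  show "inner_perm (length xs) (length us) \<tau> permutes {..<length (xs @ us @ zs)}"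
    using assms by (rule inner_perm_permutes) simp
  fix k assume k: "k < length (xs @ us @ zs)"
  show "(xs @ permute_list (inv_into UNIV \<tau>) us @ zs) ! inner_perm (length xs) (length us) \<tau> k
    = (xs @ us @ zs) ! k"
  proof (cases "length xs \<le> k \<and> k < length xs + length us")
    case True
    then have "\<tau> (k - length xs) < length us" using permutes_in_image[OF assms, of "k - length xs"] by auto
    then have "permute_list (inv_into UNIV \<tau>) us ! \<tau> (k - length xs) = us ! (k - length xs)"
      by (simp add: permute_list_nth permutes_inv[OF assms] permutes_inverses[OF assms])
    moreover have "k - length xs < length us" using True by auto
    ultimately show ?thesis using True \<open>\<tau> (k - length xs) < length us\<close>
      by (simp add: inner_perm_def nth_append)
  qed (auto simp: inner_perm_def nth_append)
qed simp

text \<open>The block at \<open>i\<close> is moved to the place that starts at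
  \<open>\<sigma> i\<close>. Undoing this is the same construction for the inverse
  \<open>\<rho>\<close>, with the block taken at \<open>\<sigma> i\<close>.\<close>

lemma outer_perm_inverse:
  assumes "\<And>x. \<rho> (\<sigma> x) = x" "\<And>x. \<sigma> (\<rho> x) = x"
  shows "outer_perm (\<sigma> i) n \<rho> (outer_perm i n \<sigma> t) = t"
proof (cases "i \<le> t \<and> t < i + n")
  case True
  then obtain d where "t = i + d" "d < n" using le_Suc_ex by fastforce
  then show ?thesis by (simp add: outer_perm_def assms)
next
  case False
  \<comment> \<open>\<open>u\<close> is \<open>t\<close> with the block collapsed to the single
    input \<open>i\<close>, \<open>s\<close> is its image under the outer permutation, and
    \<open>w\<close> is the position of \<open>s\<close> after \<open>\<sigma> i\<close> has been
    opened up to \<open>n\<close> places.\<close>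
  define u where "u = (if t < i then t else t + 1 - n)"
  have u: "u \<noteq> i" "(if u < i then u else u + n - 1) = t" using False by (auto simp: u_def)
  define s where "s = \<sigma> u"
  have s: "s \<noteq> \<sigma> i" using u(1) assms(1) unfolding s_def by metis
  have 1: "outer_perm i n \<sigma> t = (if s < \<sigma> i then s else s + n - 1)"
    unfolding outer_perm_def u_def[symmetric] s_def[symmetric] Let_def by (simp only: if_not_P[OF False])
  define w where "w = (if s < \<sigma> i then s else s + n - 1)"
  have w: "\<not> (\<sigma> i \<le> w \<and> w < \<sigma> i + n)" "(if w < \<sigma> i then w else w + 1 - n) = s"
    using s by (auto simp: w_def)
  have "outer_perm (\<sigma> i) n \<rho> w = (if \<rho> s < \<rho> (\<sigma> i) then \<rho> s else \<rho> s + n - 1)"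
    unfolding outer_perm_def w(2) Let_def by (simp only: if_not_P[OF w(1)])
  also have "\<dots> = t" unfolding s_def assms(1) by (rule u(2))
  finally show ?thesis unfolding 1 w_def .
qed

lemma outer_perm_permutes:
  assumes \<sigma>: "\<sigma> permutes {..<m}" and i: "i < m"
  shows "outer_perm i n \<sigma> permutes {..<m + n - 1}"
proof (rule permutesI[where q = "outer_perm (\<sigma> i) n (inv_into UNIV \<sigma>)"])
  note inv = permutes_inverses[OF \<sigma>]
  show "outer_perm (\<sigma> i) n (inv_into UNIV \<sigma>) (outer_perm i n \<sigma> x) = x" for x
    by (rule outer_perm_inverse) (simp_all add: inv)
  show "outer_perm i n \<sigma> (outer_perm (\<sigma> i) n (inv_into UNIV \<sigma>) x) = x" for x
    using outer_perm_inverse[of \<sigma> "inv_into UNIV \<sigma>" "\<sigma> i" n x] by (simp add: inv)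
  fix x assume "x \<notin> {..<m + n - 1}"
  then have x: "m + n - 1 \<le> x" by simp
  \<comment> \<open>Collapsing the block turns a position beyond the \<open>m + n - 1\<close> inputs
    into one beyond the \<open>m\<close> inputs of the outer operation, where
    \<open>\<sigma>\<close> is the identity.\<close>
  then have "\<sigma> (x + 1 - n) = x + 1 - n" using i \<sigma> by (auto simp: permutes_def)
  moreover have "\<sigma> i < m" using permutes_in_image[OF \<sigma>] i by simp
  ultimately show "outer_perm i n \<sigma> x = x" using x i by (auto simp: outer_perm_def Let_def)
qed

text \<open>Opening the entry \<open>t\<close> up into the block \<open>us\<close> commutes with
  permuting: either open it first and apply the block permutation, or apply \<open>\<sigma>\<close>
  first to get \<open>l\<close>, in which \<open>t\<close> sits at \<open>\<sigma> i\<close>, and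
  open it there. The two conclusions share \<open>l\<close>, so that the block can afterwards be
  folded back into \<open>t\<close>.\<close>

lemma permute_list_outer:
  fixes t :: 'a and xs zs :: "'a list"
  assumes \<sigma>: "\<sigma> permutes {..<length xs + 1 + length zs}"
  defines "l \<equiv> permute_list (inv_into UNIV \<sigma>) (xs @ [t] @ zs)" and "i \<equiv> length xs"
  shows "permute_list (inv_into UNIV (outer_perm i (length us) \<sigma>)) (xs @ us @ zs)
      = take (\<sigma> i) l @ us @ drop (Suc (\<sigma> i)) l"
    and "l = take (\<sigma> i) l @ [t] @ drop (Suc (\<sigma> i)) l"
proof -
  let ?m = "length xs + 1 + length zs" and ?n = "length us"
  have \<sigma>_less: "\<sigma> k < ?m \<longleftrightarrow> k < ?m" for k using permutes_in_image[OF \<sigma>] by simp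
  have \<sigma>_eq: "\<sigma> k = \<sigma> k' \<longleftrightarrow> k = k'" for k k' using permutes_inj[OF \<sigma>] by (simp add: inj_eq)
  have ll: "length l = ?m" by (simp add: l_def)
  have l: "l ! \<sigma> k = (xs @ [t] @ zs) ! k" if "k < ?m" for k
    using that \<sigma> \<sigma>_less[of k] by (simp add: l_def permute_list_nth permutes_inv permutes_inverses[OF \<sigma>])
  have i: "i < ?m" "\<sigma> i < ?m" using \<sigma>_less by (auto simp: i_def)
  have "l ! \<sigma> i = t" using l[of i] by (simp add: i_def)
  then show "l = take (\<sigma> i) l @ [t] @ drop (Suc (\<sigma> i)) l"
    using i ll by (metis append_Cons append_Nil id_take_nth_drop)
  \<comment> \<open>Positions of \<open>l\<close> other than \<open>\<sigma> i\<close>, transported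
    to the opened list: those to the right of it are displaced by
    \<open>length us - 1\<close>.\<close>
  have side: "(take (\<sigma> i) l @ us @ drop (Suc (\<sigma> i)) l) ! (if s < \<sigma> i then s else s + ?n - 1) = l ! s"
    if "s < ?m" "s \<noteq> \<sigma> i" for s
    using that i ll by (auto simp: nth_append)
  show "permute_list (inv_into UNIV (outer_perm i ?n \<sigma>)) (xs @ us @ zs)
      = take (\<sigma> i) l @ us @ drop (Suc (\<sigma> i)) l"
  proof (rule permute_list_invI)
    show "outer_perm i ?n \<sigma> permutes {..<length (xs @ us @ zs)}"
      using outer_perm_permutes[OF \<sigma> i(1), of ?n] by (simp add: add_ac)
    show "length (take (\<sigma> i) l @ us @ drop (Suc (\<sigma> i)) l) = length (xs @ us @ zs)" using ll i by simp
    fix k assume k: "k < length (xs @ us @ zs)"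
    show "(take (\<sigma> i) l @ us @ drop (Suc (\<sigma> i)) l) ! outer_perm i ?n \<sigma> k = (xs @ us @ zs) ! k"
    proof (cases "i \<le> k \<and> k < i + ?n")
      case True
      then obtain d where "k = i + d" "d < ?n" using le_Suc_ex by fastforce
      then show ?thesis using i ll by (simp add: outer_perm_def i_def nth_append)
    next
      case False
      define u where "u = (if k < i then k else k + 1 - ?n)"
      have u: "u < ?m" "u \<noteq> i" using False k by (auto simp: u_def i_def)
      have o: "outer_perm i ?n \<sigma> k = (if \<sigma> u < \<sigma> i then \<sigma> u else \<sigma> u + ?n - 1)"
        unfolding outer_perm_def u_def[symmetric] Let_def by (simp only: if_not_P[OF False])
      have "\<sigma> u < ?m" "\<sigma> u \<noteq> \<sigma> i" using u \<sigma>_less \<sigma>_eq by blast+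
      then have "(take (\<sigma> i) l @ us @ drop (Suc (\<sigma> i)) l) ! outer_perm i ?n \<sigma> k = l ! \<sigma> u"
        unfolding o by (rule side)
      also have "\<dots> = (xs @ [t] @ zs) ! u" using u by (intro l)
      also have "\<dots> = (xs @ us @ zs) ! k" using False by (auto simp: u_def i_def nth_append add.commute)
      finally show ?thesis .
    qed
  qed
qed

section \<open>Total composition\<close>

text \<open>Total composition that leaves the last \<open>r\<close> inputs of \<open>\<mu>\<close> alone, so that it can be split along \<open>@\<close>.\<close>

primrec partial_comp :: "('r, 'p) operad \<Rightarrow> nat \<Rightarrow> nat \<Rightarrow> 'p \<Rightarrow> ('p, 'v) tensor list \<Rightarrow> 'p"
  where
    "partial_comp P q r \<mu> [] = \<mu>"
  | "partial_comp P q r \<mu> (t # ts) =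
      partial_comp P (q + length (snd t)) r
        (pcomp P (q + 1 + length ts + r) q (length (snd t)) \<mu> (fst t)) ts"

lemma full_comp_eq_partial_comp: "full_comp P q \<mu> ts = partial_comp P q 0 \<mu> ts"
  by (induction ts arbitrary: q \<mu>) simp_all

abbreviation tensor_inputs :: "('p, 'v) tensor list \<Rightarrow> 'v list"
  where "tensor_inputs ts \<equiv> concat (map snd ts)"

abbreviation tensor_ok :: "('r, 'p) operad \<Rightarrow> ('p, 'v) tensor \<Rightarrow> bool"
  where "tensor_ok P t \<equiv> fst t \<in> arity_ops P (length (snd t))"

text \<open>While \<open>xs\<close> is processed, the slots meant for \<open>ys\<close> count among
  those left alone; afterwards the inputs contributed by \<open>xs\<close> stand in front of the
  next slot.\<close>

lemma partial_comp_append: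
  "partial_comp P q r \<mu> (xs @ ys)
    = partial_comp P (q + length (tensor_inputs xs)) r (partial_comp P q (r + length ys) \<mu> xs) ys"
  by (induction xs arbitrary: q \<mu>) (simp_all add: add_ac)

context symmetric_operad
begin

lemma partial_comp_closed:
  assumes "\<mu> \<in> arity_ops P (q + length ts + r)" "\<forall>t\<in>set ts. tensor_ok P t"
  shows "partial_comp P q r \<mu> ts \<in> arity_ops P (q + length (tensor_inputs ts) + r)"
  using assms
proof (induction ts arbitrary: q \<mu>)
  case (Cons t ts)
  have "pcomp P (q + 1 + length ts + r) q (length (snd t)) \<mu> (fst t)
      \<in> arity_ops P (q + 1 + length ts + r + length (snd t) - 1)"
    using Cons.prems by (intro pcomp_closed) auto
  then have "pcomp P (q + 1 + length ts + r) q (length (snd t)) \<mu> (fst t)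
      \<in> arity_ops P (q + length (snd t) + length ts + r)"
    by (simp add: add_ac)
  from Cons.IH[OF this] show ?case using Cons.prems by (simp add: add_ac)
qed simp

lemma full_comp_closed:
  assumes "\<mu> \<in> arity_ops P (length ts)" "\<forall>t\<in>set ts. tensor_ok P t"
  shows "full_comp P 0 \<mu> ts \<in> arity_ops P (length (tensor_inputs ts))"
  using partial_comp_closed[of \<mu> 0 ts 0] assms by (simp add: full_comp_eq_partial_comp)

text \<open>Iterated sequential associativity: the slots filled by \<open>us\<close> all lie in the
  inserted \<open>\<mu>\<close>, so they may be filled before \<open>\<mu>\<close> is inserted.
  \<open>j\<close> counts the inputs of \<open>\<mu>\<close> in front of the current slot.\<close>

lemma partial_comp_sequential:
  assumes "\<kappa> \<in> arity_ops P (q + 1 + r)" "\<mu> \<in> arity_ops P (j + length us)" "\<forall>t\<in>set us. tensor_ok P t"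
  shows "partial_comp P (q + j) r (pcomp P (q + 1 + r) q (j + length us) \<kappa> \<mu>) us
    = pcomp P (q + 1 + r) q (j + length (tensor_inputs us)) \<kappa> (partial_comp P j 0 \<mu> us)"
  using assms(2,3)
proof (induction us arbitrary: j \<mu>)
  case (Cons t us)
  let ?n = "length (snd t)" and ?m = "j + 1 + length us"
  have t: "fst t \<in> arity_ops P ?n" and us: "\<forall>t\<in>set us. tensor_ok P t"
    and \<mu>: "\<mu> \<in> arity_ops P ?m" using Cons.prems by auto
  have "pcomp P (q + 1 + r + ?m - 1) (q + j) ?n (pcomp P (q + 1 + r) q ?m \<kappa> \<mu>) (fst t)
      = pcomp P (q + 1 + r) q (?m + ?n - 1) \<kappa> (pcomp P ?m j ?n \<mu> (fst t))"
    by (rule pcomp_sequential[OF assms(1) \<mu> t]) auto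
  then have 1: "pcomp P (q + j + 1 + length us + r) (q + j) ?n (pcomp P (q + 1 + r) q ?m \<kappa> \<mu>) (fst t)
      = pcomp P (q + 1 + r) q (j + ?n + length us) \<kappa> (pcomp P ?m j ?n \<mu> (fst t))"
    by (simp add: add_ac)
  have "pcomp P ?m j ?n \<mu> (fst t) \<in> arity_ops P (?m + ?n - 1)" by (rule pcomp_closed[OF \<mu> t]) simp
  then have 2: "pcomp P ?m j ?n \<mu> (fst t) \<in> arity_ops P (j + ?n + length us)" by (simp add: add_ac)
  have "partial_comp P (q + j) r (pcomp P (q + 1 + r) q (j + length (t # us)) \<kappa> \<mu>) (t # us)
      = partial_comp P (q + (j + ?n)) r
          (pcomp P (q + j + 1 + length us + r) (q + j) ?n (pcomp P (q + 1 + r) q ?m \<kappa> \<mu>) (fst t)) us"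
    by (simp add: add_ac)
  also have "\<dots> = pcomp P (q + 1 + r) q (j + ?n + length (tensor_inputs us)) \<kappa>
      (partial_comp P (j + ?n) 0 (pcomp P ?m j ?n \<mu> (fst t)) us)"
    unfolding 1 by (rule Cons.IH[OF 2 us])
  finally show ?case by (simp add: add_ac)
qed simp

text \<open>Iterated parallel axiom: the slot of \<open>\<nu>\<close> lies to the right of all slots
  filled by \<open>xs\<close>, so the insertions commute. Its offset past \<open>q\<close> changes
  from the number of these slots to the number of inputs that replace them.\<close>

lemma partial_comp_parallel:
  assumes "\<mu> \<in> arity_ops P (q + length xs + 1 + r)" "\<nu> \<in> arity_ops P n" "\<forall>t\<in>set xs. tensor_ok P t"
  shows "partial_comp P q (r + n) (pcomp P (q + length xs + 1 + r) (q + length xs) n \<mu> \<nu>) xs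
    = pcomp P (q + length (tensor_inputs xs) + 1 + r) (q + length (tensor_inputs xs)) n
        (partial_comp P q (1 + r) \<mu> xs) \<nu>"
  using assms(1,3)
proof (induction xs arbitrary: q \<mu>)
  case (Cons t xs)
  let ?m = "length (snd t)" and ?l = "q + length xs + 2 + r" and ?k = "q + length xs + 1"
  have t: "fst t \<in> arity_ops P ?m" and xs: "\<forall>t\<in>set xs. tensor_ok P t"
    and \<mu>: "\<mu> \<in> arity_ops P ?l" using Cons.prems by (auto simp: add_ac)
  have 1: "pcomp P (?l + ?m - 1) (?k + ?m - 1) n (pcomp P ?l q ?m \<mu> (fst t)) \<nu>
      = pcomp P (?l + n - 1) q ?m (pcomp P ?l ?k n \<mu> \<nu>) (fst t)"
    by (rule pcomp_parallel[OF \<mu> t assms(2)]) auto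
  have "pcomp P ?l q ?m \<mu> (fst t) \<in> arity_ops P (?l + ?m - 1)" by (rule pcomp_closed[OF \<mu> t]) simp
  then have 2: "pcomp P ?l q ?m \<mu> (fst t) \<in> arity_ops P (q + ?m + length xs + 1 + r)"
    by (simp add: add_ac)
  have "partial_comp P q (r + n) (pcomp P (q + length (t # xs) + 1 + r) (q + length (t # xs)) n \<mu> \<nu>) (t # xs)
      = partial_comp P (q + ?m) (r + n) (pcomp P (?l + n - 1) q ?m (pcomp P ?l ?k n \<mu> \<nu>) (fst t)) xs"
    by (simp add: add_ac numeral_2_eq_2)
  also have "\<dots> = partial_comp P (q + ?m) (r + n) (pcomp P (q + ?m + length xs + 1 + r) (q + ?m + length xs) n
      (pcomp P ?l q ?m \<mu> (fst t)) \<nu>) xs"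
    unfolding 1[symmetric] by (simp add: add_ac)
  also have "\<dots> = pcomp P (q + ?m + length (tensor_inputs xs) + 1 + r) (q + ?m + length (tensor_inputs xs)) n
        (partial_comp P (q + ?m) (1 + r) (pcomp P ?l q ?m \<mu> (fst t)) xs) \<nu>"
    by (rule Cons.IH[OF 2 xs])
  finally show ?case by (simp add: add_ac numeral_2_eq_2)
qed simp

text \<open>Filling from left to right meets three blocks. Over \<open>xs\<close> the insertion of
  \<open>\<nu>\<close> is postponed by the parallel law, over \<open>us\<close> the arguments are
  absorbed into \<open>\<nu>\<close> by the sequential law, and over \<open>zs\<close> both sides do
  the same.\<close>

lemma full_comp_assoc:
  assumes \<mu>: "\<mu> \<in> arity_ops P (length xs + 1 + length zs)" and \<nu>: "\<nu> \<in> arity_ops P (length us)"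
    and "\<forall>t\<in>set xs. tensor_ok P t" "\<forall>t\<in>set us. tensor_ok P t"
  shows "full_comp P 0 (pcomp P (length xs + 1 + length zs) (length xs) (length us) \<mu> \<nu>) (xs @ us @ zs)
    = full_comp P 0 \<mu> (xs @ [(full_comp P 0 \<nu> us, tensor_inputs us)] @ zs)"
proof -
  let ?a = "length (tensor_inputs xs)" and ?b = "length (tensor_inputs us)" and ?r = "length zs"
  let ?\<mu> = "partial_comp P 0 (1 + ?r) \<mu> xs"
  have c: "?\<mu> \<in> arity_ops P (?a + 1 + ?r)"
    using partial_comp_closed[of \<mu> 0 xs "1 + ?r"] assms by (simp add: add_ac)
  have 1: "partial_comp P 0 (?r + length us) (pcomp P (length xs + 1 + ?r) (length xs) (length us) \<mu> \<nu>) xs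
      = pcomp P (?a + 1 + ?r) ?a (length us) ?\<mu> \<nu>"
    using partial_comp_parallel[of \<mu> 0 xs ?r \<nu> "length us"] assms by simp
  have "full_comp P 0 (pcomp P (length xs + 1 + ?r) (length xs) (length us) \<mu> \<nu>) (xs @ us @ zs)
      = partial_comp P (?a + ?b) 0 (partial_comp P ?a ?r (partial_comp P 0 (?r + length us)
          (pcomp P (length xs + 1 + ?r) (length xs) (length us) \<mu> \<nu>) xs) us) zs"
    by (simp add: full_comp_eq_partial_comp partial_comp_append add_ac)
  also have "\<dots> = partial_comp P (?a + ?b) 0 (pcomp P (?a + 1 + ?r) ?a ?b ?\<mu> (full_comp P 0 \<nu> us)) zs"
    unfolding 1 using partial_comp_sequential[OF c, of \<nu> 0 us] assms by (simp add: full_comp_eq_partial_comp)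
  also have "\<dots> = full_comp P 0 \<mu> (xs @ [(full_comp P 0 \<nu> us, tensor_inputs us)] @ zs)"
    by (simp add: full_comp_eq_partial_comp partial_comp_append add_ac)
  finally show ?thesis .
qed

lemma partial_comp_add:
  assumes "\<mu> \<in> arity_ops P (q + length ts + r)" "\<nu> \<in> arity_ops P (q + length ts + r)"
    and "\<forall>t\<in>set ts. tensor_ok P t"
  shows "partial_comp P q r (\<mu> \<oplus>\<^bsub>opmod P (q + length ts + r)\<^esub> \<nu>) ts
    = partial_comp P q r \<mu> ts \<oplus>\<^bsub>opmod P (q + length (tensor_inputs ts) + r)\<^esub> partial_comp P q r \<nu> ts"
  using assms
proof (induction ts arbitrary: q \<mu> \<nu>)
  case (Cons t ts)
  let ?n = "length (snd t)" and ?m = "q + 1 + length ts + r"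
  have t: "fst t \<in> arity_ops P ?n" and ts: "\<forall>t\<in>set ts. tensor_ok P t"
    and c: "\<mu> \<in> arity_ops P ?m" "\<nu> \<in> arity_ops P ?m" using Cons.prems by auto
  have e: "?m + ?n - 1 = q + ?n + length ts + r" by simp
  have cl: "pcomp P ?m q ?n \<xi> (fst t) \<in> arity_ops P (q + ?n + length ts + r)" if "\<xi> \<in> arity_ops P ?m" for \<xi>
    using pcomp_closed[OF that t, of q] unfolding e by simp
  have "pcomp P ?m q ?n (\<mu> \<oplus>\<^bsub>opmod P ?m\<^esub> \<nu>) (fst t)
      = pcomp P ?m q ?n \<mu> (fst t) \<oplus>\<^bsub>opmod P (q + ?n + length ts + r)\<^esub> pcomp P ?m q ?n \<nu> (fst t)"
    using pcomp_add_left[OF c t, of q] unfolding e by simp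
  then have "partial_comp P q r (\<mu> \<oplus>\<^bsub>opmod P ?m\<^esub> \<nu>) (t # ts)
    = partial_comp P q r \<mu> (t # ts) \<oplus>\<^bsub>opmod P (q + ?n + length (tensor_inputs ts) + r)\<^esub> partial_comp P q r \<nu> (t # ts)"
    using Cons.IH[OF cl[OF c(1)] cl[OF c(2)] ts] by simp
  then show ?case by (simp add: add_ac)
qed simp

lemma partial_comp_smult:
  assumes "a \<in> carrier R" "\<mu> \<in> arity_ops P (q + length ts + r)" "\<forall>t\<in>set ts. tensor_ok P t"
  shows "partial_comp P q r (a \<odot>\<^bsub>opmod P (q + length ts + r)\<^esub> \<mu>) ts
    = a \<odot>\<^bsub>opmod P (q + length (tensor_inputs ts) + r)\<^esub> partial_comp P q r \<mu> ts"
  using assms(2,3)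
proof (induction ts arbitrary: q \<mu>)
  case (Cons t ts)
  let ?n = "length (snd t)" and ?m = "q + 1 + length ts + r"
  have t: "fst t \<in> arity_ops P ?n" and ts: "\<forall>t\<in>set ts. tensor_ok P t"
    and c: "\<mu> \<in> arity_ops P ?m" using Cons.prems by auto
  have e: "?m + ?n - 1 = q + ?n + length ts + r" by simp
  have cl: "pcomp P ?m q ?n \<mu> (fst t) \<in> arity_ops P (q + ?n + length ts + r)"
    using pcomp_closed[OF c t, of q] unfolding e by simp
  have "pcomp P ?m q ?n (a \<odot>\<^bsub>opmod P ?m\<^esub> \<mu>) (fst t)
      = a \<odot>\<^bsub>opmod P (q + ?n + length ts + r)\<^esub> pcomp P ?m q ?n \<mu> (fst t)"
    using pcomp_smult_left[OF assms(1) c t, of q] unfolding e by simp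
  then have "partial_comp P q r (a \<odot>\<^bsub>opmod P ?m\<^esub> \<mu>) (t # ts)
    = a \<odot>\<^bsub>opmod P (q + ?n + length (tensor_inputs ts) + r)\<^esub> partial_comp P q r \<mu> (t # ts)"
    using Cons.IH[OF cl ts] by simp
  then show ?case by (simp add: add_ac)
qed simp

lemma full_comp_add:
  assumes "\<mu> \<in> arity_ops P (length ts)" "\<nu> \<in> arity_ops P (length ts)" "\<forall>t\<in>set ts. tensor_ok P t"
  shows "full_comp P 0 (\<mu> \<oplus>\<^bsub>opmod P (length ts)\<^esub> \<nu>) ts
    = full_comp P 0 \<mu> ts \<oplus>\<^bsub>opmod P (length (tensor_inputs ts))\<^esub> full_comp P 0 \<nu> ts"
  using partial_comp_add[of \<mu> 0 ts 0 \<nu>] assms by (simp add: full_comp_eq_partial_comp)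

lemma full_comp_smult:
  assumes "a \<in> carrier R" "\<mu> \<in> arity_ops P (length ts)" "\<forall>t\<in>set ts. tensor_ok P t"
  shows "full_comp P 0 (a \<odot>\<^bsub>opmod P (length ts)\<^esub> \<mu>) ts
    = a \<odot>\<^bsub>opmod P (length (tensor_inputs ts))\<^esub> full_comp P 0 \<mu> ts"
  using partial_comp_smult[of a \<mu> 0 ts 0] assms by (simp add: full_comp_eq_partial_comp)

lemma partial_comp_units:
  assumes "\<mu> \<in> arity_ops P (q + length vs + r)"
  shows "partial_comp P q r \<mu> (map (\<lambda>v. (opunit P, [v])) vs) = \<mu>"
  using assms
proof (induction vs arbitrary: q)
  case (Cons v vs)
  have "pcomp P (q + 1 + length vs + r) q 1 \<mu> (opunit P) = \<mu>"
    using Cons.prems by (intro opunit_right) auto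
  then show ?case using Cons.IH[of "q + 1"] Cons.prems by simp
qed simp

text \<open>One right unit law per slot. It makes the tensors \<open>1 \<otimes> v\<close> behave as
  formal generators: applying \<open>\<mu>\<close> to them yields the pure tensor with operation
  \<open>\<mu>\<close> itself.\<close>

lemma full_comp_units:
  "\<mu> \<in> arity_ops P (length vs) \<Longrightarrow> full_comp P 0 \<mu> (map (\<lambda>v. (opunit P, [v])) vs) = \<mu>"
  using partial_comp_units[of \<mu> 0 vs 0] by (simp add: full_comp_eq_partial_comp)

lemma full_comp_single:
  assumes "tensor_ok P t"
  shows "full_comp P 0 (opunit P) [t] = fst t"
  using opunit_left[OF assms] by simp

end

section \<open>The free algebra\<close>

lemma (in module) submodule_gen_submodule:
  assumes "X \<subseteq> carrier M"
  shows "submodule (submodule_gen R M X) R M"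
proof (rule submoduleI)
  \<comment> \<open>The carrier is one of the submodules that are intersected, which keeps the
    intersection inside it.\<close>
  show "submodule_gen R M X \<subseteq> carrier M"
    using assms carrier_is_submodule by (auto simp: submodule_gen_def)
  show "\<zero>\<^bsub>M\<^esub> \<in> submodule_gen R M X"
    using subgroup.one_closed[OF submodule.axioms(1)] by (fastforce simp: submodule_gen_def)
qed (auto simp: submodule_gen_def submoduleE)

lemma submodule_gen_superset: "X \<subseteq> submodule_gen R M X"
  by (auto simp: submodule_gen_def)

lemma submodule_gen_least: "submodule N R M \<Longrightarrow> X \<subseteq> N \<Longrightarrow> submodule_gen R M X \<subseteq> N"
  by (auto simp: submodule_gen_def)

section \<open>Formal tensors and the submodule of relations\<close>

locale free_operad_algebra = symmetric_operad R P + V: module R V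
  for R :: "('r, 's) ring_scheme" (structure) and P :: "('r, 'p) operad"
    and V :: "('r, 'v, 't) module_scheme"
begin

abbreviation F where "F \<equiv> tensor_free_module R P V"
abbreviation K where "K \<equiv> submodule_gen R F (tensor_relations R P V)"
abbreviation PT where "PT \<equiv> pure_tensors P V"
abbreviation \<delta> where "\<delta> \<equiv> basis_elt R"

lemma PT_iff: "(\<mu>, vs) \<in> PT \<longleftrightarrow> set vs \<subseteq> carrier V \<and> \<mu> \<in> arity_ops P (length vs)"
  by (simp add: pure_tensors_def)

lemma PT_ok: "t \<in> PT \<Longrightarrow> tensor_ok P t"
  by (cases t) (simp add: PT_iff)

lemma PT_inputs: "set ts \<subseteq> PT \<Longrightarrow> set (tensor_inputs ts) \<subseteq> carrier V"
proof
  fix x assume ts: "set ts \<subseteq> PT" and "x \<in> set (tensor_inputs ts)"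
  then obtain t where "t \<in> set ts" "x \<in> set (snd t)" by auto
  moreover have "t \<in> PT" using ts calculation(1) by (rule subsetD)
  ultimately show "x \<in> carrier V" unfolding pure_tensors_def by auto
qed

sublocale F: module R F
  by (rule module_free_module)

lemma \<delta>_closed: "t \<in> PT \<Longrightarrow> \<delta> t \<in> carrier F"
  by (rule basis_elt_closed)

lemma opmod_closed:
  "\<mu> \<in> arity_ops P n \<Longrightarrow> \<nu> \<in> arity_ops P n \<Longrightarrow> \<mu> \<oplus>\<^bsub>opmod P n\<^esub> \<nu> \<in> arity_ops P n"
  "r \<in> carrier R \<Longrightarrow> \<mu> \<in> arity_ops P n \<Longrightarrow> r \<odot>\<^bsub>opmod P n\<^esub> \<mu> \<in> arity_ops P n"
proof -
  interpret Pn: module R "opmod P n" by (rule opmod_module)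
  show "\<mu> \<in> arity_ops P n \<Longrightarrow> \<nu> \<in> arity_ops P n \<Longrightarrow> \<mu> \<oplus>\<^bsub>opmod P n\<^esub> \<nu> \<in> arity_ops P n"
    by (rule Pn.M.a_closed)
  show "r \<in> carrier R \<Longrightarrow> \<mu> \<in> arity_ops P n \<Longrightarrow> r \<odot>\<^bsub>opmod P n\<^esub> \<mu> \<in> arity_ops P n"
    by (rule Pn.smult_closed)
qed

lemma PT_closed:
  assumes "set vs \<subseteq> carrier V" "\<mu> \<in> arity_ops P (length vs)"
  shows "(\<mu>, vs) \<in> PT"
    and "\<nu> \<in> arity_ops P (length vs) \<Longrightarrow> (\<mu> \<oplus>\<^bsub>opmod P (length vs)\<^esub> \<nu>, vs) \<in> PT"
    and "r \<in> carrier R \<Longrightarrow> (r \<odot>\<^bsub>opmod P (length vs)\<^esub> \<mu>, vs) \<in> PT"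
    and "x \<in> carrier V \<Longrightarrow> (\<mu>, vs[i := x]) \<in> PT"
    and "\<sigma> permutes {..<length vs} \<Longrightarrow> (act P (length vs) \<mu> \<sigma>, vs) \<in> PT"
    and "\<sigma> permutes {..<length vs} \<Longrightarrow> (\<mu>, permute_list (inv_into UNIV \<sigma>) vs) \<in> PT"
  using assms by (simp_all add: PT_iff opmod_closed set_update_subset act_closed permutes_inv)

lemma tensor_relations_closed: "tensor_relations R P V \<subseteq> carrier F"
  unfolding tensor_relations_def Let_def
  by (auto simp: \<delta>_closed PT_closed)

lemma K_submodule: "submodule K R F"
  by (rule F.submodule_gen_submodule[OF tensor_relations_closed])

sublocale Q: submodule_of_module R F K
  by (intro submodule_of_module.intro submodule_of_module_axioms.intro F.module_axioms K_submodule)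

text \<open>The last five hypotheses are the five families of relations, read under
  \<open>H\<close>. It serves twice: for the morphism out of the free algebra, and with values in
  the quotient itself, to see that an operation sends a relation placed in one argument to
  zero.\<close>

lemma kernel_K:
  assumes N: "module R N" and H: "lin_map R F N H" and f: "f \<in> K"
    and add_op: "\<And>\<mu> \<nu> vs. \<lbrakk>set vs \<subseteq> carrier V; \<mu> \<in> arity_ops P (length vs); \<nu> \<in> arity_ops P (length vs)\<rbrakk> \<Longrightarrow>
        H (\<delta> (\<mu> \<oplus>\<^bsub>opmod P (length vs)\<^esub> \<nu>, vs)) = H (\<delta> (\<mu>, vs)) \<oplus>\<^bsub>N\<^esub> H (\<delta> (\<nu>, vs))"
    and smult_op: "\<And>r \<mu> vs. \<lbrakk>r \<in> carrier R; set vs \<subseteq> carrier V; \<mu> \<in> arity_ops P (length vs)\<rbrakk> \<Longrightarrow>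
        H (\<delta> (r \<odot>\<^bsub>opmod P (length vs)\<^esub> \<mu>, vs)) = r \<odot>\<^bsub>N\<^esub> H (\<delta> (\<mu>, vs))"
    and add_arg: "\<And>\<mu> vs i x y. \<lbrakk>set vs \<subseteq> carrier V; \<mu> \<in> arity_ops P (length vs); i < length vs;
        x \<in> carrier V; y \<in> carrier V\<rbrakk> \<Longrightarrow>
        H (\<delta> (\<mu>, vs[i := x \<oplus>\<^bsub>V\<^esub> y])) = H (\<delta> (\<mu>, vs[i := x])) \<oplus>\<^bsub>N\<^esub> H (\<delta> (\<mu>, vs[i := y]))"
    and smult_arg: "\<And>\<mu> vs i r x. \<lbrakk>set vs \<subseteq> carrier V; \<mu> \<in> arity_ops P (length vs); i < length vs;
        r \<in> carrier R; x \<in> carrier V\<rbrakk> \<Longrightarrow>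
        H (\<delta> (\<mu>, vs[i := r \<odot>\<^bsub>V\<^esub> x])) = r \<odot>\<^bsub>N\<^esub> H (\<delta> (\<mu>, vs[i := x]))"
    and act: "\<And>\<mu> vs \<sigma>. \<lbrakk>set vs \<subseteq> carrier V; \<mu> \<in> arity_ops P (length vs); \<sigma> permutes {..<length vs}\<rbrakk> \<Longrightarrow>
        H (\<delta> (act P (length vs) \<mu> \<sigma>, vs)) = H (\<delta> (\<mu>, permute_list (inv_into UNIV \<sigma>) vs))"
  shows "H f = \<zero>\<^bsub>N\<^esub>"
proof -
  interpret N: module R N by (rule N)
  note simps = lin_map_minus[OF F.module_axioms N H] lin_mapD[OF H] minus_eq_zero_iff[OF N.M.abelian_group_axioms]
    \<delta>_closed PT_closed
  have "H \<rho> = \<zero>\<^bsub>N\<^esub>" if "\<rho> \<in> tensor_relations R P V" for \<rho>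
    using that unfolding tensor_relations_def Let_def
    by (auto simp: simps add_op smult_op add_arg smult_arg act)
  then have "tensor_relations R P V \<subseteq> {f \<in> carrier F. H f = \<zero>\<^bsub>N\<^esub>}"
    using tensor_relations_closed by auto
  from submodule_gen_least[OF submodule_kernel[OF F.module_axioms N H] this] f show ?thesis by auto
qed

text \<open>Short for "pure tensor": the class of
  \<open>\<mu> \<otimes> v\<^sub>0 \<otimes> ...\<close> in the free algebra.\<close>

definition pt :: "'p \<Rightarrow> 'v list \<Rightarrow> (('p, 'v) tensor \<Rightarrow> 'r) set"
  where "pt \<mu> vs = K +>\<^bsub>F\<^esub> \<delta> (\<mu>, vs)"

abbreviation Q where "Q \<equiv> quot_module F K"

lemma pt_relations:
  assumes vs: "set vs \<subseteq> carrier V" and \<mu>: "\<mu> \<in> arity_ops P (length vs)"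
  shows "\<nu> \<in> arity_ops P (length vs) \<Longrightarrow> pt (\<mu> \<oplus>\<^bsub>opmod P (length vs)\<^esub> \<nu>) vs = pt \<mu> vs \<oplus>\<^bsub>Q\<^esub> pt \<nu> vs"
    and "r \<in> carrier R \<Longrightarrow> pt (r \<odot>\<^bsub>opmod P (length vs)\<^esub> \<mu>) vs = r \<odot>\<^bsub>Q\<^esub> pt \<mu> vs"
    and "\<lbrakk>i < length vs; x \<in> carrier V; y \<in> carrier V\<rbrakk> \<Longrightarrow>
      pt \<mu> (vs[i := x \<oplus>\<^bsub>V\<^esub> y]) = pt \<mu> (vs[i := x]) \<oplus>\<^bsub>Q\<^esub> pt \<mu> (vs[i := y])"
    and "\<lbrakk>i < length vs; r \<in> carrier R; x \<in> carrier V\<rbrakk> \<Longrightarrow>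
      pt \<mu> (vs[i := r \<odot>\<^bsub>V\<^esub> x]) = r \<odot>\<^bsub>Q\<^esub> pt \<mu> (vs[i := x])"
    and "\<sigma> permutes {..<length vs} \<Longrightarrow> pt (act P (length vs) \<mu> \<sigma>) vs = pt \<mu> (permute_list (inv_into UNIV \<sigma>) vs)"
proof -
  have cls: "K +>\<^bsub>F\<^esub> f = K +>\<^bsub>F\<^esub> g"
    if "f \<ominus>\<^bsub>F\<^esub> g \<in> tensor_relations R P V" "f \<in> carrier F" "g \<in> carrier F" for f g
    by (rule iffD2[OF Q.cls_eq_iff[OF that(2,3)] subsetD[OF submodule_gen_superset that(1)]])
  note cl = F.M.a_closed F.smult_closed \<delta>_closed PT_closed V.M.a_closed V.smult_closed
  show "pt (\<mu> \<oplus>\<^bsub>opmod P (length vs)\<^esub> \<nu>) vs = pt \<mu> vs \<oplus>\<^bsub>Q\<^esub> pt \<nu> vs"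
    if "\<nu> \<in> arity_ops P (length vs)"
  proof -
    have "\<delta> (\<mu> \<oplus>\<^bsub>opmod P (length vs)\<^esub> \<nu>, vs) \<ominus>\<^bsub>F\<^esub> (\<delta> (\<mu>, vs) \<oplus>\<^bsub>F\<^esub> \<delta> (\<nu>, vs)) \<in> tensor_relations R P V"
      unfolding tensor_relations_def Let_def
      \<comment> \<open>The union in \<open>tensor_relations\<close> associates to the left; a chain
        of \<open>UnI1\<close> and \<open>UnI2\<close> picks one of its five families, here the
        first.\<close>
      by (rule UnI1, rule UnI1, rule UnI1, rule UnI1, rule CollectI, intro exI conjI, rule refl)
        (simp_all only: vs \<mu> that)
    then have "K +>\<^bsub>F\<^esub> \<delta> (\<mu> \<oplus>\<^bsub>opmod P (length vs)\<^esub> \<nu>, vs) = K +>\<^bsub>F\<^esub> (\<delta> (\<mu>, vs) \<oplus>\<^bsub>F\<^esub> \<delta> (\<nu>, vs))"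
      by (rule cls) (simp_all only: cl vs \<mu> that)
    then show ?thesis unfolding pt_def by (simp only: Q.cls_add cl vs \<mu> that)
  qed
  show "pt (r \<odot>\<^bsub>opmod P (length vs)\<^esub> \<mu>) vs = r \<odot>\<^bsub>Q\<^esub> pt \<mu> vs"
    if "r \<in> carrier R"
  proof -
    have "\<delta> (r \<odot>\<^bsub>opmod P (length vs)\<^esub> \<mu>, vs) \<ominus>\<^bsub>F\<^esub> (r \<odot>\<^bsub>F\<^esub> \<delta> (\<mu>, vs)) \<in> tensor_relations R P V"
      unfolding tensor_relations_def Let_def
      by (rule UnI1, rule UnI1, rule UnI1, rule UnI2, rule CollectI, intro exI conjI, rule refl)
        (simp_all only: vs \<mu> that)
    then have "K +>\<^bsub>F\<^esub> \<delta> (r \<odot>\<^bsub>opmod P (length vs)\<^esub> \<mu>, vs) = K +>\<^bsub>F\<^esub> (r \<odot>\<^bsub>F\<^esub> \<delta> (\<mu>, vs))"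
      by (rule cls) (simp_all only: cl vs \<mu> that)
    then show ?thesis unfolding pt_def by (simp only: Q.cls_smult cl vs \<mu> that)
  qed
  show "pt \<mu> (vs[i := x \<oplus>\<^bsub>V\<^esub> y]) = pt \<mu> (vs[i := x]) \<oplus>\<^bsub>Q\<^esub> pt \<mu> (vs[i := y])"
    if "i < length vs" "x \<in> carrier V" "y \<in> carrier V"
  proof -
    have "\<delta> (\<mu>, vs[i := x \<oplus>\<^bsub>V\<^esub> y]) \<ominus>\<^bsub>F\<^esub> (\<delta> (\<mu>, vs[i := x]) \<oplus>\<^bsub>F\<^esub> \<delta> (\<mu>, vs[i := y])) \<in> tensor_relations R P V"
      unfolding tensor_relations_def Let_def
      by (rule UnI1, rule UnI1, rule UnI2, rule CollectI, intro exI conjI, rule refl)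
        (simp_all only: vs \<mu> that)
    then have "K +>\<^bsub>F\<^esub> \<delta> (\<mu>, vs[i := x \<oplus>\<^bsub>V\<^esub> y]) = K +>\<^bsub>F\<^esub> (\<delta> (\<mu>, vs[i := x]) \<oplus>\<^bsub>F\<^esub> \<delta> (\<mu>, vs[i := y]))"
      by (rule cls) (simp_all only: cl vs \<mu> that)
    then show ?thesis unfolding pt_def by (simp only: Q.cls_add cl vs \<mu> that)
  qed
  show "pt \<mu> (vs[i := r \<odot>\<^bsub>V\<^esub> x]) = r \<odot>\<^bsub>Q\<^esub> pt \<mu> (vs[i := x])"
    if "i < length vs" "r \<in> carrier R" "x \<in> carrier V"
  proof -
    have "\<delta> (\<mu>, vs[i := r \<odot>\<^bsub>V\<^esub> x]) \<ominus>\<^bsub>F\<^esub> (r \<odot>\<^bsub>F\<^esub> \<delta> (\<mu>, vs[i := x])) \<in> tensor_relations R P V"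
      unfolding tensor_relations_def Let_def
      by (rule UnI1, rule UnI2, rule CollectI, intro exI conjI, rule refl)
        (simp_all only: vs \<mu> that)
    then have "K +>\<^bsub>F\<^esub> \<delta> (\<mu>, vs[i := r \<odot>\<^bsub>V\<^esub> x]) = K +>\<^bsub>F\<^esub> (r \<odot>\<^bsub>F\<^esub> \<delta> (\<mu>, vs[i := x]))"
      by (rule cls) (simp_all only: cl vs \<mu> that)
    then show ?thesis unfolding pt_def by (simp only: Q.cls_smult cl vs \<mu> that)
  qed
  show "pt (act P (length vs) \<mu> \<sigma>) vs = pt \<mu> (permute_list (inv_into UNIV \<sigma>) vs)"
    if "\<sigma> permutes {..<length vs}"
  proof -
    have "\<delta> (act P (length vs) \<mu> \<sigma>, vs) \<ominus>\<^bsub>F\<^esub> (\<delta> (\<mu>, permute_list (inv_into UNIV \<sigma>) vs)) \<in> tensor_relations R P V"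
      unfolding tensor_relations_def Let_def
      by (rule UnI2, rule CollectI, intro exI conjI, rule refl)
        (simp_all only: vs \<mu> that)
    then have "K +>\<^bsub>F\<^esub> \<delta> (act P (length vs) \<mu> \<sigma>, vs) = K +>\<^bsub>F\<^esub> (\<delta> (\<mu>, permute_list (inv_into UNIV \<sigma>) vs))"
      by (rule cls) (simp_all only: cl vs \<mu> that)
    then show ?thesis unfolding pt_def by assumption
  qed
qed

lemma pt_closed: "set vs \<subseteq> carrier V \<Longrightarrow> \<mu> \<in> arity_ops P (length vs) \<Longrightarrow> pt \<mu> vs \<in> carrier Q"
  by (auto simp: pt_def Q.carrier_Q \<delta>_closed PT_closed)

section \<open>Operations on pure tensors, computed modulo the relations\<close>

definition ev :: "'p \<Rightarrow> ('p, 'v) tensor list \<Rightarrow> (('p, 'v) tensor \<Rightarrow> 'r) set"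
  where "ev \<mu> ts = pt (full_comp P 0 \<mu> ts) (tensor_inputs ts)"

abbreviation units :: "'v list \<Rightarrow> ('p, 'v) tensor list"
  where "units vs \<equiv> map (\<lambda>v. (opunit P, [v])) vs"

text \<open>The second form is what the simplifier produces when it fuses the two maps.\<close>

lemma tensor_inputs_units: "tensor_inputs (units vs) = vs" "concat (map (snd \<circ> (\<lambda>v. (opunit P, [v]))) vs) = vs"
  by (induction vs) simp_all

lemma units_PT: "set vs \<subseteq> carrier V \<Longrightarrow> set (units vs) \<subseteq> PT"
  using opunit_closed by (auto simp: PT_iff)

lemma full_comp_PT:
  assumes "set ts \<subseteq> PT" "\<mu> \<in> arity_ops P (length ts)"
  shows "full_comp P 0 \<mu> ts \<in> arity_ops P (length (tensor_inputs ts))" "(full_comp P 0 \<mu> ts, tensor_inputs ts) \<in> PT"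
proof -
  show "full_comp P 0 \<mu> ts \<in> arity_ops P (length (tensor_inputs ts))"
    using assms PT_ok by (intro full_comp_closed) auto
  then show "(full_comp P 0 \<mu> ts, tensor_inputs ts) \<in> PT" using PT_inputs[OF assms(1)] by (simp add: PT_iff)
qed

lemma ev_assoc:
  assumes "\<mu> \<in> arity_ops P (length xs + 1 + length zs)" "\<nu> \<in> arity_ops P (length us)"
    and "set xs \<subseteq> PT" "set us \<subseteq> PT"
  shows "ev (pcomp P (length xs + 1 + length zs) (length xs) (length us) \<mu> \<nu>) (xs @ us @ zs)
    = ev \<mu> (xs @ [(full_comp P 0 \<nu> us, tensor_inputs us)] @ zs)"
proof -
  have "\<forall>t\<in>set xs. tensor_ok P t" "\<forall>t\<in>set us. tensor_ok P t" using assms PT_ok by blast+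
  from full_comp_assoc[OF assms(1,2) this] show ?thesis by (simp add: ev_def)
qed

text \<open>The case \<open>us = units vs\<close> of \<open>ev_assoc\<close>, read from right to
  left: composing \<open>\<nu>\<close> with units returns \<open>\<nu>\<close> together with the
  inputs \<open>vs\<close>.\<close>

lemma ev_expand:
  assumes "\<mu> \<in> arity_ops P (length xs + 1 + length zs)" "set xs \<subseteq> PT" "(\<nu>, vs) \<in> PT"
  shows "ev \<mu> (xs @ [(\<nu>, vs)] @ zs)
    = ev (pcomp P (length xs + 1 + length zs) (length xs) (length vs) \<mu> \<nu>) (xs @ units vs @ zs)"
  using ev_assoc[of \<mu> xs zs \<nu> "units vs"] assms units_PT
  by (simp add: PT_iff full_comp_units tensor_inputs_units)

lemma ev_units: "\<mu> \<in> arity_ops P (length vs) \<Longrightarrow> ev \<mu> (units vs) = pt \<mu> vs"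
  by (simp add: ev_def full_comp_units tensor_inputs_units)

lemma ev_act:
  assumes "set ts \<subseteq> PT" "\<mu> \<in> arity_ops P (length ts)" "\<sigma> permutes {..<length ts}"
  shows "ev (act P (length ts) \<mu> \<sigma>) ts = ev \<mu> (permute_list (inv_into UNIV \<sigma>) ts)"
  using assms
\<comment> \<open>The measure counts the arguments that are not of the form
  \<open>1 \<otimes> v\<close>. Opening such an argument may lengthen the list and changes the
  operation and the permutation, but it lowers this count.\<close>
proof (induction "length (filter (\<lambda>t. t \<notin> range (\<lambda>v. (opunit P, [v]))) ts)" arbitrary: ts \<mu> \<sigma> rule: less_induct)
  case less
  let ?U = "range (\<lambda>v. (opunit P, [v]))"
  show ?case
  proof (cases "set ts \<subseteq> ?U")
    case True
    then have "ts \<in> lists ((\<lambda>v. (opunit P, [v])) ` UNIV)" by auto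
    then obtain vs where ts: "ts = units vs" by (auto simp: lists_image)
    have vs: "set vs \<subseteq> carrier V" using less.prems(1) by (auto simp: ts PT_iff)
    have \<sigma>: "\<sigma> permutes {..<length vs}" "inv_into UNIV \<sigma> permutes {..<length vs}"
      using less.prems(3) by (simp_all add: ts permutes_inv)
    have \<mu>: "\<mu> \<in> arity_ops P (length vs)" using less.prems(2) by (simp add: ts)
    have "ev (act P (length ts) \<mu> \<sigma>) ts = pt (act P (length vs) \<mu> \<sigma>) vs"
      using act_closed[OF \<mu> \<sigma>(1)] by (simp add: ts ev_units)
    also have "\<dots> = pt \<mu> (permute_list (inv_into UNIV \<sigma>) vs)" by (rule pt_relations(5)[OF vs \<mu> \<sigma>(1)])
    also have "\<dots> = ev \<mu> (permute_list (inv_into UNIV \<sigma>) ts)"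
      using \<mu> by (simp add: ts permute_list_map[OF \<sigma>(2)] ev_units)
    finally show ?thesis .
  next
    case False
    then obtain t where "t \<in> set ts" and t: "t \<notin> ?U" by auto
    then obtain xs zs where ts: "ts = xs @ [t] @ zs" using split_list by fastforce
    obtain \<nu> vs where tv: "t = (\<nu>, vs)" by (cases t)
    let ?m = "length xs + 1 + length zs" and ?n = "length vs" and ?i = "length xs" and ?us = "units vs"
    have sub: "set xs \<subseteq> PT" "set zs \<subseteq> PT" and t_PT: "(\<nu>, vs) \<in> PT" using less.prems(1) by (auto simp: ts tv)
    have \<mu>: "\<mu> \<in> arity_ops P ?m" and \<sigma>: "\<sigma> permutes {..<?m}" and \<nu>: "\<nu> \<in> arity_ops P ?n"
      using less.prems t_PT by (auto simp: ts PT_iff)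
    have \<sigma>i: "\<sigma> ?i < ?m" using permutes_in_image[OF \<sigma>] by simp
    have us: "set ?us \<subseteq> PT" using t_PT by (intro units_PT) (simp add: PT_iff)
    let ?ts' = "xs @ ?us @ zs"
    have len: "length ?ts' = ?m + ?n - 1" by simp
    define l where "l = permute_list (inv_into UNIV \<sigma>) ts"
    let ?xs = "take (\<sigma> ?i) l" and ?zs = "drop (Suc (\<sigma> ?i)) l"
    note outer = permute_list_outer[OF \<sigma>, where t = t, folded ts, folded l_def]
    have "set l = set ts" unfolding l_def using less.prems(3) by (simp add: permutes_inv)
    then have sub': "set ?xs \<subseteq> PT" "set ?zs \<subseteq> PT"
      using less.prems(1) by (auto dest: in_set_takeD in_set_dropD)
    have len': "length ?xs = \<sigma> ?i" "\<sigma> ?i + 1 + length ?zs = ?m"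
      using \<sigma>i by (auto simp: l_def ts)
    \<comment> \<open>Open \<open>t\<close>, move \<open>\<sigma>\<close> out of the partial
      composition as a block permutation, apply the induction hypothesis, and close the block again
      inside the permuted list.\<close>
    have "ev (act P (length ts) \<mu> \<sigma>) ts = ev (pcomp P ?m ?i ?n (act P ?m \<mu> \<sigma>) \<nu>) ?ts'"
      using ev_expand[OF act_closed[OF \<mu> \<sigma>] sub(1) t_PT] by (simp add: ts tv)
    also have "\<dots> = ev (act P (length ?ts') (pcomp P ?m (\<sigma> ?i) ?n \<mu> \<nu>) (outer_perm ?i ?n \<sigma>)) ?ts'"
      unfolding len by (subst pcomp_act_left[OF \<mu> \<nu> _ \<sigma>]) simp_all
    also have "\<dots> = ev (pcomp P ?m (\<sigma> ?i) ?n \<mu> \<nu>) (permute_list (inv_into UNIV (outer_perm ?i ?n \<sigma>)) ?ts')"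
    proof (rule less.hyps)
      show "length (filter (\<lambda>t. t \<notin> ?U) ?ts') < length (filter (\<lambda>t. t \<notin> ?U) ts)"
        using t by (auto simp: ts filter_empty_conv)
      show "set ?ts' \<subseteq> PT" using sub us by auto
      show "pcomp P ?m (\<sigma> ?i) ?n \<mu> \<nu> \<in> arity_ops P (length ?ts')"
        unfolding len by (rule pcomp_closed[OF \<mu> \<nu> \<sigma>i])
      show "outer_perm ?i ?n \<sigma> permutes {..<length ?ts'}"
        unfolding len by (rule outer_perm_permutes[OF \<sigma>]) simp
    qed
    also have "permute_list (inv_into UNIV (outer_perm ?i ?n \<sigma>)) ?ts' = ?xs @ ?us @ ?zs"
      using outer(1)[of ?us] by simp
    also have "ev (pcomp P ?m (\<sigma> ?i) ?n \<mu> \<nu>) (?xs @ ?us @ ?zs) = ev \<mu> (?xs @ [t] @ ?zs)"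
      using ev_expand[of \<mu> ?xs ?zs \<nu> vs, unfolded len', OF \<mu> sub'(1) t_PT] unfolding tv by (rule sym)
    also have "?xs @ [t] @ ?zs = l" using outer(2) by simp
    finally show ?thesis by (simp add: l_def)
  qed
qed

lemma ev_add_op:
  assumes "set ts \<subseteq> PT" "\<mu> \<in> arity_ops P (length ts)" "\<nu> \<in> arity_ops P (length ts)"
  shows "ev (\<mu> \<oplus>\<^bsub>opmod P (length ts)\<^esub> \<nu>) ts = ev \<mu> ts \<oplus>\<^bsub>Q\<^esub> ev \<nu> ts"
proof -
  have "\<forall>t\<in>set ts. tensor_ok P t" using assms PT_ok by blast
  with assms show ?thesis
    unfolding ev_def by (simp only: full_comp_add pt_relations PT_inputs full_comp_PT)
qed

lemma ev_smult_op:
  assumes "set ts \<subseteq> PT" "\<mu> \<in> arity_ops P (length ts)" "r \<in> carrier R"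
  shows "ev (r \<odot>\<^bsub>opmod P (length ts)\<^esub> \<mu>) ts = r \<odot>\<^bsub>Q\<^esub> ev \<mu> ts"
proof -
  have "\<forall>t\<in>set ts. tensor_ok P t" using assms PT_ok by blast
  with assms show ?thesis
    unfolding ev_def by (simp only: full_comp_smult pt_relations PT_inputs full_comp_PT)
qed

text \<open>The relations in the operation of one argument. After that argument is opened by
  \<open>ev_expand\<close>, its operation is the right factor of a partial composition, where the
  axioms for \<open>\<mu> \<circ>\<^sub>i \<nu>\<close> apply. For the permuted operation,
  \<open>ev_act\<close> then turns the block permutation of the inputs into a permutation of
  \<open>vs\<close>.\<close>

lemma ev_inner_op:
  assumes \<mu>: "\<mu> \<in> arity_ops P (length xs + 1 + length zs)" and sub: "set xs \<subseteq> PT" "set zs \<subseteq> PT"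
    and vs: "set vs \<subseteq> carrier V" and \<nu>: "\<nu> \<in> arity_ops P (length vs)"
  shows "\<nu>' \<in> arity_ops P (length vs) \<Longrightarrow> ev \<mu> (xs @ [(\<nu> \<oplus>\<^bsub>opmod P (length vs)\<^esub> \<nu>', vs)] @ zs)
      = ev \<mu> (xs @ [(\<nu>, vs)] @ zs) \<oplus>\<^bsub>Q\<^esub> ev \<mu> (xs @ [(\<nu>', vs)] @ zs)"
    and "r \<in> carrier R \<Longrightarrow> ev \<mu> (xs @ [(r \<odot>\<^bsub>opmod P (length vs)\<^esub> \<nu>, vs)] @ zs)
      = r \<odot>\<^bsub>Q\<^esub> ev \<mu> (xs @ [(\<nu>, vs)] @ zs)"
    and "\<tau> permutes {..<length vs} \<Longrightarrow> ev \<mu> (xs @ [(act P (length vs) \<nu> \<tau>, vs)] @ zs)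
      = ev \<mu> (xs @ [(\<nu>, permute_list (inv_into UNIV \<tau>) vs)] @ zs)"
proof -
  let ?m = "length xs + 1 + length zs" and ?i = "length xs" and ?n = "length vs"
  let ?l = "xs @ units vs @ zs"
  have i: "?i < ?m" by simp
  have len: "?m + ?n - 1 = length ?l" by simp
  have l: "set ?l \<subseteq> PT" using sub units_PT[OF vs] by auto
  note pc = pcomp_closed[OF \<mu> _ i, of _ ?n, unfolded len]
  note exp = ev_expand[OF \<mu> sub(1)]
  show "ev \<mu> (xs @ [(\<nu> \<oplus>\<^bsub>opmod P (length vs)\<^esub> \<nu>', vs)] @ zs)
      = ev \<mu> (xs @ [(\<nu>, vs)] @ zs) \<oplus>\<^bsub>Q\<^esub> ev \<mu> (xs @ [(\<nu>', vs)] @ zs)" if \<nu>': "\<nu>' \<in> arity_ops P ?n"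
    by (simp only: exp PT_closed[OF vs] \<nu> \<nu>' pcomp_add_right[OF \<mu> \<nu> \<nu>' i, unfolded len]
        ev_add_op[OF l] pc)
  show "ev \<mu> (xs @ [(r \<odot>\<^bsub>opmod P (length vs)\<^esub> \<nu>, vs)] @ zs) = r \<odot>\<^bsub>Q\<^esub> ev \<mu> (xs @ [(\<nu>, vs)] @ zs)"
    if r: "r \<in> carrier R"
    by (simp only: exp PT_closed[OF vs] \<nu> r pcomp_smult_right[OF r \<mu> \<nu> i, unfolded len]
        ev_smult_op[OF l] pc)
  show "ev \<mu> (xs @ [(act P (length vs) \<nu> \<tau>, vs)] @ zs)
      = ev \<mu> (xs @ [(\<nu>, permute_list (inv_into UNIV \<tau>) vs)] @ zs)" if \<tau>: "\<tau> permutes {..<?n}"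
  proof -
    have "ev \<mu> (xs @ [(act P ?n \<nu> \<tau>, vs)] @ zs)
        = ev (act P (length ?l) (pcomp P ?m ?i ?n \<mu> \<nu>) (inner_perm ?i ?n \<tau>)) ?l"
      by (simp only: exp PT_closed[OF vs] \<nu> \<tau> pcomp_act_right[OF \<mu> \<nu> i \<tau>, unfolded len])
    also have "\<dots> = ev (pcomp P ?m ?i ?n \<mu> \<nu>) (permute_list (inv_into UNIV (inner_perm ?i ?n \<tau>)) ?l)"
      using \<tau> by (intro ev_act[OF l pc[OF \<nu>]] inner_perm_permutes) auto
    also have "permute_list (inv_into UNIV (inner_perm ?i ?n \<tau>)) ?l
        = xs @ units (permute_list (inv_into UNIV \<tau>) vs) @ zs"
      using permute_list_inner[of \<tau> "units vs" xs zs] \<tau> by (simp add: permute_list_map permutes_inv)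
    also have "ev (pcomp P ?m ?i ?n \<mu> \<nu>) \<dots> = ev \<mu> (xs @ [(\<nu>, permute_list (inv_into UNIV \<tau>) vs)] @ zs)"
      using exp[OF PT_closed(6)[OF vs \<nu> \<tau>]] by simp
    finally show ?thesis .
  qed
qed

text \<open>Composition sees the inputs of an argument only through their number.\<close>

lemma partial_comp_update_inputs:
  "length vs = length ws \<Longrightarrow> partial_comp P q r \<mu> (xs @ (\<nu>, vs) # zs) = partial_comp P q r \<mu> (xs @ (\<nu>, ws) # zs)"
  by (induction xs arbitrary: q \<mu>) simp_all

text \<open>The relations in the inputs of one argument. The composed operation stays the same, and
  input \<open>i\<close> of this argument is input \<open>?j\<close> of the concatenated list, so
  the relation for the resulting pure tensor applies.\<close>

lemma ev_inner_arg:
  assumes \<mu>: "\<mu> \<in> arity_ops P (length xs + 1 + length zs)" and sub: "set xs \<subseteq> PT" "set zs \<subseteq> PT"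
    and vs: "set vs \<subseteq> carrier V" and \<nu>: "\<nu> \<in> arity_ops P (length vs)" and i: "i < length vs"
    and x: "x \<in> carrier V"
  shows "y \<in> carrier V \<Longrightarrow> ev \<mu> (xs @ [(\<nu>, vs[i := x \<oplus>\<^bsub>V\<^esub> y])] @ zs)
      = ev \<mu> (xs @ [(\<nu>, vs[i := x])] @ zs) \<oplus>\<^bsub>Q\<^esub> ev \<mu> (xs @ [(\<nu>, vs[i := y])] @ zs)"
    and "r \<in> carrier R \<Longrightarrow> ev \<mu> (xs @ [(\<nu>, vs[i := r \<odot>\<^bsub>V\<^esub> x])] @ zs)
      = r \<odot>\<^bsub>Q\<^esub> ev \<mu> (xs @ [(\<nu>, vs[i := x])] @ zs)"
proof -
  let ?ts = "xs @ [(\<nu>, vs)] @ zs" and ?j = "length (tensor_inputs xs) + i"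
  have ts: "set ?ts \<subseteq> PT" using sub vs \<nu> by (auto simp: PT_iff)
  have \<mu>': "\<mu> \<in> arity_ops P (length ?ts)" using \<mu> by simp
  have e: "ev \<mu> (xs @ [(\<nu>, vs[i := z])] @ zs) = pt (full_comp P 0 \<mu> ?ts) ((tensor_inputs ?ts)[?j := z])" for z
  proof -
    have "full_comp P 0 \<mu> (xs @ [(\<nu>, vs[i := z])] @ zs) = full_comp P 0 \<mu> ?ts"
      using partial_comp_update_inputs[of "vs[i := z]" vs] by (simp add: full_comp_eq_partial_comp)
    moreover have "tensor_inputs (xs @ [(\<nu>, vs[i := z])] @ zs) = (tensor_inputs ?ts)[?j := z]"
      using i by (simp add: list_update_append)
    ultimately show ?thesis by (simp only: ev_def)
  qed
  have j: "?j < length (tensor_inputs ?ts)" using i by simp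
  note rel = pt_relations(3,4)[OF PT_inputs[OF ts] full_comp_PT(1)[OF ts \<mu>'] j]
  show "ev \<mu> (xs @ [(\<nu>, vs[i := x \<oplus>\<^bsub>V\<^esub> y])] @ zs)
      = ev \<mu> (xs @ [(\<nu>, vs[i := x])] @ zs) \<oplus>\<^bsub>Q\<^esub> ev \<mu> (xs @ [(\<nu>, vs[i := y])] @ zs)" if "y \<in> carrier V"
    unfolding e by (rule rel(1)[OF x that])
  show "ev \<mu> (xs @ [(\<nu>, vs[i := r \<odot>\<^bsub>V\<^esub> x])] @ zs) = r \<odot>\<^bsub>Q\<^esub> ev \<mu> (xs @ [(\<nu>, vs[i := x])] @ zs)"
    if "r \<in> carrier R"
    unfolding e by (rule rel(2)[OF that x])
qed

section \<open>Operations on arbitrary formal sums of tensors\<close>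

abbreviation opr :: "'p \<Rightarrow> (('p, 'v) tensor \<Rightarrow> 'r) list \<Rightarrow> ('p, 'v) tensor \<Rightarrow> 'r"
  where "opr \<equiv> tensor_free_oper R P V"

lemma opr_multilin: "\<mu> \<in> arity_ops P n \<Longrightarrow> multilin R F F n {..<n} (opr \<mu>)"
  unfolding tensor_free_oper_def using full_comp_PT
  by (intro F.multilin_ext_multilin \<delta>_closed) auto

lemma opr_basis:
  assumes "set ts \<subseteq> PT" "\<mu> \<in> arity_ops P (length ts)"
  shows "opr \<mu> (map \<delta> ts) = \<delta> (full_comp P 0 \<mu> ts, tensor_inputs ts)"
  unfolding tensor_free_oper_def using assms full_comp_PT
  by (intro F.multilin_ext_basis[of PT] \<delta>_closed) auto

lemma cls_opr_basis:
  "set ts \<subseteq> PT \<Longrightarrow> \<mu> \<in> arity_ops P (length ts) \<Longrightarrow> K +>\<^bsub>F\<^esub> opr \<mu> (map \<delta> ts) = ev \<mu> ts"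
  by (simp add: opr_basis ev_def pt_def)

lemma F_agree:
  assumes "module R N" "multilin R F N n {..<n} G" "multilin R F N n {..<n} H"
    and "\<And>ts. set ts \<subseteq> PT \<Longrightarrow> length ts = n \<Longrightarrow> G (map \<delta> ts) = H (map \<delta> ts)"
    and "set fs \<subseteq> carrier F" "length fs = n"
  shows "G fs = H fs"
proof (rule multilin_agree[OF F.module_axioms assms(1) spans_basis assms(2,3) subset_refl _ assms(5,6)])
  fix gs assume gs: "set gs \<subseteq> carrier F" "length gs = n" "\<forall>j\<in>{..<n}. gs ! j \<in> \<delta> ` PT"
  then have "gs \<in> lists (\<delta> ` PT)" by (auto simp: in_set_conv_nth)
  then obtain ts where "set ts \<subseteq> PT" "gs = map \<delta> ts" by (auto simp: lists_image)
  with gs(2) assms(4) show "G gs = H gs" by simp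
qed

text \<open>The entry at \<open>i\<close> is held fixed as an element of \<open>K\<close> while the
  others are reduced to basis tensors, by multilinearity in the positions other than
  \<open>i\<close>. What remains is a linear map in the entry at \<open>i\<close>, and it kills the
  relations by \<open>ev_inner_op\<close> and \<open>ev_inner_arg\<close>.\<close>

lemma opr_absorb:
  assumes fs: "set fs \<subseteq> carrier F" and \<mu>: "\<mu> \<in> arity_ops P (length fs)"
    and i: "i < length fs" and K: "fs ! i \<in> K"
  shows "opr \<mu> fs \<in> K"
proof -
  let ?n = "length fs" and ?f = "fs ! i"
  have f: "?f \<in> carrier F" using fs i by auto
  have G: "multilin R F Q ?n {..<?n} (\<lambda>gs. K +>\<^bsub>F\<^esub> opr \<mu> gs)"
    by (rule multilin_compose[OF opr_multilin[OF \<mu>] Q.cls_linear])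
  interpret QM: module R Q by (rule Q.module_Q)
  have "K +>\<^bsub>F\<^esub> opr \<mu> (gs[i := ?f]) = \<zero>\<^bsub>Q\<^esub>" if "set gs \<subseteq> carrier F" "length gs = ?n" for gs
  proof (rule multilin_agree[OF F.module_axioms Q.module_Q spans_basis _ _ _ _ that,
      where G = "\<lambda>gs. K +>\<^bsub>F\<^esub> opr \<mu> (gs[i := ?f])" and H = "\<lambda>gs. \<zero>\<^bsub>Q\<^esub>" and J = "{..<?n} - {i}"])
    show "multilin R F Q ?n ({..<?n} - {i}) (\<lambda>gs. K +>\<^bsub>F\<^esub> opr \<mu> (gs[i := ?f]))"
      by (rule multilin_update[OF G f]) auto
    show "multilin R F Q ?n ({..<?n} - {i}) (\<lambda>gs. \<zero>\<^bsub>Q\<^esub>)"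
      by (intro multilinI QM.M.zero_closed lin_map_const_zero[OF F.module_axioms Q.module_Q])
    show "{..<?n} - {i} \<subseteq> {..<?n}" by auto
    fix gs assume gs: "set gs \<subseteq> carrier F" "length gs = ?n" "\<forall>j\<in>{..<?n} - {i}. gs ! j \<in> \<delta> ` PT"
    have "take i gs \<in> lists (\<delta> ` PT)" "drop (Suc i) gs \<in> lists (\<delta> ` PT)"
      using gs i by (auto simp: in_set_conv_nth)
    then obtain xs zs where xs: "set xs \<subseteq> PT" "take i gs = map \<delta> xs"
      and zs: "set zs \<subseteq> PT" "drop (Suc i) gs = map \<delta> zs" by (auto simp: lists_image)
    have upd: "gs[i := h] = map \<delta> xs @ [h] @ map \<delta> zs" for h
      using gs(2) i xs(2) zs(2) by (simp add: upd_conv_take_nth_drop)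
    have len: "length (xs @ [t] @ zs) = ?n" for t :: "('p, 'v) tensor"
      using arg_cong[OF upd, of length] gs(2) by simp
    \<comment> \<open>The length is the same for every tensor in the middle, so an arbitrary value
      instantiates \<open>len\<close>.\<close>
    have \<mu>': "\<mu> \<in> arity_ops P (length xs + 1 + length zs)" using \<mu> len[of undefined] by simp
    define H where "H h = K +>\<^bsub>F\<^esub> opr \<mu> (gs[i := h])" for h
    have H: "lin_map R F Q H"
      unfolding H_def using i by (intro multilinD(2)[OF G gs(1,2)]) auto
    have H\<delta>: "H (\<delta> t) = ev \<mu> (xs @ [t] @ zs)" if "t \<in> PT" for t
      using cls_opr_basis[of "xs @ [t] @ zs" \<mu>] that xs(1) zs(1) \<mu>' by (simp add: H_def upd)
    have "H ?f = \<zero>\<^bsub>Q\<^esub>"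
      by (rule kernel_K[OF Q.module_Q H K])
        (simp_all only: H\<delta> PT_closed ev_inner_op[OF \<mu>' xs(1) zs(1)] ev_inner_arg[OF \<mu>' xs(1) zs(1)]
          V.M.a_closed V.smult_closed)
    then show "K +>\<^bsub>F\<^esub> opr \<mu> (gs[i := ?f]) = \<zero>\<^bsub>Q\<^esub>" by (simp add: H_def)
  qed
  from this[OF fs refl] have "K +>\<^bsub>F\<^esub> opr \<mu> fs = K" by (simp add: quot_module_simps(2))
  then show ?thesis using Q.cls_eq_zero_iff multilinD(1)[OF opr_multilin[OF \<mu>] fs refl] by blast
qed

sublocale Q: operad_quotient R P F K opr
proof
  have c: "multilin R F Q n {..<n} (\<lambda>fs. K +>\<^bsub>F\<^esub> opr \<mu> fs)" if "\<mu> \<in> arity_ops P n" for \<mu> n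
    by (rule multilin_compose[OF opr_multilin[OF that] Q.cls_linear])
  show cl: "opr \<mu> fs \<in> carrier F" if "set fs \<subseteq> carrier F" "\<mu> \<in> arity_ops P (length fs)" for fs \<mu>
    using multilinD(1)[OF opr_multilin[OF that(2)] that(1) refl] .
  show "multilin R F F n {..<n} (opr \<mu>)" if "\<mu> \<in> arity_ops P n" for \<mu> n
    by (rule opr_multilin[OF that])
  show "opr \<mu> fs \<in> K"
    if "set fs \<subseteq> carrier F" "\<mu> \<in> arity_ops P (length fs)" "i < length fs" "fs ! i \<in> K" for fs \<mu> i
    using that by (rule opr_absorb)
  show "K +>\<^bsub>F\<^esub> opr (\<mu> \<oplus>\<^bsub>opmod P (length fs)\<^esub> \<nu>) fs = K +>\<^bsub>F\<^esub> (opr \<mu> fs \<oplus>\<^bsub>F\<^esub> opr \<nu> fs)"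
    if fs: "set fs \<subseteq> carrier F" and \<mu>: "\<mu> \<in> arity_ops P (length fs)" and \<nu>: "\<nu> \<in> arity_ops P (length fs)"
    for fs \<mu> \<nu>
  proof -
    let ?n = "length fs"
    have "K +>\<^bsub>F\<^esub> opr (\<mu> \<oplus>\<^bsub>opmod P ?n\<^esub> \<nu>) fs = (K +>\<^bsub>F\<^esub> opr \<mu> fs) \<oplus>\<^bsub>Q\<^esub> (K +>\<^bsub>F\<^esub> opr \<nu> fs)"
    proof (rule F_agree[OF Q.module_Q c[OF opmod_closed(1)[OF \<mu> \<nu>]]
          multilin_add[OF F.module_axioms Q.module_Q c[OF \<mu>] c[OF \<nu>]] _ fs refl])
      fix ts assume ts: "set ts \<subseteq> PT" "length ts = ?n"
      then show "K +>\<^bsub>F\<^esub> opr (\<mu> \<oplus>\<^bsub>opmod P ?n\<^esub> \<nu>) (map \<delta> ts)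
          = (K +>\<^bsub>F\<^esub> opr \<mu> (map \<delta> ts)) \<oplus>\<^bsub>Q\<^esub> (K +>\<^bsub>F\<^esub> opr \<nu> (map \<delta> ts))"
        using ev_add_op[of ts \<mu> \<nu>] \<mu> \<nu> opmod_closed(1)[OF \<mu> \<nu>] by (simp only: cls_opr_basis)
    qed
    then show ?thesis using fs \<mu> \<nu> by (simp only: Q.cls_add cl)
  qed
  show "K +>\<^bsub>F\<^esub> opr (r \<odot>\<^bsub>opmod P (length fs)\<^esub> \<mu>) fs = K +>\<^bsub>F\<^esub> (r \<odot>\<^bsub>F\<^esub> opr \<mu> fs)"
    if r: "r \<in> carrier R" and fs: "set fs \<subseteq> carrier F" and \<mu>: "\<mu> \<in> arity_ops P (length fs)" for fs \<mu> r
  proof -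
    let ?n = "length fs"
    have "K +>\<^bsub>F\<^esub> opr (r \<odot>\<^bsub>opmod P ?n\<^esub> \<mu>) fs = r \<odot>\<^bsub>Q\<^esub> (K +>\<^bsub>F\<^esub> opr \<mu> fs)"
    proof (rule F_agree[OF Q.module_Q c[OF opmod_closed(2)[OF r \<mu>]]
          multilin_smult[OF F.module_axioms Q.module_Q c[OF \<mu>] r] _ fs refl])
      fix ts assume ts: "set ts \<subseteq> PT" "length ts = ?n"
      then show "K +>\<^bsub>F\<^esub> opr (r \<odot>\<^bsub>opmod P ?n\<^esub> \<mu>) (map \<delta> ts) = r \<odot>\<^bsub>Q\<^esub> (K +>\<^bsub>F\<^esub> opr \<mu> (map \<delta> ts))"
        using ev_smult_op[of ts \<mu> r] \<mu> r opmod_closed(2)[OF r \<mu>] by (simp only: cls_opr_basis)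
    qed
    then show ?thesis using fs \<mu> r by (simp only: Q.cls_smult cl)
  qed
  show "K +>\<^bsub>F\<^esub> opr (act P (length fs) \<mu> \<sigma>) fs = K +>\<^bsub>F\<^esub> opr \<mu> (permute_list (inv_into UNIV \<sigma>) fs)"
    if fs: "set fs \<subseteq> carrier F" and \<mu>: "\<mu> \<in> arity_ops P (length fs)" and \<sigma>: "\<sigma> permutes {..<length fs}"
    for fs \<mu> \<sigma>
  proof (rule F_agree[OF Q.module_Q c[OF act_closed[OF \<mu> \<sigma>]] multilin_permute[OF c[OF \<mu>] \<sigma>] _ fs refl])
    fix ts assume ts: "set ts \<subseteq> PT" "length ts = length fs"
    have \<sigma>': "inv_into UNIV \<sigma> permutes {..<length ts}" using \<sigma> ts(2) by (simp add: permutes_inv)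
    have "K +>\<^bsub>F\<^esub> opr (act P (length fs) \<mu> \<sigma>) (map \<delta> ts) = ev (act P (length ts) \<mu> \<sigma>) ts"
      using ts act_closed[OF \<mu> \<sigma>] by (simp add: cls_opr_basis)
    also have "\<dots> = ev \<mu> (permute_list (inv_into UNIV \<sigma>) ts)" using ts \<mu> \<sigma> by (intro ev_act) auto
    also have "\<dots> = K +>\<^bsub>F\<^esub> opr \<mu> (map \<delta> (permute_list (inv_into UNIV \<sigma>) ts))"
      using ts \<mu> \<sigma>' by (intro cls_opr_basis[symmetric]) auto
    finally show "K +>\<^bsub>F\<^esub> opr (act P (length fs) \<mu> \<sigma>) (map \<delta> ts)
        = K +>\<^bsub>F\<^esub> opr \<mu> (permute_list (inv_into UNIV \<sigma>) (map \<delta> ts))"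
      using permute_list_map[OF \<sigma>', of \<delta>] by simp
  qed
  show "K +>\<^bsub>F\<^esub> opr (opunit P) [f] = K +>\<^bsub>F\<^esub> f" if "f \<in> carrier F" for f
  proof -
    \<comment> \<open>Linearity in the single argument is multilinearity at position
      \<open>0\<close> of a one-element list. The unit law holds for the formal sums themselves,
      before passing to classes.\<close>
    have "lin_map R F F (\<lambda>f. opr (opunit P) [f])"
      using multilinD(2)[OF opr_multilin[OF opunit_closed], of "[\<zero>\<^bsub>F\<^esub>]" 0] by simp
    moreover have "opr (opunit P) [\<delta> t] = \<delta> t" if "t \<in> PT" for t
      using opr_basis[of "[t]" "opunit P"] that opunit_closed full_comp_single[OF PT_ok[OF that]]
      by (simp del: full_comp.simps)
    ultimately have "opr (opunit P) [f] = f"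
      using lin_map_ext[OF F.module_axioms F.module_axioms spans_basis _ lin_map_id _ that] by blast
    then show ?thesis by simp
  qed
  show "K +>\<^bsub>F\<^esub> opr (pcomp P (length xs + 1 + length zs) (length xs) (length ys) \<mu> \<nu>) (xs @ ys @ zs)
      = K +>\<^bsub>F\<^esub> opr \<mu> (xs @ [opr \<nu> ys] @ zs)"
    if xs: "set xs \<subseteq> carrier F" and ys: "set ys \<subseteq> carrier F" and zs: "set zs \<subseteq> carrier F"
      and \<mu>: "\<mu> \<in> arity_ops P (length xs + 1 + length zs)" and \<nu>: "\<nu> \<in> arity_ops P (length ys)"
    for xs ys zs \<mu> \<nu>
  proof -
    let ?i = "length xs" and ?n = "length ys" and ?k = "length zs"
    \<comment> \<open>The arguments of the outer operation as a function of the undivided list, cut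
      at fixed lengths; the identity maps give it the shape of
      \<open>multilin_insert\<close>.\<close>
    let ?H = "\<lambda>as. map (\<lambda>x. x) (take ?i as) @ [opr \<nu> (take ?n (drop ?i as))] @ map (\<lambda>x. x) (drop (?i + ?n) as)"
    have pc: "pcomp P (?i + 1 + ?k) ?i ?n \<mu> \<nu> \<in> arity_ops P (?i + ?n + ?k)"
      using pcomp_closed[OF \<mu> \<nu>, of ?i] by (simp add: add_ac)
    have "K +>\<^bsub>F\<^esub> opr (pcomp P (?i + 1 + ?k) ?i ?n \<mu> \<nu>) (xs @ ys @ zs) = K +>\<^bsub>F\<^esub> opr \<mu> (?H (xs @ ys @ zs))"
    proof (rule F_agree[OF Q.module_Q c[OF pc] multilin_insert[OF c[OF \<mu>] opr_multilin[OF \<nu>] lin_map_id]])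
      fix ts assume ts: "set ts \<subseteq> PT" "length ts = ?i + ?n + ?k"
      let ?xs = "take ?i ts" and ?us = "take ?n (drop ?i ts)" and ?zs = "drop (?i + ?n) ts"
      have sub: "set ?xs \<subseteq> PT" "set ?us \<subseteq> PT" "set ?zs \<subseteq> PT"
        using ts(1) by (auto dest!: in_set_takeD in_set_dropD)
      have len: "length ?xs = ?i" "length ?us = ?n" "length ?zs = ?k" using ts(2) by auto
      have split: "?xs @ ?us @ ?zs = ts" by (metis add.commute append_take_drop_id drop_drop)
      have 1: "opr \<nu> (map \<delta> ?us) = \<delta> (full_comp P 0 \<nu> ?us, tensor_inputs ?us)"
        using sub \<nu> len by (intro opr_basis) auto
      have "K +>\<^bsub>F\<^esub> opr (pcomp P (?i + 1 + ?k) ?i ?n \<mu> \<nu>) (map \<delta> ts) = ev (pcomp P (?i + 1 + ?k) ?i ?n \<mu> \<nu>) (?xs @ ?us @ ?zs)"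
        using ts pc unfolding split by (intro cls_opr_basis) auto
      also have "\<dots> = ev \<mu> (?xs @ [(full_comp P 0 \<nu> ?us, tensor_inputs ?us)] @ ?zs)"
        using ev_assoc[of \<mu> ?xs ?zs \<nu> ?us] \<mu> \<nu> sub unfolding len by blast
      also have "\<dots> = K +>\<^bsub>F\<^esub> opr \<mu> (map \<delta> (?xs @ [(full_comp P 0 \<nu> ?us, tensor_inputs ?us)] @ ?zs))"
        using \<mu> \<nu> sub len full_comp_PT(2)[OF sub(2), of \<nu>] by (intro cls_opr_basis[symmetric]) auto
      also have "\<dots> = K +>\<^bsub>F\<^esub> opr \<mu> (?H (map \<delta> ts))" by (simp add: 1[symmetric] take_map drop_map)
      finally show "K +>\<^bsub>F\<^esub> opr (pcomp P (?i + 1 + ?k) ?i ?n \<mu> \<nu>) (map \<delta> ts) = K +>\<^bsub>F\<^esub> opr \<mu> (?H (map \<delta> ts))" .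
    qed (use xs ys zs in auto)
    then show ?thesis by simp
  qed
qed

lemma free_alg_eq: "free_alg R P V = Q.quot"
  by (simp add: free_alg_def Let_def)

lemma free_alg_operad_algebra: "operad_algebra R P (free_alg R P V)"
  unfolding free_alg_eq by (rule Q.quot_operad_algebra)

end

section \<open>The tangent functor\<close>

lemma prod_module_simps:
  "carrier (prod_module M N) = carrier M \<times> carrier N" "\<zero>\<^bsub>prod_module M N\<^esub> = (\<zero>\<^bsub>M\<^esub>, \<zero>\<^bsub>N\<^esub>)"
  "p \<oplus>\<^bsub>prod_module M N\<^esub> q = (fst p \<oplus>\<^bsub>M\<^esub> fst q, snd p \<oplus>\<^bsub>N\<^esub> snd q)"
  "r \<odot>\<^bsub>prod_module M N\<^esub> p = (r \<odot>\<^bsub>M\<^esub> fst p, r \<odot>\<^bsub>N\<^esub> snd p)"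
  by (simp_all add: prod_module_def)

lemma module_prod_module:
  assumes "module R M" "module R N"
  shows "module R (prod_module M N)"
proof -
  interpret M: module R M by fact
  interpret N: module R N by fact
  show ?thesis
  proof (rule moduleI)
    show "cring R" by (rule M.is_cring)
    show "abelian_group (prod_module M N)"
    proof (rule abelian_groupI)
      fix p assume "p \<in> carrier (prod_module M N)"
      then show "\<exists>q\<in>carrier (prod_module M N). q \<oplus>\<^bsub>prod_module M N\<^esub> p = \<zero>\<^bsub>prod_module M N\<^esub>"
        by (intro bexI[of _ "(\<ominus>\<^bsub>M\<^esub> fst p, \<ominus>\<^bsub>N\<^esub> snd p)"])
          (auto simp: prod_module_simps M.M.l_neg N.M.l_neg)
    qed (auto simp: prod_module_simps M.M.a_ac N.M.a_ac)
  qed (auto simp: prod_module_simps M.smult_l_distr N.smult_l_distr M.smult_r_distr N.smult_r_distr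
      M.smult_assoc1 N.smult_assoc1)
qed

lemma lin_map_fst: "lin_map R (prod_module M N) M fst"
  and lin_map_snd: "lin_map R (prod_module M N) N snd"
  by (auto simp: lin_map_def prod_module_simps)

lemma lin_map_pair:
  "lin_map R L M f \<Longrightarrow> lin_map R L N g \<Longrightarrow> lin_map R L (prod_module M N) (\<lambda>x. (f x, g x))"
  by (auto simp: lin_map_def prod_module_simps)

lemma alg_hom_iff:
  "f \<in> alg_hom R P A B \<longleftrightarrow> lin_map R A B f \<and>
    (\<forall>as \<mu>. set as \<subseteq> carrier A \<longrightarrow> \<mu> \<in> arity_ops P (length as) \<longrightarrow> f (oper A \<mu> as) = oper B \<mu> (map f as))"
  by (auto simp: alg_hom_def lin_map_def)

lemma alg_homI:
  assumes "lin_map R A B f"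
    and "\<And>as \<mu>. set as \<subseteq> carrier A \<Longrightarrow> \<mu> \<in> arity_ops P (length as) \<Longrightarrow> f (oper A \<mu> as) = oper B \<mu> (map f as)"
  shows "f \<in> alg_hom R P A B"
  using assms by (simp add: alg_hom_iff)

lemma alg_homD:
  assumes "f \<in> alg_hom R P A B"
  shows "lin_map R A B f" "x \<in> carrier A \<Longrightarrow> f x \<in> carrier B"
    and "set as \<subseteq> carrier A \<Longrightarrow> \<mu> \<in> arity_ops P (length as) \<Longrightarrow> f (oper A \<mu> as) = oper B \<mu> (map f as)"
  using assms by (auto simp: alg_hom_iff lin_map_def)

lemma alg_hom_compose:
  assumes "f \<in> alg_hom R P A B" "g \<in> alg_hom R P B C"
  shows "(\<lambda>x. g (f x)) \<in> alg_hom R P A C"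
proof (rule alg_homI)
  show "lin_map R A C (\<lambda>x. g (f x))" 
    by (rule lin_map_compose[OF alg_homD(1)[OF assms(1)] alg_homD(1)[OF assms(2)]])
  fix as \<mu> assume as: "set as \<subseteq> carrier A" "\<mu> \<in> arity_ops P (length as)"
  then have "set (map f as) \<subseteq> carrier B" using alg_homD(2)[OF assms(1)] by auto
  with as show "g (f (oper A \<mu> as)) = oper C \<mu> (map (\<lambda>x. g (f x)) as)"
    using alg_homD(3)[OF assms(1)] alg_homD(3)[OF assms(2), of "map f as"] by (simp add: comp_def)
qed

lemma alg_hom_id: "(\<lambda>x. x) \<in> alg_hom R P A A"
  by (simp add: alg_hom_iff lin_map_id)

text \<open>Cuts a sum over slots at a block boundary and renumbers the second part from zero, as
  the slots of an inserted operation are numbered.\<close>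

lemma (in abelian_monoid) finsum_lessThan_add:
  fixes a b :: nat
  assumes "\<And>i. i < a + b \<Longrightarrow> f i \<in> carrier G"
  shows "finsum G f {..<a + b} = finsum G f {..<a} \<oplus> finsum G (\<lambda>k. f (a + k)) {..<b}"
  using assms
proof (induction b)
  case 0
  then show ?case by (simp add: finsum_closed Pi_iff)
next
  case (Suc b)
  then have c: "f \<in> {..<a + b} \<rightarrow> carrier G" "f \<in> {..<a} \<rightarrow> carrier G"
    "(\<lambda>k. f (a + k)) \<in> {..<b} \<rightarrow> carrier G" "f (a + b) \<in> carrier G" by auto
  then have "finsum G f {..<a + Suc b} = f (a + b) \<oplus> finsum G f {..<a + b}"
    by (simp add: lessThan_Suc finsum_insert)
  also have "\<dots> = finsum G f {..<a} \<oplus> (f (a + b) \<oplus> finsum G (\<lambda>k. f (a + k)) {..<b})"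
    using Suc c by (simp add: a_lcomm finsum_closed)
  finally show ?case using c by (simp add: lessThan_Suc finsum_insert)
qed

text \<open>Arguments of the \<open>i\<close>-th Leibniz term: base points everywhere, with the
  tangent component in slot \<open>i\<close> only.\<close>

definition tangent_args :: "nat \<Rightarrow> ('a \<times> 'a) list \<Rightarrow> 'a list"
  where "tangent_args i ps = (map fst ps)[i := snd (ps ! i)]"

lemma length_tangent_args [simp]: "length (tangent_args i ps) = length ps"
  by (simp add: tangent_args_def)

lemma tangent_args_append:
  "i < length xs \<Longrightarrow> tangent_args i (xs @ ys) = tangent_args i xs @ map fst ys"
  "tangent_args (length xs + k) (xs @ ys) = map fst xs @ tangent_args k ys"
  by (simp_all add: tangent_args_def list_update_append nth_append)

lemma tangent_args_Cons:
  "tangent_args 0 (p # ps) = snd p # map fst ps"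
  "tangent_args (Suc k) (p # ps) = fst p # tangent_args k ps"
  by (simp_all add: tangent_args_def)

lemma tangent_simps:
  "carrier (tangent A) = carrier A \<times> carrier A"
  "p \<oplus>\<^bsub>tangent A\<^esub> q = (fst p \<oplus>\<^bsub>A\<^esub> fst q, snd p \<oplus>\<^bsub>A\<^esub> snd q)"
  "r \<odot>\<^bsub>tangent A\<^esub> p = (r \<odot>\<^bsub>A\<^esub> fst p, r \<odot>\<^bsub>A\<^esub> snd p)"
  "oper (tangent A) \<mu> ps =
    (oper A \<mu> (map fst ps), finsum A (\<lambda>i. oper A \<mu> (tangent_args i ps)) {..<length ps})"
  by (simp_all add: tangent_def prod_module_simps tangent_args_def)

context operad_algebra
begin

lemma oper_multilin: "\<mu> \<in> arity_ops P n \<Longrightarrow> multilin R A A n {..<n} (oper A \<mu>)"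
  using oper_closed oper_add_arg oper_smult_arg by (intro multilinI lin_mapI) (auto simp: set_update_subset)

lemma oper_linear:
  "\<mu> \<in> arity_ops P (length xs + 1 + length zs) \<Longrightarrow> set xs \<subseteq> carrier A \<Longrightarrow> set zs \<subseteq> carrier A \<Longrightarrow>
    lin_map R A A (\<lambda>x. oper A \<mu> (xs @ [x] @ zs))"
  using multilinD(2)[OF oper_multilin, of \<mu> "length xs + 1 + length zs" "xs @ [\<zero>\<^bsub>A\<^esub>] @ zs" "length xs"]
  by (simp add: list_update_append)

lemma set_tangent_args:
  assumes "set ps \<subseteq> carrier (tangent A)"
  shows "set (map fst ps) \<subseteq> carrier A" "i < length ps \<Longrightarrow> set (tangent_args i ps) \<subseteq> carrier A"
proof -
  show "set (map fst ps) \<subseteq> carrier A" using assms by (auto simp: tangent_simps)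
  moreover have "snd (ps ! i) \<in> carrier A" if "i < length ps"
    using assms nth_mem[OF that] by (auto simp: tangent_simps)
  ultimately show "set (tangent_args i ps) \<subseteq> carrier A" if "i < length ps"
    unfolding tangent_args_def using that by (intro set_update_subset) auto
qed

lemma oper_tangent_args_closed:
  "set ps \<subseteq> carrier (tangent A) \<Longrightarrow> \<mu> \<in> arity_ops P (length ps) \<Longrightarrow> i < length ps \<Longrightarrow>
    oper A \<mu> (tangent_args i ps) \<in> carrier A"
  using set_tangent_args by (intro oper_closed) auto

lemma tangent_oper_multilin:
  assumes "\<mu> \<in> arity_ops P n"
  shows "multilin R (prod_module A A) (prod_module A A) n {..<n} (oper (tangent A) \<mu>)"
proof (rule multilinI)
  note AA = module_prod_module[OF module_axioms module_axioms]
  fix ps assume ps: "set ps \<subseteq> carrier (prod_module A A)" "length ps = n"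
  then have ps': "set ps \<subseteq> carrier (tangent A)" by (simp add: tangent_simps prod_module_simps)
  then show "oper (tangent A) \<mu> ps \<in> carrier (prod_module A A)"
    using assms ps(2) set_tangent_args(1)[OF ps'] oper_tangent_args_closed[OF ps']
    by (auto simp: tangent_simps(4) prod_module_simps intro!: oper_closed M.finsum_closed)
  fix j assume j: "j \<in> {..<n}"
  have upd: "lin_map R A A (\<lambda>x. oper A \<mu> (as[j := x]))" if "set as \<subseteq> carrier A" "length as = n" for as
    using multilinD(2)[OF oper_multilin[OF assms] that j] .
  have 1: "lin_map R (prod_module A A) A (\<lambda>p. oper A \<mu> (map fst (ps[j := p])))"
    using lin_map_compose[OF lin_map_fst upd, of "map fst ps"] set_tangent_args(1)[OF ps'] ps(2)
    by (simp add: map_update)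
  \<comment> \<open>As a function of the \<open>j\<close>-th pair, the \<open>i\<close>-th Leibniz
    term depends on the tangent component if \<open>i = j\<close> and on the base point otherwise;
    it is linear either way.\<close>
  have 2: "lin_map R (prod_module A A) A (\<lambda>p. oper A \<mu> (tangent_args i (ps[j := p])))" if i: "i \<in> {..<n}" for i
  proof (cases "i = j")
    case True
    then have "tangent_args i (ps[j := p]) = (map fst ps)[j := snd p]" for p
      using i ps(2) by (simp add: tangent_args_def map_update)
    then show ?thesis
      using lin_map_compose[OF lin_map_snd upd, of "map fst ps"] set_tangent_args(1)[OF ps'] ps(2) by simp
  next
    case False
    then have "tangent_args i (ps[j := p]) = (tangent_args i ps)[j := fst p]" for p
      by (simp add: tangent_args_def map_update list_update_swap)
    then show ?thesis
      using lin_map_compose[OF lin_map_fst upd, of "tangent_args i ps"] set_tangent_args(2)[OF ps', of i] ps(2) i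
      by simp
  qed
  show "lin_map R (prod_module A A) (prod_module A A) (\<lambda>p. oper (tangent A) \<mu> (ps[j := p]))"
    unfolding tangent_simps(4)
    using lin_map_pair[OF 1 lin_map_sum[OF AA module_axioms finite_lessThan 2]] ps(2) by simp
qed

text \<open>Permuting the arguments turns the \<open>i\<close>-th Leibniz term into the one with
  index \<open>\<sigma> i\<close>; since \<open>\<sigma>\<close> is a bijection of the slots, the
  sum is only reindexed.\<close>

lemma tangent_oper_act:
  assumes ps: "set ps \<subseteq> carrier (tangent A)" and \<mu>: "\<mu> \<in> arity_ops P (length ps)"
    and \<sigma>: "\<sigma> permutes {..<length ps}"
  shows "oper (tangent A) (act P (length ps) \<mu> \<sigma>) ps = oper (tangent A) \<mu> (permute_list (inv_into UNIV \<sigma>) ps)"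
proof -
  let ?qs = "permute_list (inv_into UNIV \<sigma>) ps" and ?n = "length ps"
  have \<sigma>': "inv_into UNIV \<sigma> permutes {..<?n}" using \<sigma> by (rule permutes_inv)
  have act: "oper A (act P ?n \<mu> \<sigma>) as = oper A \<mu> (permute_list (inv_into UNIV \<sigma>) as)"
    if "set as \<subseteq> carrier A" "length as = ?n" for as
    using oper_act[of as \<mu> \<sigma>] that \<mu> \<sigma> by simp
  have 1: "oper A (act P ?n \<mu> \<sigma>) (map fst ps) = oper A \<mu> (map fst ?qs)"
    using act[OF set_tangent_args(1)[OF ps]] \<sigma>' by (simp add: permute_list_map)
  have perm: "permute_list (inv_into UNIV \<sigma>) (tangent_args i ps) = tangent_args (\<sigma> i) ?qs" if "i < ?n" for i
  proof -
    have "\<sigma> i < ?n" using that permutes_in_image[OF \<sigma>] by simp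
    then have "?qs ! \<sigma> i = ps ! i" using \<sigma>' by (simp add: permute_list_nth permutes_inverses[OF \<sigma>])
    then show ?thesis
      unfolding tangent_args_def using that \<sigma> \<sigma>' by (simp add: permute_list_update permute_list_map)
  qed
  have qs: "set ?qs \<subseteq> carrier (tangent A)" using ps \<sigma>' by simp
  have img: "\<sigma> ` {..<?n} = {..<?n}" using \<sigma> by (rule permutes_image)
  have "finsum A (\<lambda>i. oper A (act P ?n \<mu> \<sigma>) (tangent_args i ps)) {..<?n}
      = finsum A (\<lambda>i. oper A \<mu> (tangent_args (\<sigma> i) ?qs)) {..<?n}"
  proof (rule M.finsum_cong')
    fix i assume "i \<in> {..<?n}"
    then show "oper A (act P ?n \<mu> \<sigma>) (tangent_args i ps) = oper A \<mu> (tangent_args (\<sigma> i) ?qs)"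
      using act[of "tangent_args i ps"] set_tangent_args(2)[OF ps] perm by simp
  next
    show "(\<lambda>i. oper A \<mu> (tangent_args (\<sigma> i) ?qs)) \<in> {..<?n} \<rightarrow> carrier A"
      using oper_tangent_args_closed[OF qs] \<mu> permutes_in_image[OF \<sigma>] by auto
  qed simp
  also have "\<dots> = finsum A (\<lambda>i. oper A \<mu> (tangent_args i ?qs)) (\<sigma> ` {..<?n})"
    using oper_tangent_args_closed[OF qs] \<mu> permutes_inj_on[OF \<sigma>]
    by (intro M.finsum_reindex[symmetric]) (auto simp: img)
  finally show ?thesis using 1 unfolding tangent_simps(4) img by simp
qed

text \<open>The chain rule. Cut the Leibniz sum of the composite at the ends of the inserted block:
  terms outside it match terms of \<open>\<mu>\<close> one by one, while the terms inside
  differentiate \<open>\<nu>\<close> and add up, by linearity of \<open>\<mu>\<close> in that slot,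
  to the single term with the tangent component of \<open>oper (tangent A) \<nu> ys\<close>.\<close>

lemma tangent_oper_pcomp:
  assumes xs: "set xs \<subseteq> carrier (tangent A)" and ys: "set ys \<subseteq> carrier (tangent A)"
    and zs: "set zs \<subseteq> carrier (tangent A)"
    and \<mu>: "\<mu> \<in> arity_ops P (length xs + 1 + length zs)" and \<nu>: "\<nu> \<in> arity_ops P (length ys)"
  shows "oper (tangent A) (pcomp P (length xs + 1 + length zs) (length xs) (length ys) \<mu> \<nu>) (xs @ ys @ zs)
    = oper (tangent A) \<mu> (xs @ [oper (tangent A) \<nu> ys] @ zs)"
proof -
  let ?a = "length xs" and ?b = "length ys" and ?c = "length zs"
  let ?\<pi> = "pcomp P (?a + 1 + ?c) ?a ?b \<mu> \<nu>"
  let ?q = "oper (tangent A) \<nu> ys"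
  let ?l = "xs @ ys @ zs" and ?r = "xs @ [?q] @ zs"
  let ?L = "\<lambda>i. oper A ?\<pi> (tangent_args i ?l)" and ?R = "\<lambda>i. oper A \<mu> (tangent_args i ?r)"
  have \<pi>: "?\<pi> \<in> arity_ops P (length ?l)" using pcomp_closed[OF \<mu> \<nu>, of ?a] by (simp add: add_ac)
  have q: "?q \<in> carrier (tangent A)"
    using multilinD(1)[OF tangent_oper_multilin[OF \<nu>], of ys] ys by (simp add: tangent_simps prod_module_simps)
  have pc: "oper A ?\<pi> (as @ bs @ cs) = oper A \<mu> (as @ [oper A \<nu> bs] @ cs)"
    if "set as \<subseteq> carrier A" "set bs \<subseteq> carrier A" "set cs \<subseteq> carrier A"
      "length as = ?a" "length bs = ?b" "length cs = ?c" for as bs cs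
    using oper_pcomp[of as bs cs \<mu> \<nu>] that \<mu> \<nu> by simp
  note x = set_tangent_args[OF xs] and y = set_tangent_args[OF ys] and z = set_tangent_args[OF zs]
  have l: "set ?l \<subseteq> carrier (tangent A)" and r: "set ?r \<subseteq> carrier (tangent A)" using xs ys zs q by auto
  have \<mu>': "\<mu> \<in> arity_ops P (length ?r)" using \<mu> by simp
  have Lc: "?L i \<in> carrier A" if "i < ?a + (?b + ?c)" for i
    using oper_tangent_args_closed[OF l \<pi>] that by simp
  have Rc: "?R i \<in> carrier A" if "i < ?a + (1 + ?c)" for i
    using oper_tangent_args_closed[OF r \<mu>'] that by simp
  have fst_q: "fst ?q = oper A \<nu> (map fst ys)" by (simp add: tangent_simps)
  have 1: "finsum A ?L {..<?a} = finsum A ?R {..<?a}"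
  proof (rule M.finsum_cong')
    fix i assume i: "i \<in> {..<?a}"
    have "?L i = oper A ?\<pi> (tangent_args i xs @ map fst ys @ map fst zs)"
      using i by (simp add: tangent_args_append)
    also have "\<dots> = oper A \<mu> (tangent_args i xs @ [oper A \<nu> (map fst ys)] @ map fst zs)"
      using i x y z by (intro pc) auto
    also have "\<dots> = ?R i" using i by (simp add: tangent_args_append fst_q)
    finally show "?L i = ?R i" .
  qed (use Rc in auto)
  have 2: "finsum A (\<lambda>k. ?L (?a + k)) {..<?b} = ?R ?a"
  proof -
    let ?f = "\<lambda>x. oper A \<mu> (map fst xs @ [x] @ map fst zs)"
    have lin: "lin_map R A A ?f" using \<mu> x z by (intro oper_linear) auto
    have "finsum A (\<lambda>k. ?L (?a + k)) {..<?b} = finsum A (\<lambda>k. ?f (oper A \<nu> (tangent_args k ys))) {..<?b}"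
    proof (rule M.finsum_cong')
      fix k assume k: "k \<in> {..<?b}"
      have "?L (?a + k) = oper A ?\<pi> (map fst xs @ tangent_args k ys @ map fst zs)"
        using k by (simp add: tangent_args_append)
      also have "\<dots> = ?f (oper A \<nu> (tangent_args k ys))" using k x y z by (intro pc) auto
      finally show "?L (?a + k) = ?f (oper A \<nu> (tangent_args k ys))" .
    next
      show "(\<lambda>k. ?f (oper A \<nu> (tangent_args k ys))) \<in> {..<?b} \<rightarrow> carrier A"
        using oper_tangent_args_closed[OF ys \<nu>] lin_mapD(1)[OF lin] by auto
    qed simp
    also have "\<dots> = ?f (snd ?q)"
      using lin_map_finsum[OF module_axioms module_axioms lin, of "{..<?b}" "\<lambda>k. oper A \<nu> (tangent_args k ys)"]
        oper_tangent_args_closed[OF ys \<nu>] by (simp add: tangent_simps(4))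
    also have "\<dots> = ?R ?a" using tangent_args_append(2)[of xs 0 "[?q] @ zs"] by (simp add: tangent_args_Cons)
    finally show ?thesis .
  qed
  have 3: "finsum A (\<lambda>k. ?L (?a + (?b + k))) {..<?c} = finsum A (\<lambda>k. ?R (?a + (1 + k))) {..<?c}"
  proof (rule M.finsum_cong')
    fix k assume k: "k \<in> {..<?c}"
    have "?L (?a + (?b + k)) = oper A ?\<pi> (map fst xs @ map fst ys @ tangent_args k zs)"
      by (simp add: tangent_args_append)
    also have "\<dots> = oper A \<mu> (map fst xs @ [oper A \<nu> (map fst ys)] @ tangent_args k zs)"
      using k x y z by (intro pc) auto
    also have "\<dots> = ?R (?a + (1 + k))"
      using tangent_args_append(2)[of xs "Suc k" "[?q] @ zs"] by (simp add: tangent_args_Cons fst_q)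
    finally show "?L (?a + (?b + k)) = ?R (?a + (1 + k))" .
  qed (use Rc in auto)
  have "finsum A ?L {..<length ?l} = finsum A ?L {..<?a} \<oplus>\<^bsub>A\<^esub>
      (finsum A (\<lambda>k. ?L (?a + k)) {..<?b} \<oplus>\<^bsub>A\<^esub> finsum A (\<lambda>k. ?L (?a + (?b + k))) {..<?c})"
    using M.finsum_lessThan_add[of ?a "?b + ?c" ?L, OF Lc] M.finsum_lessThan_add[of ?b ?c "\<lambda>k. ?L (?a + k)"] Lc
    by simp
  also have "\<dots> = finsum A ?R {..<?a} \<oplus>\<^bsub>A\<^esub> (?R ?a \<oplus>\<^bsub>A\<^esub> finsum A (\<lambda>k. ?R (?a + (1 + k))) {..<?c})"
    unfolding 1 2 3 ..
  \<comment> \<open>The middle term is written as a sum over one slot, so that the three pieces can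
    be reassembled by the same splitting lemma.\<close>
  also have "?R ?a = finsum A (\<lambda>k. ?R (?a + k)) {..<1}"
    using Rc[of ?a] M.finsum_insert[of "{}" 0 "\<lambda>k. ?R (?a + k)"] by (simp add: lessThan_Suc)
  also have "finsum A ?R {..<?a} \<oplus>\<^bsub>A\<^esub>
      (finsum A (\<lambda>k. ?R (?a + k)) {..<1} \<oplus>\<^bsub>A\<^esub> finsum A (\<lambda>k. ?R (?a + (1 + k))) {..<?c})
    = finsum A ?R {..<?a + (1 + ?c)}"
    using M.finsum_lessThan_add[of ?a "1 + ?c" ?R, OF Rc] M.finsum_lessThan_add[of 1 ?c "\<lambda>k. ?R (?a + k)"] Rc
    by simp
  finally have snd: "finsum A ?L {..<length ?l} = finsum A ?R {..<length ?r}" by simp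
  have "oper A ?\<pi> (map fst ?l) = oper A \<mu> (map fst ?r)"
    using pc[OF x(1) y(1) z(1)] by (simp add: fst_q)
  with snd show ?thesis unfolding tangent_simps(4) by simp
qed

lemma tangent_operad_algebra: "operad_algebra R P (tangent A)"
proof (intro operad_algebra.intro symmetric_operad_axioms operad_algebra_axioms.intro)
  show "module R (tangent A)"
    unfolding tangent_def by (intro module_with_oper module_prod_module module_axioms)
  fix ps \<mu> assume ps: "set ps \<subseteq> carrier (tangent A)" and \<mu>: "\<mu> \<in> arity_ops P (length ps)"
  note arg = set_tangent_args[OF ps]
  have psV: "set ps \<subseteq> carrier (prod_module A A)" using ps by (simp add: tangent_simps prod_module_simps)
  note ml = multilinD[OF tangent_oper_multilin[OF \<mu>] psV refl]
  show "oper (tangent A) \<mu> ps \<in> carrier (tangent A)"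
    using ml(1) by (simp add: tangent_simps prod_module_simps)
  { fix \<nu> assume \<nu>: "\<nu> \<in> arity_ops P (length ps)"
    have "finsum A (\<lambda>i. oper A (\<mu> \<oplus>\<^bsub>opmod P (length ps)\<^esub> \<nu>) (tangent_args i ps)) {..<length ps}
      = finsum A (\<lambda>i. oper A \<mu> (tangent_args i ps) \<oplus>\<^bsub>A\<^esub> oper A \<nu> (tangent_args i ps)) {..<length ps}"
    proof (rule M.finsum_cong')
      fix i assume "i \<in> {..<length ps}"
      then have i: "i < length ps" by simp
      show "oper A (\<mu> \<oplus>\<^bsub>opmod P (length ps)\<^esub> \<nu>) (tangent_args i ps)
          = oper A \<mu> (tangent_args i ps) \<oplus>\<^bsub>A\<^esub> oper A \<nu> (tangent_args i ps)"
        using oper_add_op[OF arg(2)[OF i]] \<mu> \<nu> by simp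
    qed (use oper_tangent_args_closed[OF ps] \<mu> \<nu> in auto)
    then show "oper (tangent A) (\<mu> \<oplus>\<^bsub>opmod P (length ps)\<^esub> \<nu>) ps
        = oper (tangent A) \<mu> ps \<oplus>\<^bsub>tangent A\<^esub> oper (tangent A) \<nu> ps"
      using \<mu> \<nu> oper_add_op[OF arg(1)] oper_tangent_args_closed[OF ps]
      by (simp add: tangent_simps M.finsum_addf Pi_iff) }
  { fix r assume r: "r \<in> carrier R"
    have "finsum A (\<lambda>i. oper A (r \<odot>\<^bsub>opmod P (length ps)\<^esub> \<mu>) (tangent_args i ps)) {..<length ps}
      = finsum A (\<lambda>i. r \<odot>\<^bsub>A\<^esub> oper A \<mu> (tangent_args i ps)) {..<length ps}"
    proof (rule M.finsum_cong')
      fix i assume "i \<in> {..<length ps}"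
      then have i: "i < length ps" by simp
      show "oper A (r \<odot>\<^bsub>opmod P (length ps)\<^esub> \<mu>) (tangent_args i ps) = r \<odot>\<^bsub>A\<^esub> oper A \<mu> (tangent_args i ps)"
        using oper_smult_op[OF r arg(2)[OF i]] \<mu> by simp
    qed (use oper_tangent_args_closed[OF ps] \<mu> r in auto)
    then show "oper (tangent A) (r \<odot>\<^bsub>opmod P (length ps)\<^esub> \<mu>) ps = r \<odot>\<^bsub>tangent A\<^esub> oper (tangent A) \<mu> ps"
      using \<mu> r oper_smult_op[OF r arg(1)] oper_tangent_args_closed[OF ps]
      by (simp add: tangent_simps finsum_smult_ldistr Pi_iff) }
  { fix i p q assume i: "i < length ps" and p: "p \<in> carrier (tangent A)" and q: "q \<in> carrier (tangent A)"
    have lin: "lin_map R (tangent A) (tangent A) (\<lambda>x. oper (tangent A) \<mu> (ps[i := x]))"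
      using ml(2)[of i] i unfolding lin_map_def by (simp add: tangent_simps prod_module_simps)
    show "oper (tangent A) \<mu> (ps[i := p \<oplus>\<^bsub>tangent A\<^esub> q])
        = oper (tangent A) \<mu> (ps[i := p]) \<oplus>\<^bsub>tangent A\<^esub> oper (tangent A) \<mu> (ps[i := q])"
      by (rule lin_mapD(2)[OF lin p q])
    fix r assume "r \<in> carrier R"
    then show "oper (tangent A) \<mu> (ps[i := r \<odot>\<^bsub>tangent A\<^esub> p]) = r \<odot>\<^bsub>tangent A\<^esub> oper (tangent A) \<mu> (ps[i := p])"
      by (rule lin_mapD(3)[OF lin _ p]) }
  show "oper (tangent A) (act P (length ps) \<mu> \<sigma>) ps = oper (tangent A) \<mu> (permute_list (inv_into UNIV \<sigma>) ps)"
    if "\<sigma> permutes {..<length ps}" for \<sigma>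
    using ps \<mu> that by (rule tangent_oper_act)
next
  fix p assume "p \<in> carrier (tangent A)"
  then obtain a b where p: "p = (a, b)" "a \<in> carrier A" "b \<in> carrier A" by (auto simp: tangent_simps)
  have "finsum A (\<lambda>i. oper A (opunit P) (tangent_args i [p])) {..<length [p]} = b"
    using p M.finsum_insert[of "{}" 0 "\<lambda>i. oper A (opunit P) (tangent_args i [p])"]
    by (simp add: lessThan_Suc tangent_args_Cons oper_unit)
  then show "oper (tangent A) (opunit P) [p] = p"
    using p by (simp add: tangent_simps(4) oper_unit)
qed (rule tangent_oper_pcomp)

end

text \<open>A morphism is linear, hence passes through the Leibniz sum, and it carries the
  \<open>i\<close>-th argument list to the \<open>i\<close>-th argument list of the image.\<close>

lemma tangent_map_alg_hom:
  assumes A: "operad_algebra R P A" and B: "operad_algebra R P B" and f: "f \<in> alg_hom R P A B"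
  shows "tangent_map f \<in> alg_hom R P (tangent A) (tangent B)"
proof (rule alg_homI)
  interpret A: operad_algebra R P A by (rule A)
  interpret B: operad_algebra R P B by (rule B)
  note lin = alg_homD(1)[OF f]
  show "lin_map R (tangent A) (tangent B) (tangent_map f)"
    using lin_mapD[OF lin] by (intro lin_mapI) (auto simp: tangent_simps tangent_map_def)
  fix ps \<mu> assume ps: "set ps \<subseteq> carrier (tangent A)" and \<mu>: "\<mu> \<in> arity_ops P (length ps)"
  have args: "map f (tangent_args i ps) = tangent_args i (map (tangent_map f) ps)" if "i < length ps" for i
    using that by (simp add: tangent_args_def tangent_map_def map_update comp_def)
  have fst: "f (oper A \<mu> (map fst ps)) = oper B \<mu> (map fst (map (tangent_map f) ps))"
    using alg_homD(3)[OF f A.set_tangent_args(1)[OF ps]] \<mu> by (simp add: tangent_map_def comp_def)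
  have "f (finsum A (\<lambda>i. oper A \<mu> (tangent_args i ps)) {..<length ps})
      = finsum B (\<lambda>i. f (oper A \<mu> (tangent_args i ps))) {..<length ps}"
    using A.oper_tangent_args_closed[OF ps \<mu>]
    by (intro lin_map_finsum[OF A.module_axioms B.module_axioms lin]) auto
  also have "\<dots> = finsum B (\<lambda>i. oper B \<mu> (tangent_args i (map (tangent_map f) ps))) {..<length ps}"
  proof (rule B.M.finsum_cong')
    fix i assume "i \<in> {..<length ps}"
    then have i: "i < length ps" by simp
    show *: "f (oper A \<mu> (tangent_args i ps)) = oper B \<mu> (tangent_args i (map (tangent_map f) ps))"
      using alg_homD(3)[OF f A.set_tangent_args(2)[OF ps i]] \<mu> args[OF i] by simp
  next
    have "oper B \<mu> (tangent_args i (map (tangent_map f) ps)) \<in> carrier B" if "i < length ps" for i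
      using alg_homD(3)[OF f A.set_tangent_args(2)[OF ps that]] \<mu> args[OF that]
        alg_homD(2)[OF f A.oper_tangent_args_closed[OF ps \<mu> that]] by simp
    then show "(\<lambda>i. oper B \<mu> (tangent_args i (map (tangent_map f) ps))) \<in> {..<length ps} \<rightarrow> carrier B" by auto
  qed simp
  finally show "tangent_map f (oper (tangent A) \<mu> ps) = oper (tangent B) \<mu> (map (tangent_map f) ps)"
    using fst by (simp add: tangent_simps(4) tangent_map_def)
qed

section \<open>Universal properties\<close>

text \<open>Used at both levels: from formal tensors to the free algebra, and from the free algebra
  to \<open>T\<degree>(A)\<close>. \<open>H\<close> has to respect the operations on
  representatives, which themselves satisfy the algebra axioms only modulo \<open>K\<close>.\<close>

lemma (in operad_quotient) quot_hom_lift: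
  assumes B: "operad_algebra R P B" and H: "lin_map R F B H" and ker: "\<And>f. f \<in> K \<Longrightarrow> H f = \<zero>\<^bsub>B\<^esub>"
    and oper: "\<And>fs \<mu>. set fs \<subseteq> carrier F \<Longrightarrow> \<mu> \<in> arity_ops P (length fs) \<Longrightarrow>
      H (opr \<mu> fs) = oper B \<mu> (map H fs)"
  obtains g where "g \<in> alg_hom R P quot B" "\<And>f. f \<in> carrier F \<Longrightarrow> g (K +>\<^bsub>F\<^esub> f) = H f"
proof -
  interpret B: operad_algebra R P B by (rule B)
  obtain g where g: "lin_map R (quot_module F K) B g" "\<And>f. f \<in> carrier F \<Longrightarrow> g (K +>\<^bsub>F\<^esub> f) = H f"
    using cls_lift[OF B.module_axioms H ker] by blast
  have "g \<in> alg_hom R P quot B"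
  proof (rule alg_homI)
    show "lin_map R quot B g" using g(1) by simp
    fix Cs \<mu> assume Cs: "set Cs \<subseteq> carrier quot" and \<mu>: "\<mu> \<in> arity_ops P (length Cs)"
    obtain as where as: "set as \<subseteq> carrier F" "Cs = map (\<lambda>x. K +>\<^bsub>F\<^esub> x) as" using quot_lists[OF Cs] .
    have \<mu>': "\<mu> \<in> arity_ops P (length as)" using \<mu> as(2) by simp
    have "g (oper quot \<mu> Cs) = H (opr \<mu> as)"
      unfolding as(2) quot_oper[OF as(1) \<mu>'] by (rule g(2)[OF opr_closed[OF as(1) \<mu>']])
    also have "\<dots> = oper B \<mu> (map H as)" by (rule oper[OF as(1) \<mu>'])
    also have "map H as = map g Cs" using as g(2) by auto
    finally show "g (oper quot \<mu> Cs) = oper B \<mu> (map g Cs)" .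
  qed
  then show ?thesis using g(2) that by blast
qed

section \<open>Ideals, their quotients, and evaluation of total composites\<close>

context operad_algebra
begin

lemma alg_ideal_carrier: "alg_ideal R P A (carrier A)"
  using carrier_is_submodule oper_closed by (simp add: alg_ideal_def)

lemma alg_ideal_gen_ideal:
  assumes "X \<subseteq> carrier A"
  shows "alg_ideal R P A (alg_ideal_gen R P A X)"
  unfolding alg_ideal_def
proof (intro conjI allI impI)
  show "submodule (alg_ideal_gen R P A X) R A"
  proof (rule submoduleI)
    show "alg_ideal_gen R P A X \<subseteq> carrier A" using assms alg_ideal_carrier by (auto simp: alg_ideal_gen_def)
    have "\<zero>\<^bsub>A\<^esub> \<in> I" if "alg_ideal R P A I" for I
      using that subgroup.one_closed[OF submodule.axioms(1), of I R A] by (simp add: alg_ideal_def)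
    then show "\<zero>\<^bsub>A\<^esub> \<in> alg_ideal_gen R P A X" by (simp add: alg_ideal_gen_def)
  qed (auto simp: alg_ideal_gen_def alg_ideal_def submoduleE)
  fix as \<mu> assume "set as \<subseteq> carrier A" "\<mu> \<in> arity_ops P (length as)" "set as \<inter> alg_ideal_gen R P A X \<noteq> {}"
  then show "oper A \<mu> as \<in> alg_ideal_gen R P A X"
    unfolding alg_ideal_gen_def alg_ideal_def by blast
qed

text \<open>Here the algebra axioms hold in \<open>A\<close> itself and pass to classes at once; the
  ideal property supplies absorption.\<close>

lemma ideal_quotient:
  assumes I: "alg_ideal R P A I"
  shows "operad_quotient R P A I (oper A)"
proof -
  interpret submodule_of_module R A I
    using I by (intro submodule_of_module.intro submodule_of_module_axioms.intro module_axioms)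
      (simp add: alg_ideal_def)
  show ?thesis
  proof
    fix as \<mu> i assume as: "set as \<subseteq> carrier A" "\<mu> \<in> arity_ops P (length as)" "i < length as" "as ! i \<in> I"
    then have "as ! i \<in> set as \<inter> I" by simp
    then show "oper A \<mu> as \<in> I" using I as unfolding alg_ideal_def by blast
  next
    fix xs ys zs \<mu> \<nu>
    assume "set xs \<subseteq> carrier A" "set ys \<subseteq> carrier A" "set zs \<subseteq> carrier A"
      "\<mu> \<in> arity_ops P (length xs + 1 + length zs)" "\<nu> \<in> arity_ops P (length ys)"
    from oper_pcomp[OF this]
    show "I +>\<^bsub>A\<^esub> oper A (pcomp P (length xs + 1 + length zs) (length xs) (length ys) \<mu> \<nu>) (xs @ ys @ zs)
      = I +>\<^bsub>A\<^esub> oper A \<mu> (xs @ [oper A \<nu> ys] @ zs)" by simp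
  qed (use oper_closed oper_multilin in \<open>simp_all add: oper_add_op oper_smult_op oper_act oper_unit\<close>)
qed

lemma oper_zero_arg:
  assumes "set as \<subseteq> carrier A" "\<mu> \<in> arity_ops P (length as)" "\<zero>\<^bsub>A\<^esub> \<in> set as"
  shows "oper A \<mu> as = \<zero>\<^bsub>A\<^esub>"
proof -
  obtain i where i: "i < length as" "as ! i = \<zero>\<^bsub>A\<^esub>" using assms(3) by (auto simp: in_set_conv_nth)
  have "lin_map R A A (\<lambda>x. oper A \<mu> (as[i := x]))"
    using multilinD(2)[OF oper_multilin[OF assms(2)] assms(1) refl] i by simp
  from lin_map_zero[OF module_axioms module_axioms this]
  have "oper A \<mu> (as[i := as ! i]) = \<zero>\<^bsub>A\<^esub>" by (simp add: i)
  then show ?thesis by simp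
qed

text \<open>\<open>as\<close> holds the inputs in front of the next slot, so its length is the
  offset of the partial composition. Each step is the composition law, read as permission to
  evaluate one argument \<open>\<nu> \<otimes> vs\<close> to \<open>\<nu>(vs)\<close> first.\<close>

lemma oper_partial_comp:
  assumes "\<mu> \<in> arity_ops P (length as + length ts)" "set as \<subseteq> carrier A"
    and "\<forall>t\<in>set ts. tensor_ok P t \<and> set (snd t) \<subseteq> carrier A"
  shows "oper A (partial_comp P (length as) 0 \<mu> ts) (as @ tensor_inputs ts)
    = oper A \<mu> (as @ map (\<lambda>t. oper A (fst t) (snd t)) ts)"
  using assms
proof (induction ts arbitrary: as \<mu>)
  case (Cons t ts)
  let ?m = "length as + 1 + length ts" and ?n = "length (snd t)"
  let ?ev = "\<lambda>t. oper A (fst t) (snd t)"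
  have t: "fst t \<in> arity_ops P ?n" "set (snd t) \<subseteq> carrier A" and \<mu>: "\<mu> \<in> arity_ops P ?m"
    using Cons.prems by auto
  have ts: "set (map ?ev ts) \<subseteq> carrier A" using Cons.prems by (auto intro!: oper_closed)
  have "pcomp P ?m (length as) ?n \<mu> (fst t) \<in> arity_ops P (length (as @ snd t) + length ts)"
    using pcomp_closed[OF \<mu> t(1), of "length as"] by (simp add: add_ac)
  from Cons.IH[OF this]
  have "oper A (partial_comp P (length as) 0 \<mu> (t # ts)) (as @ tensor_inputs (t # ts))
      = oper A (pcomp P ?m (length as) ?n \<mu> (fst t)) (as @ snd t @ map ?ev ts)"
    using Cons.prems by simp
  also have "\<dots> = oper A \<mu> (as @ [?ev t] @ map ?ev ts)"
    using oper_pcomp[of as "snd t" "map ?ev ts" \<mu> "fst t"] Cons.prems(2) t ts \<mu> by simp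
  finally show ?case by simp
qed simp

lemma oper_full_comp:
  assumes "\<mu> \<in> arity_ops P (length ts)" "\<forall>t\<in>set ts. tensor_ok P t \<and> set (snd t) \<subseteq> carrier A"
  shows "oper A (full_comp P 0 \<mu> ts) (tensor_inputs ts) = oper A \<mu> (map (\<lambda>t. oper A (fst t) (snd t)) ts)"
  using oper_partial_comp[of \<mu> "[]" ts] assms by (simp add: full_comp_eq_partial_comp)

end

lemma full_comp_map_inputs:
  "full_comp P q \<mu> (map (\<lambda>t. (fst t, map \<phi> (snd t))) ts) = full_comp P q \<mu> ts"
  by (induction ts arbitrary: q \<mu>) simp_all

text \<open>If an argument is sent to zero, so is the value, since operations are linear in every
  slot. With this, a morphism kills an ideal given by generators once it kills the
  generators.\<close>

lemma alg_ideal_kernel: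
  assumes A: "operad_algebra R P A" and B: "operad_algebra R P B" and h: "h \<in> alg_hom R P A B"
  shows "alg_ideal R P A {x \<in> carrier A. h x = \<zero>\<^bsub>B\<^esub>}"
  unfolding alg_ideal_def
proof (intro conjI allI impI)
  interpret A: operad_algebra R P A by (rule A)
  interpret B: operad_algebra R P B by (rule B)
  show "submodule {x \<in> carrier A. h x = \<zero>\<^bsub>B\<^esub>} R A"
    by (rule submodule_kernel[OF A.module_axioms B.module_axioms alg_homD(1)[OF h]])
  fix as \<mu> assume as: "set as \<subseteq> carrier A" "\<mu> \<in> arity_ops P (length as)"
    and "set as \<inter> {x \<in> carrier A. h x = \<zero>\<^bsub>B\<^esub>} \<noteq> {}"
  then have "\<zero>\<^bsub>B\<^esub> \<in> set (map h as)" by force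
  moreover have "set (map h as) \<subseteq> carrier B" using as alg_homD(2)[OF h] by auto
  ultimately have "h (oper A \<mu> as) = \<zero>\<^bsub>B\<^esub>"
    using as B.oper_zero_arg by (simp add: alg_homD(3)[OF h])
  then show "oper A \<mu> as \<in> {x \<in> carrier A. h x = \<zero>\<^bsub>B\<^esub>}" using A.oper_closed as by simp
qed

section \<open>Universal property of the free algebra\<close>

context free_operad_algebra
begin

lemma free_incl_eq: "free_incl R P V v = pt (opunit P) [v]"
  by (simp add: free_incl_def pt_def Let_def)

lemma free_incl_linear: "lin_map R V (free_alg R P V) (free_incl R P V)"
proof (rule lin_mapI)
  fix x y r assume x: "x \<in> carrier V"
  have u: "opunit P \<in> arity_ops P (length [x])" using opunit_closed by simp
  then show "free_incl R P V x \<in> carrier (free_alg R P V)"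
    using x pt_closed[of "[x]" "opunit P"] by (simp add: free_incl_eq free_alg_eq)
  show "free_incl R P V (x \<oplus>\<^bsub>V\<^esub> y) = free_incl R P V x \<oplus>\<^bsub>free_alg R P V\<^esub> free_incl R P V y" if "y \<in> carrier V"
    using pt_relations(3)[OF _ u, of 0 x y] x that by (simp add: free_incl_eq free_alg_eq)
  show "free_incl R P V (r \<odot>\<^bsub>V\<^esub> x) = r \<odot>\<^bsub>free_alg R P V\<^esub> free_incl R P V x" if "r \<in> carrier R"
    using pt_relations(4)[OF _ u, of 0 r x] x that by (simp add: free_incl_eq free_alg_eq)
qed

text \<open>Pure tensors span the free algebra and each is an operation applied to generators, so a
  morphism is determined by its values on \<open>V\<close>. The identity is \<open>ev_units\<close>
  read through the quotient operation.\<close>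

lemma pt_eq_oper:
  assumes "set vs \<subseteq> carrier V" "\<mu> \<in> arity_ops P (length vs)"
  shows "pt \<mu> vs = oper (free_alg R P V) \<mu> (map (free_incl R P V) vs)"
proof -
  have us: "set (units vs) \<subseteq> PT" using assms(1) by (rule units_PT)
  have F: "set (map \<delta> (units vs)) \<subseteq> carrier F" using us \<delta>_closed by (auto simp del: map_map)
  have "pt \<mu> vs = K +>\<^bsub>F\<^esub> opr \<mu> (map \<delta> (units vs))"
    using assms us by (simp add: cls_opr_basis ev_units del: map_map)
  also have "\<dots> = oper Q.quot \<mu> (map (\<lambda>f. K +>\<^bsub>F\<^esub> f) (map \<delta> (units vs)))"
    using assms F by (intro Q.quot_oper[symmetric]) simp_all
  also have "map (\<lambda>f. K +>\<^bsub>F\<^esub> f) (map \<delta> (units vs)) = map (free_incl R P V) vs"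
    by (simp add: free_incl_eq pt_def)
  finally show ?thesis by (simp only: free_alg_eq)
qed

lemma free_hom_unique:
  assumes B: "operad_algebra R P B"
    and g: "g \<in> alg_hom R P (free_alg R P V) B" and h: "h \<in> alg_hom R P (free_alg R P V) B"
    and eq: "\<And>v. v \<in> carrier V \<Longrightarrow> g (free_incl R P V v) = h (free_incl R P V v)"
    and x: "x \<in> carrier (free_alg R P V)"
  shows "g x = h x"
proof -
  interpret B: operad_algebra R P B by (rule B)
  have lin: "lin_map R Q B g" "lin_map R Q B h" using alg_homD(1)[OF g] alg_homD(1)[OF h] by (simp_all add: free_alg_eq)
  have xQ: "x \<in> carrier Q" using x by (simp add: free_alg_eq)
  show ?thesis
  proof (rule lin_map_ext[OF Q.module_Q B.module_axioms Q.cls_spans[OF spans_basis] lin _ xQ])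
    fix c assume "c \<in> (\<lambda>x. K +>\<^bsub>F\<^esub> x) ` \<delta> ` PT"
    then obtain \<mu> vs where c: "c = pt \<mu> vs" "set vs \<subseteq> carrier V" "\<mu> \<in> arity_ops P (length vs)"
      by (auto simp: pt_def pure_tensors_def)
    have vs: "set (map (free_incl R P V) vs) \<subseteq> carrier (free_alg R P V)"
      using c(2) lin_mapD(1)[OF free_incl_linear] by auto
    have \<mu>: "\<mu> \<in> arity_ops P (length (map (free_incl R P V) vs))" using c(3) by simp
    have "map g (map (free_incl R P V) vs) = map h (map (free_incl R P V) vs)" using c(2) eq by auto
    then show "g c = h c"
      unfolding c(1) pt_eq_oper[OF c(2,3)] alg_homD(3)[OF g vs \<mu>] alg_homD(3)[OF h vs \<mu>] by (rule arg_cong)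
  qed
qed

text \<open>The pure tensor \<open>\<mu> \<otimes> vs\<close> must go to
  \<open>\<mu>(\<phi> v\<^sub>0, ...)\<close>. The linear extension to formal sums respects the
  relations because the operations of \<open>B\<close> are multilinear and equivariant, and it
  respects the operations because \<open>B\<close> satisfies the composition law.\<close>

lemma free_hom_exists:
  assumes B: "operad_algebra R P B" and \<phi>: "lin_map R V B \<phi>"
  obtains h where "h \<in> alg_hom R P (free_alg R P V) B"
    "\<And>v. v \<in> carrier V \<Longrightarrow> h (free_incl R P V v) = \<phi> v"
proof -
  interpret B: operad_algebra R P B by (rule B)
  define e where "e t = oper B (fst t) (map \<phi> (snd t))" for t :: "('p, 'v) tensor"
  define H where "H f = lin_ext R B f e" for f
  have \<phi>c: "\<phi> v \<in> carrier B" if "v \<in> carrier V" for v using lin_mapD(1)[OF \<phi> that] .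
  have \<phi>vs: "set (map \<phi> vs) \<subseteq> carrier B" if "set vs \<subseteq> carrier V" for vs using that \<phi>c by auto
  have e_closed: "e t \<in> carrier B" if "t \<in> PT" for t
    unfolding e_def using that \<phi>c by (intro B.oper_closed) (auto simp: pure_tensors_def subset_iff)
  have H: "lin_map R F B H"
    unfolding H_def using e_closed by (rule B.lin_ext_linear)
  have H\<delta>: "H (\<delta> t) = e t" if "t \<in> PT" for t
    unfolding H_def using that e_closed by (rule B.lin_ext_basis)
  have ker: "H f = \<zero>\<^bsub>B\<^esub>" if "f \<in> K" for f
  proof (rule kernel_K[OF B.module_axioms H that])
    fix \<mu> vs assume vs: "set vs \<subseteq> carrier V" and \<mu>: "\<mu> \<in> arity_ops P (length vs)"
    note simps = H\<delta> PT_closed[OF vs \<mu>] PT_closed(1)[OF vs] e_def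
    have \<mu>': "\<mu> \<in> arity_ops P (length (map \<phi> vs))" using \<mu> by simp
    show "H (\<delta> (\<mu> \<oplus>\<^bsub>opmod P (length vs)\<^esub> \<nu>, vs)) = H (\<delta> (\<mu>, vs)) \<oplus>\<^bsub>B\<^esub> H (\<delta> (\<nu>, vs))"
      if "\<nu> \<in> arity_ops P (length vs)" for \<nu>
      using B.oper_add_op[OF \<phi>vs[OF vs] \<mu>', of \<nu>] that by (simp add: simps)
    show "H (\<delta> (r \<odot>\<^bsub>opmod P (length vs)\<^esub> \<mu>, vs)) = r \<odot>\<^bsub>B\<^esub> H (\<delta> (\<mu>, vs))" if "r \<in> carrier R" for r
      using B.oper_smult_op[OF that \<phi>vs[OF vs] \<mu>'] that by (simp add: simps)
    show "H (\<delta> (\<mu>, vs[i := x \<oplus>\<^bsub>V\<^esub> y])) = H (\<delta> (\<mu>, vs[i := x])) \<oplus>\<^bsub>B\<^esub> H (\<delta> (\<mu>, vs[i := y]))"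
      if "i < length vs" "x \<in> carrier V" "y \<in> carrier V" for i x y
      using B.oper_add_arg[OF \<phi>vs[OF vs] \<mu>', of i "\<phi> x" "\<phi> y"] that \<phi>c
      by (simp add: simps map_update lin_mapD[OF \<phi>])
    show "H (\<delta> (\<mu>, vs[i := r \<odot>\<^bsub>V\<^esub> x])) = r \<odot>\<^bsub>B\<^esub> H (\<delta> (\<mu>, vs[i := x]))"
      if "i < length vs" "r \<in> carrier R" "x \<in> carrier V" for i r x
      using B.oper_smult_arg[OF \<phi>vs[OF vs] \<mu>', of i r "\<phi> x"] that \<phi>c
      by (simp add: simps map_update lin_mapD[OF \<phi>])
    show "H (\<delta> (act P (length vs) \<mu> \<sigma>, vs)) = H (\<delta> (\<mu>, permute_list (inv_into UNIV \<sigma>) vs))"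
      if "\<sigma> permutes {..<length vs}" for \<sigma>
      using B.oper_act[OF \<phi>vs[OF vs] \<mu>', of \<sigma>] that
      by (simp add: simps permute_list_map permutes_inv)
  qed
  have oper: "H (opr \<mu> fs) = oper B \<mu> (map H fs)"
    if fs: "set fs \<subseteq> carrier F" and \<mu>: "\<mu> \<in> arity_ops P (length fs)" for fs \<mu>
  proof (rule F_agree[OF B.module_axioms multilin_compose[OF opr_multilin[OF \<mu>] H]
        multilin_map[OF B.oper_multilin[OF \<mu>] H] _ fs refl])
    fix ts assume ts: "set ts \<subseteq> PT" "length ts = length fs"
    \<comment> \<open>Applying \<open>\<phi>\<close> to the inputs keeps their number and hence the
      total composite, so the composition law of \<open>B\<close> can be applied to tensors with
      inputs in \<open>B\<close>.\<close>
    let ?ts = "map (\<lambda>t. (fst t, map \<phi> (snd t))) ts"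
    have ok: "\<forall>t\<in>set ?ts. tensor_ok P t \<and> set (snd t) \<subseteq> carrier B"
      using ts(1) \<phi>c by (auto simp: pure_tensors_def subset_iff)
    have "H (opr \<mu> (map \<delta> ts)) = e (full_comp P 0 \<mu> ts, tensor_inputs ts)"
      using ts \<mu> by (simp add: opr_basis H\<delta> full_comp_PT)
    also have "\<dots> = oper B (full_comp P 0 \<mu> ?ts) (tensor_inputs ?ts)"
      by (simp add: e_def full_comp_map_inputs map_concat comp_def)
    also have "\<dots> = oper B \<mu> (map (\<lambda>t. oper B (fst t) (snd t)) ?ts)"
      using \<mu> ts(2) ok by (intro B.oper_full_comp) simp_all
    also have "map (\<lambda>t. oper B (fst t) (snd t)) ?ts = map H (map \<delta> ts)"
      using ts(1) H\<delta> by (auto simp: e_def)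
    finally show "H (opr \<mu> (map \<delta> ts)) = oper B \<mu> (map H (map \<delta> ts))" .
  qed
  obtain h where h: "h \<in> alg_hom R P Q.quot B" "\<And>f. f \<in> carrier F \<Longrightarrow> h (K +>\<^bsub>F\<^esub> f) = H f"
    using Q.quot_hom_lift[OF B H ker oper] by blast
  have "h (free_incl R P V v) = \<phi> v" if "v \<in> carrier V" for v
  proof -
    have "(opunit P, [v]) \<in> PT" using units_PT[of "[v]"] that by simp
    then show ?thesis
      using that by (simp add: free_incl_eq pt_def h(2) \<delta>_closed H\<delta> e_def B.oper_unit \<phi>c)
  qed
  with h(1) that show ?thesis by (simp add: free_alg_eq)
qed

end

section \<open>The adjoint tangent functor\<close>

text \<open>The same assumptions as \<open>operad_algebra\<close> under a new name: \<open>S\<close>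
  and \<open>T\<close> are operad algebras in turn, and sublocales declared in
  \<open>operad_algebra\<close> itself would apply to them again without end.\<close>

locale adj_tangent_algebra = operad_algebra R P A
  for R :: "('r, 's) ring_scheme" (structure) and P :: "('r, 'p) operad"
    and A :: "('r, 'p, 'a) operad_alg"
begin

abbreviation V where "V \<equiv> prod_module A A"
abbreviation S where "S \<equiv> free_alg R P V"
abbreviation j where "j \<equiv> free_incl R P V"
abbreviation I where "I \<equiv> adj_ideal R P A"
abbreviation T where "T \<equiv> adj_tangent R P A"

sublocale free: free_operad_algebra R P V
  by (intro free_operad_algebra.intro symmetric_operad_axioms module_prod_module module_axioms)

sublocale S: operad_algebra R P S
  by (rule free.free_alg_operad_algebra)

lemma j_closed: "v \<in> carrier V \<Longrightarrow> j v \<in> carrier S"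
  by (rule lin_mapD(1)[OF free.free_incl_linear])

lemma inl_linear: "lin_map R A V (\<lambda>a. (a, \<zero>\<^bsub>A\<^esub>))"
  and inr_linear: "lin_map R A V (\<lambda>a. (\<zero>\<^bsub>A\<^esub>, a))"
  by (intro lin_map_pair lin_map_id lin_map_const_zero module_axioms)+

lemma pair_closed: "a \<in> carrier A \<Longrightarrow> b \<in> carrier A \<Longrightarrow> (a, b) \<in> carrier V"
  by (simp add: prod_module_simps)

lemma jl_closed: "a \<in> carrier A \<Longrightarrow> j (a, \<zero>\<^bsub>A\<^esub>) \<in> carrier S"
  and jr_closed: "a \<in> carrier A \<Longrightarrow> j (\<zero>\<^bsub>A\<^esub>, a) \<in> carrier S"
  by (simp_all add: j_closed pair_closed)

lemma jl_list_closed: "set as \<subseteq> carrier A \<Longrightarrow> set (map (\<lambda>a. j (a, \<zero>\<^bsub>A\<^esub>)) as) \<subseteq> carrier S"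
  using jl_closed by auto

lemma jlr_list_closed:
  assumes "set as \<subseteq> carrier A" "i < length as"
  shows "set ((map (\<lambda>a. j (a, \<zero>\<^bsub>A\<^esub>)) as)[i := j (\<zero>\<^bsub>A\<^esub>, as ! i)]) \<subseteq> carrier S"
  using assms by (intro set_update_subset jl_list_closed jr_closed) auto

lemma jlr_oper_closed:
  assumes "set as \<subseteq> carrier A" "\<mu> \<in> arity_ops P (length as)" "i < length as"
  shows "oper S \<mu> ((map (\<lambda>a. j (a, \<zero>\<^bsub>A\<^esub>)) as)[i := j (\<zero>\<^bsub>A\<^esub>, as ! i)]) \<in> carrier S"
  using assms jlr_list_closed by (intro S.oper_closed) auto

lemma adj_relationsI:
  assumes "set as \<subseteq> carrier A" "\<mu> \<in> arity_ops P (length as)"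
  shows "oper S \<mu> (map (\<lambda>a. j (a, \<zero>\<^bsub>A\<^esub>)) as) \<ominus>\<^bsub>S\<^esub> j (oper A \<mu> as, \<zero>\<^bsub>A\<^esub>) \<in> adj_relations R P A"
    and "j (\<zero>\<^bsub>A\<^esub>, oper A \<mu> as) \<ominus>\<^bsub>S\<^esub>
      finsum S (\<lambda>i. oper S \<mu> ((map (\<lambda>a. j (a, \<zero>\<^bsub>A\<^esub>)) as)[i := j (\<zero>\<^bsub>A\<^esub>, as ! i)])) {..<length as}
      \<in> adj_relations R P A"
  unfolding adj_relations_def Let_def
  by (rule UnI1, rule CollectI, intro exI conjI, rule refl, rule assms, rule assms,
      rule UnI2, rule CollectI, intro exI conjI, rule refl, rule assms, rule assms)

lemma adj_relationsE:
  assumes "x \<in> adj_relations R P A"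
  obtains \<mu> as where "set as \<subseteq> carrier A" "\<mu> \<in> arity_ops P (length as)"
      "x = oper S \<mu> (map (\<lambda>a. j (a, \<zero>\<^bsub>A\<^esub>)) as) \<ominus>\<^bsub>S\<^esub> j (oper A \<mu> as, \<zero>\<^bsub>A\<^esub>)"
    | \<mu> as where "set as \<subseteq> carrier A" "\<mu> \<in> arity_ops P (length as)"
      "x = j (\<zero>\<^bsub>A\<^esub>, oper A \<mu> as) \<ominus>\<^bsub>S\<^esub>
        finsum S (\<lambda>i. oper S \<mu> ((map (\<lambda>a. j (a, \<zero>\<^bsub>A\<^esub>)) as)[i := j (\<zero>\<^bsub>A\<^esub>, as ! i)])) {..<length as}"
  using assms unfolding adj_relations_def Let_def by (elim UnE CollectE exE conjE) blast+

lemma jlr_finsum_closed: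
  assumes "set as \<subseteq> carrier A" "\<mu> \<in> arity_ops P (length as)"
  shows "finsum S (\<lambda>i. oper S \<mu> ((map (\<lambda>a. j (a, \<zero>\<^bsub>A\<^esub>)) as)[i := j (\<zero>\<^bsub>A\<^esub>, as ! i)])) {..<length as}
    \<in> carrier S"
  using jlr_oper_closed[OF assms] by (intro S.M.finsum_closed) auto

lemma jl_oper_closed:
  assumes "set as \<subseteq> carrier A" "\<mu> \<in> arity_ops P (length as)"
  shows "oper S \<mu> (map (\<lambda>a. j (a, \<zero>\<^bsub>A\<^esub>)) as) \<in> carrier S"
  using assms jl_list_closed by (intro S.oper_closed) auto

lemma adj_relations_closed: "adj_relations R P A \<subseteq> carrier S"
proof
  fix x assume "x \<in> adj_relations R P A"
  then show "x \<in> carrier S"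
    by (cases rule: adj_relationsE)
      (simp_all only: S.M.minus_closed jl_oper_closed jl_closed jr_closed oper_closed jlr_finsum_closed)
qed

lemma adj_ideal: "alg_ideal R P S I"
  unfolding adj_ideal_def by (rule S.alg_ideal_gen_ideal[OF adj_relations_closed])

sublocale T: operad_quotient R P S I "oper S"
  by (rule S.ideal_quotient[OF adj_ideal])

lemma T_eq: "T = T.quot"
  by (simp add: adj_tangent_def quot_alg_def)

lemma adj_tangent_operad_algebra: "operad_algebra R P T"
  unfolding T_eq by (rule T.quot_operad_algebra)

sublocale Ta: operad_algebra R P T
  by (rule adj_tangent_operad_algebra)

lemma cls_hom: "(\<lambda>x. I +>\<^bsub>S\<^esub> x) \<in> alg_hom R P S T"
proof (rule alg_homI)
  show "lin_map R S T (\<lambda>x. I +>\<^bsub>S\<^esub> x)" unfolding T_eq using T.cls_linear by simp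
  fix xs \<mu> assume "set xs \<subseteq> carrier S" "\<mu> \<in> arity_ops P (length xs)"
  from T.quot_oper[OF this, symmetric]
  show "I +>\<^bsub>S\<^esub> oper S \<mu> xs = oper T \<mu> (map (\<lambda>x. I +>\<^bsub>S\<^esub> x) xs)" by (simp only: T_eq)
qed

lemma cls_eq:
  assumes "x \<ominus>\<^bsub>S\<^esub> y \<in> adj_relations R P A" "x \<in> carrier S" "y \<in> carrier S"
  shows "I +>\<^bsub>S\<^esub> x = I +>\<^bsub>S\<^esub> y"
proof -
  have "x \<ominus>\<^bsub>S\<^esub> y \<in> I" using assms(1) by (auto simp: adj_ideal_def alg_ideal_gen_def)
  then show ?thesis by (rule iffD2[OF T.cls_eq_iff[OF assms(2,3)]])
qed

section \<open>Generators of the adjoint tangent algebra and its universal property\<close>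

lemma adj_pt_linear: "lin_map R A T (adj_pt R P A)"
  and adj_d_linear: "lin_map R A T (adj_d R P A)"
  unfolding adj_pt_def[abs_def] adj_d_def[abs_def]
  by (rule lin_map_compose[OF lin_map_compose[OF inl_linear free.free_incl_linear] alg_homD(1)[OF cls_hom]],
      rule lin_map_compose[OF lin_map_compose[OF inr_linear free.free_incl_linear] alg_homD(1)[OF cls_hom]])

text \<open>The class map is a morphism that equates the two sides of each relation. The first
  family then gives the base component of the operation in \<open>tangent T\<close>; the second,
  whose sum consists of the same Leibniz terms, gives the tangent component.\<close>

lemma adj_unit_hom: "adj_unit R P A \<in> alg_hom R P A (tangent T)"
proof (rule alg_homI)
  have "lin_map R A (prod_module T T) (\<lambda>a. (adj_pt R P A a, adj_d R P A a))"
    by (rule lin_map_pair[OF adj_pt_linear adj_d_linear])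
  then show "lin_map R A (tangent T) (adj_unit R P A)"
    unfolding lin_map_def by (simp add: tangent_simps prod_module_simps adj_unit_def Pi_iff)
  fix as \<mu> assume as: "set as \<subseteq> carrier A" and \<mu>: "\<mu> \<in> arity_ops P (length as)"
  let ?c = "\<lambda>x. I +>\<^bsub>S\<^esub> x" and ?jl = "map (\<lambda>a. j (a, \<zero>\<^bsub>A\<^esub>)) as"
  let ?jlr = "\<lambda>i. ?jl[i := j (\<zero>\<^bsub>A\<^esub>, as ! i)]"
  have o: "oper A \<mu> as \<in> carrier A" using as \<mu> by (rule oper_closed)
  have "adj_pt R P A (oper A \<mu> as) = ?c (oper S \<mu> ?jl)"
    unfolding adj_pt_def
    by (rule cls_eq[OF adj_relationsI(1)[OF as \<mu>] jl_oper_closed[OF as \<mu>] jl_closed[OF o], symmetric])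
  also have "\<dots> = oper T \<mu> (map ?c ?jl)"
    using \<mu> by (intro alg_homD(3)[OF cls_hom jl_list_closed[OF as]]) simp
  also have "map ?c ?jl = map fst (map (adj_unit R P A) as)" by (simp add: adj_unit_def adj_pt_def)
  finally have pt: "adj_pt R P A (oper A \<mu> as) = oper T \<mu> (map fst (map (adj_unit R P A) as))" .
  have args: "map ?c (?jlr i) = tangent_args i (map (adj_unit R P A) as)" if "i < length as" for i
    using that by (simp add: tangent_args_def map_update adj_unit_def adj_pt_def adj_d_def comp_def)
  have c: "?c (oper S \<mu> (?jlr i)) = oper T \<mu> (tangent_args i (map (adj_unit R P A) as))" if "i < length as" for i
    unfolding args[OF that, symmetric]
    using \<mu> by (intro alg_homD(3)[OF cls_hom jlr_list_closed[OF as that]]) simp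
  have "adj_d R P A (oper A \<mu> as) = ?c (finsum S (\<lambda>i. oper S \<mu> (?jlr i)) {..<length as})"
    unfolding adj_d_def
    by (rule cls_eq[OF adj_relationsI(2)[OF as \<mu>] jr_closed[OF o] jlr_finsum_closed[OF as \<mu>]])
  also have "\<dots> = finsum T (\<lambda>i. ?c (oper S \<mu> (?jlr i))) {..<length as}"
    using jlr_oper_closed[OF as \<mu>]
    by (intro lin_map_finsum[OF S.module_axioms Ta.module_axioms alg_homD(1)[OF cls_hom]]) auto
  also have "\<dots> = finsum T (\<lambda>i. oper T \<mu> (tangent_args i (map (adj_unit R P A) as))) {..<length as}"
  proof (rule Ta.M.finsum_cong')
    show "(\<lambda>i. oper T \<mu> (tangent_args i (map (adj_unit R P A) as))) \<in> {..<length as} \<rightarrow> carrier T"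
      using alg_homD(2)[OF cls_hom jlr_oper_closed[OF as \<mu>]] by (auto simp flip: c)
  qed (simp_all add: c)
  finally have "adj_d R P A (oper A \<mu> as)
    = finsum T (\<lambda>i. oper T \<mu> (tangent_args i (map (adj_unit R P A) as))) {..<length as}" .
  with pt show "adj_unit R P A (oper A \<mu> as) = oper (tangent T) \<mu> (map (adj_unit R P A) as)"
    unfolding adj_unit_def[of R P A "oper A \<mu> as"] tangent_simps(4) by simp
qed

text \<open>Since \<open>(a, b) = (a, 0) + (0, b)\<close>, agreement on all \<open>a\<close> and
  \<open>d(b)\<close> is agreement on \<open>V\<close> after composing with the projection from the
  free algebra, where uniqueness is known.\<close>

lemma adj_hom_unique:
  assumes B: "operad_algebra R P B" and g: "g \<in> alg_hom R P T B" and h: "h \<in> alg_hom R P T B"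
    and eq: "\<And>a. a \<in> carrier A \<Longrightarrow> g (adj_pt R P A a) = h (adj_pt R P A a)"
      "\<And>a. a \<in> carrier A \<Longrightarrow> g (adj_d R P A a) = h (adj_d R P A a)"
    and x: "x \<in> carrier T"
  shows "g x = h x"
proof -
  let ?c = "\<lambda>x. I +>\<^bsub>S\<^esub> x"
  have gc: "(\<lambda>x. g (?c x)) \<in> alg_hom R P S B" and hc: "(\<lambda>x. h (?c x)) \<in> alg_hom R P S B"
    by (rule alg_hom_compose[OF cls_hom g], rule alg_hom_compose[OF cls_hom h])
  have "g (?c (j v)) = h (?c (j v))" if v: "v \<in> carrier V" for v
  proof -
    obtain a b where ab: "v = (a, b)" "a \<in> carrier A" "b \<in> carrier A" using v by (auto simp: prod_module_simps)
    have "j v = j (a, \<zero>\<^bsub>A\<^esub>) \<oplus>\<^bsub>S\<^esub> j (\<zero>\<^bsub>A\<^esub>, b)"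
      using ab lin_mapD(2)[OF free.free_incl_linear, of "(a, \<zero>\<^bsub>A\<^esub>)" "(\<zero>\<^bsub>A\<^esub>, b)"] by (simp add: prod_module_simps)
    then show ?thesis
      using ab eq lin_mapD(2)[OF alg_homD(1)[OF gc] jl_closed jr_closed]
        lin_mapD(2)[OF alg_homD(1)[OF hc] jl_closed jr_closed]
      by (simp add: adj_pt_def adj_d_def)
  qed
  note unique = free.free_hom_unique[OF B gc hc this]
  obtain y where "y \<in> carrier S" "x = ?c y" using x unfolding T_eq by (auto simp: T.carrier_Q)
  with unique show ?thesis by blast
qed

text \<open>On \<open>V\<close> the map has to be \<open>(a, b) \<mapsto> u a + v b\<close>. Its
  extension to the free algebra equates both sides of each relation, because the two components of
  the hypothesis say that \<open>u\<close> respects operations and that \<open>v\<close> satisfies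
  the Leibniz rule along \<open>u\<close>.\<close>

lemma adj_hom_exists:
  assumes B: "operad_algebra R P B" and uv: "(\<lambda>a. (u a, v a)) \<in> alg_hom R P A (tangent B)"
  obtains h where "h \<in> alg_hom R P T B"
    "\<And>a. a \<in> carrier A \<Longrightarrow> h (adj_pt R P A a) = u a" "\<And>a. a \<in> carrier A \<Longrightarrow> h (adj_d R P A a) = v a"
proof -
  interpret B: operad_algebra R P B by (rule B)
  have pair: "lin_map R A (prod_module B B) (\<lambda>a. (u a, v a))"
    using alg_homD(1)[OF uv] unfolding lin_map_def by (simp add: tangent_simps prod_module_simps)
  have u: "lin_map R A B u" and v: "lin_map R A B v"
    using lin_map_compose[OF pair lin_map_fst] lin_map_compose[OF pair lin_map_snd] by simp_all
  have u0: "u \<zero>\<^bsub>A\<^esub> = \<zero>\<^bsub>B\<^esub>" and v0: "v \<zero>\<^bsub>A\<^esub> = \<zero>\<^bsub>B\<^esub>"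
    using lin_map_zero[OF module_axioms B.module_axioms u] lin_map_zero[OF module_axioms B.module_axioms v] .
  note closed = lin_mapD(1)[OF u] lin_mapD(1)[OF v]
  have "lin_map R V B (\<lambda>p. u (fst p) \<oplus>\<^bsub>B\<^esub> v (snd p))"
    by (intro lin_map_add[OF free.V.module_axioms B.module_axioms] lin_map_compose[OF lin_map_fst u]
        lin_map_compose[OF lin_map_snd v])
  then obtain g where g: "g \<in> alg_hom R P S B"
    and gj: "\<And>p. p \<in> carrier V \<Longrightarrow> g (j p) = u (fst p) \<oplus>\<^bsub>B\<^esub> v (snd p)"
    using free.free_hom_exists[OF B] by blast
  \<comment> \<open>Both \<open>u\<close> and \<open>v\<close> vanish at zero, so the sum reduces to
    one of its terms.\<close>
  have gl: "g (j (a, \<zero>\<^bsub>A\<^esub>)) = u a" and gr: "g (j (\<zero>\<^bsub>A\<^esub>, a)) = v a" if "a \<in> carrier A" for a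
    using that closed by (simp_all add: gj pair_closed u0 v0)
  have ker: "g x = \<zero>\<^bsub>B\<^esub>" if "x \<in> adj_relations R P A" for x
    using that
  proof (cases rule: adj_relationsE)
    case (1 \<mu> as)
    have o: "oper A \<mu> as \<in> carrier A" using 1 by (intro oper_closed)
    have "g (oper S \<mu> (map (\<lambda>a. j (a, \<zero>\<^bsub>A\<^esub>)) as)) = oper B \<mu> (map g (map (\<lambda>a. j (a, \<zero>\<^bsub>A\<^esub>)) as))"
      using 1 by (intro alg_homD(3)[OF g] jl_list_closed) simp_all
    also have "map g (map (\<lambda>a. j (a, \<zero>\<^bsub>A\<^esub>)) as) = map u as" using 1(1) gl by auto
    also have "oper B \<mu> (map u as) = u (oper A \<mu> as)"
      using alg_homD(3)[OF uv 1(1,2)] by (simp add: tangent_simps comp_def)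
    also have "\<dots> = g (j (oper A \<mu> as, \<zero>\<^bsub>A\<^esub>))" using gl[OF o] by simp
    finally show ?thesis
      using 1 o closed by (simp add: lin_map_minus[OF S.module_axioms B.module_axioms alg_homD(1)[OF g]]
          jl_oper_closed jl_closed gl minus_eq_zero_iff[OF B.M.abelian_group_axioms])
  next
    case (2 \<mu> as)
    have o: "oper A \<mu> as \<in> carrier A" using 2 by (intro oper_closed)
    let ?jlr = "\<lambda>i. (map (\<lambda>a. j (a, \<zero>\<^bsub>A\<^esub>)) as)[i := j (\<zero>\<^bsub>A\<^esub>, as ! i)]"
    let ?uv = "map (\<lambda>a. (u a, v a)) as"
    have uvc: "set ?uv \<subseteq> carrier (tangent B)" using 2(1) closed by (auto simp: tangent_simps)
    have "g (finsum S (\<lambda>i. oper S \<mu> (?jlr i)) {..<length as}) = finsum B (\<lambda>i. g (oper S \<mu> (?jlr i))) {..<length as}"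
      using jlr_oper_closed[OF 2(1,2)]
      by (intro lin_map_finsum[OF S.module_axioms B.module_axioms alg_homD(1)[OF g]]) auto
    also have "\<dots> = finsum B (\<lambda>i. oper B \<mu> (tangent_args i ?uv)) {..<length as}"
    proof (rule B.M.finsum_cong')
      fix i assume "i \<in> {..<length as}"
      then have i: "i < length as" by simp
      have "g (oper S \<mu> (?jlr i)) = oper B \<mu> (map g (?jlr i))"
        using 2 i by (intro alg_homD(3)[OF g] jlr_list_closed) simp_all
      also have "map g (?jlr i) = tangent_args i ?uv"
        using 2(1) i gl gr by (auto simp: tangent_args_def map_update subset_iff intro!: arg_cong2[where f = "\<lambda>l x. l[i := x]"])
      finally show "g (oper S \<mu> (?jlr i)) = oper B \<mu> (tangent_args i ?uv)" .
    qed (use B.oper_tangent_args_closed[OF uvc] 2 in auto)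
    also have "\<dots> = v (oper A \<mu> as)" using alg_homD(3)[OF uv 2(1,2)] by (simp add: tangent_simps)
    also have "\<dots> = g (j (\<zero>\<^bsub>A\<^esub>, oper A \<mu> as))" using gr[OF o] by simp
    finally show ?thesis
      using 2 o closed by (simp add: lin_map_minus[OF S.module_axioms B.module_axioms alg_homD(1)[OF g]]
          jlr_finsum_closed jr_closed gr minus_eq_zero_iff[OF B.M.abelian_group_axioms])
  qed
  have "adj_relations R P A \<subseteq> {x \<in> carrier S. g x = \<zero>\<^bsub>B\<^esub>}" using ker adj_relations_closed by auto
  \<comment> \<open>The ideal generated by the relations is the least one containing them, and the
    kernel of \<open>g\<close> is an ideal that contains them.\<close>
  with alg_ideal_kernel[OF S.operad_algebra_axioms B g]
  have "I \<subseteq> {x \<in> carrier S. g x = \<zero>\<^bsub>B\<^esub>}" unfolding adj_ideal_def alg_ideal_gen_def by blast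
  then have "g x = \<zero>\<^bsub>B\<^esub>" if "x \<in> I" for x using that by auto
  from T.quot_hom_lift[OF B alg_homD(1)[OF g] this alg_homD(3)[OF g]]
  obtain h where h: "h \<in> alg_hom R P T B" "\<And>x. x \<in> carrier S \<Longrightarrow> h (I +>\<^bsub>S\<^esub> x) = g x"
    unfolding T_eq by blast
  show ?thesis
    by (rule that[OF h(1)]) (simp_all add: adj_pt_def adj_d_def h(2) jl_closed jr_closed gl gr)
qed

text \<open>The definite description needs a single function, while uniqueness of morphisms holds on
  the carrier only. Restricting a morphism to the carrier gives existence, and extensionality turns
  agreement on the carrier into equality.\<close>

lemma adj_rec:
  assumes B: "operad_algebra R P B" and uv: "(\<lambda>a. (u a, v a)) \<in> alg_hom R P A (tangent B)"
  shows "adj_rec R P A B u v \<in> alg_hom R P T B"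
    and "a \<in> carrier A \<Longrightarrow> adj_rec R P A B u v (adj_pt R P A a) = u a"
    and "a \<in> carrier A \<Longrightarrow> adj_rec R P A B u v (adj_d R P A a) = v a"
proof -
  let ?Q = "\<lambda>h. h \<in> extensional (carrier T) \<and> h \<in> alg_hom R P T B \<and>
    (\<forall>a\<in>carrier A. h (adj_pt R P A a) = u a \<and> h (adj_d R P A a) = v a)"
  obtain h where h: "h \<in> alg_hom R P T B"
    "\<And>a. a \<in> carrier A \<Longrightarrow> h (adj_pt R P A a) = u a" "\<And>a. a \<in> carrier A \<Longrightarrow> h (adj_d R P A a) = v a"
    using adj_hom_exists[OF B uv] by blast
  let ?h = "restrict h (carrier T)"
  have "lin_map R T B ?h"
    by (rule lin_map_cong[OF _ alg_homD(1)[OF h(1)] Ta.module_axioms]) simp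
  moreover have "?h (oper T \<mu> xs) = oper B \<mu> (map ?h xs)"
    if xs: "set xs \<subseteq> carrier T" "\<mu> \<in> arity_ops P (length xs)" for xs \<mu>
  proof -
    have "map ?h xs = map h xs" using xs(1) by auto
    then show ?thesis using Ta.oper_closed[OF xs] alg_homD(3)[OF h(1) xs] by (simp del: map_eq_conv)
  qed
  ultimately have "?h \<in> alg_hom R P T B" by (intro alg_homI)
  then have "?Q ?h"
    using h(2,3) lin_mapD(1)[OF adj_pt_linear] lin_mapD(1)[OF adj_d_linear] by simp
  moreover have "h1 = ?h" if "?Q h1" for h1
  proof (rule extensionalityI[of _ "carrier T"])
    fix x assume "x \<in> carrier T"
    then show "h1 x = ?h x"
      using that \<open>?Q ?h\<close> by (intro adj_hom_unique[OF B, of h1 ?h x]) auto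
  qed (use that in auto)
  ultimately have "?Q (adj_rec R P A B u v)" unfolding adj_rec_def by (rule theI)
  then show "adj_rec R P A B u v \<in> alg_hom R P T B"
    "a \<in> carrier A \<Longrightarrow> adj_rec R P A B u v (adj_pt R P A a) = u a"
    "a \<in> carrier A \<Longrightarrow> adj_rec R P A B u v (adj_d R P A a) = v a" by blast+
qed

end

section \<open>The adjunction\<close>

lemma adj_tangent_algebraI: "operad_algebra R P A \<Longrightarrow> adj_tangent_algebra R P A"
  by (rule adj_tangent_algebra.intro)

lemma adj_tangent_map:
  assumes A: "operad_algebra R P A" and B: "operad_algebra R P B" and f: "f \<in> alg_hom R P A B"
  shows "adj_tangent_map R P A B f \<in> alg_hom R P (adj_tangent R P A) (adj_tangent R P B)"
    and "a \<in> carrier A \<Longrightarrow> adj_tangent_map R P A B f (adj_pt R P A a) = adj_pt R P B (f a)"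
    and "a \<in> carrier A \<Longrightarrow> adj_tangent_map R P A B f (adj_d R P A a) = adj_d R P B (f a)"
proof -
  interpret A: adj_tangent_algebra R P A using A by (rule adj_tangent_algebraI)
  interpret B: adj_tangent_algebra R P B using B by (rule adj_tangent_algebraI)
  \<comment> \<open>The pair of prescribed values is \<open>f\<close> followed by the unit of
    \<open>B\<close>, hence a morphism into the tangent algebra.\<close>
  have "(\<lambda>a. (adj_pt R P B (f a), adj_d R P B (f a))) \<in> alg_hom R P A (tangent (adj_tangent R P B))"
    using alg_hom_compose[OF f B.adj_unit_hom] by (simp add: adj_unit_def)
  note rec = A.adj_rec[OF B.adj_tangent_operad_algebra this, folded adj_tangent_map_def]
  show "adj_tangent_map R P A B f \<in> alg_hom R P (adj_tangent R P A) (adj_tangent R P B)"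
    "a \<in> carrier A \<Longrightarrow> adj_tangent_map R P A B f (adj_pt R P A a) = adj_pt R P B (f a)"
    "a \<in> carrier A \<Longrightarrow> adj_tangent_map R P A B f (adj_d R P A a) = adj_d R P B (f a)"
    using rec by blast+
qed

lemma adj_counit:
  assumes A: "operad_algebra R P A"
  shows "adj_counit R P A \<in> alg_hom R P (adj_tangent R P (tangent A)) A"
    and "p \<in> carrier (tangent A) \<Longrightarrow> adj_counit R P A (adj_pt R P (tangent A) p) = fst p"
    and "p \<in> carrier (tangent A) \<Longrightarrow> adj_counit R P A (adj_d R P (tangent A) p) = snd p"
proof -
  interpret TA: adj_tangent_algebra R P "tangent A"
    by (intro adj_tangent_algebraI operad_algebra.tangent_operad_algebra[OF A])
  \<comment> \<open>The two projections paired together are the identity of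
    \<open>tangent A\<close>.\<close>
  have "(\<lambda>p. (fst p, snd p)) \<in> alg_hom R P (tangent A) (tangent A)" by (simp add: alg_hom_id)
  note rec = TA.adj_rec[OF A this, folded adj_counit_def]
  show "adj_counit R P A \<in> alg_hom R P (adj_tangent R P (tangent A)) A"
    "p \<in> carrier (tangent A) \<Longrightarrow> adj_counit R P A (adj_pt R P (tangent A) p) = fst p"
    "p \<in> carrier (tangent A) \<Longrightarrow> adj_counit R P A (adj_d R P (tangent A) p) = snd p"
    using rec by blast+
qed

lemma adj_tangent_map_id:
  assumes A: "operad_algebra R P A" and x: "x \<in> carrier (adj_tangent R P A)"
  shows "adj_tangent_map R P A A (\<lambda>a. a) x = x"
proof -
  interpret A: adj_tangent_algebra R P A using A by (rule adj_tangent_algebraI)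
  note m = adj_tangent_map[OF A A alg_hom_id]
  show ?thesis by (rule A.adj_hom_unique[OF A.adj_tangent_operad_algebra m(1) alg_hom_id m(2,3) x])
qed

text \<open>Both sides are morphisms that send \<open>a\<close> to \<open>g (f a)\<close> and
  \<open>d(a)\<close> to \<open>d(g (f a))\<close>.\<close>

lemma adj_tangent_map_compose:
  assumes A: "operad_algebra R P A" and B: "operad_algebra R P B" and C: "operad_algebra R P C"
    and f: "f \<in> alg_hom R P A B" and g: "g \<in> alg_hom R P B C" and x: "x \<in> carrier (adj_tangent R P A)"
  shows "adj_tangent_map R P A C (g \<circ> f) x = adj_tangent_map R P B C g (adj_tangent_map R P A B f x)"
proof -
  interpret A: adj_tangent_algebra R P A using A by (rule adj_tangent_algebraI)
  interpret C: adj_tangent_algebra R P C using C by (rule adj_tangent_algebraI)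
  have gf: "g \<circ> f \<in> alg_hom R P A C" unfolding comp_def by (rule alg_hom_compose[OF f g])
  note mf = adj_tangent_map[OF A B f] and mg = adj_tangent_map[OF B C g] and mgf = adj_tangent_map[OF A C gf]
  show ?thesis
    by (rule A.adj_hom_unique[OF C.adj_tangent_operad_algebra mgf(1) alg_hom_compose[OF mf(1) mg(1)] _ _ x])
      (simp_all add: mf mg mgf alg_homD(2)[OF f])
qed

text \<open>Both composites send the generator \<open>p\<close> to \<open>f (fst p)\<close> and the
  generator \<open>d(p)\<close> to \<open>f (snd p)\<close>.\<close>

lemma adj_counit_natural:
  assumes A: "operad_algebra R P A" and B: "operad_algebra R P B" and f: "f \<in> alg_hom R P A B"
    and x: "x \<in> carrier (adj_tangent R P (tangent A))"
  shows "f (adj_counit R P A x)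
    = adj_counit R P B (adj_tangent_map R P (tangent A) (tangent B) (tangent_map f) x)"
proof -
  note TA = operad_algebra.tangent_operad_algebra[OF A] and TB = operad_algebra.tangent_operad_algebra[OF B]
  interpret TA: adj_tangent_algebra R P "tangent A" using TA by (rule adj_tangent_algebraI)
  note Tf = tangent_map_alg_hom[OF A B f]
  note m = adj_tangent_map[OF TA TB Tf] and cA = adj_counit[OF A] and cB = adj_counit[OF B]
  \<comment> \<open>\<open>tangent_map\<close> is unfolded in a second pass, after the rules for
    \<open>adj_tangent_map\<close> and \<open>adj_counit\<close> have been applied to its folded
    form.\<close>
  show ?thesis
    by (rule TA.adj_hom_unique[OF B alg_hom_compose[OF cA(1) f] alg_hom_compose[OF m(1) cB(1)] _ _ x])
      (simp_all add: m cA cB alg_homD(2)[OF Tf], simp_all add: tangent_map_def)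
qed

text \<open>The inner map sends \<open>a\<close> and \<open>d(a)\<close> to the two generators
  attached to the pair \<open>(a, d(a))\<close>, from which the counit reads off the first and the
  second component. So the composite fixes all generators of \<open>T\<degree>(A)\<close>.\<close>

lemma adj_triangle_left:
  assumes A: "operad_algebra R P A" and x: "x \<in> carrier (adj_tangent R P A)"
  shows "adj_counit R P (adj_tangent R P A)
    (adj_tangent_map R P A (tangent (adj_tangent R P A)) (adj_unit R P A) x) = x"
proof -
  interpret A: adj_tangent_algebra R P A using A by (rule adj_tangent_algebraI)
  note T = A.adj_tangent_operad_algebra
  note c = adj_counit[OF T] and m = adj_tangent_map[OF A operad_algebra.tangent_operad_algebra[OF T] A.adj_unit_hom]
  show ?thesis
    by (rule A.adj_hom_unique[OF T alg_hom_compose[OF m(1) c(1)] alg_hom_id _ _ x])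
      (simp_all add: m c alg_homD(2)[OF A.adj_unit_hom], simp_all add: adj_unit_def)
qed

text \<open>A computation on pairs: the unit produces the two generators attached to
  \<open>x\<close>, and the counit returns \<open>fst x\<close> and \<open>snd x\<close>.\<close>

lemma adj_triangle_right:
  assumes A: "operad_algebra R P A" and x: "x \<in> carrier (tangent A)"
  shows "tangent_map (adj_counit R P A) (adj_unit R P (tangent A) x) = x"
  using adj_counit(2,3)[OF A x] by (simp add: tangent_map_def adj_unit_def)

theorem lemma4p4p2:
  fixes R :: "('r, 's) ring_scheme" and P :: "('r, 'p) operad"
  assumes "symmetric_operad R P"
  shows
    \<comment> \<open>the tangent functor\<close>
    "(\<forall>A :: ('r, 'p, 'a) operad_alg. operad_algebra R P A \<longrightarrow>
        operad_algebra R P (tangent A) \<and>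
        (\<forall>x\<in>carrier (tangent A). tangent_map (\<lambda>a. a) x = x)) \<and>
     (\<forall>(A :: ('r, 'p, 'a) operad_alg) (B :: ('r, 'p, 'b) operad_alg) f.
        operad_algebra R P A \<and> operad_algebra R P B \<and> f \<in> alg_hom R P A B \<longrightarrow>
        tangent_map f \<in> alg_hom R P (tangent A) (tangent B)) \<and>
     (\<forall>(A :: ('r, 'p, 'a) operad_alg) (B :: ('r, 'p, 'b) operad_alg)
         (C :: ('r, 'p, 'c) operad_alg) f g.
        operad_algebra R P A \<and> operad_algebra R P B \<and> operad_algebra R P C \<and>
        f \<in> alg_hom R P A B \<and> g \<in> alg_hom R P B C \<longrightarrow>
        (\<forall>x\<in>carrier (tangent A). tangent_map (g \<circ> f) x = tangent_map g (tangent_map f x))) \<and>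
    \<comment> \<open>the adjoint tangent functor\<close>
     (\<forall>A :: ('r, 'p, 'a) operad_alg. operad_algebra R P A \<longrightarrow>
        operad_algebra R P (adj_tangent R P A) \<and>
        (\<forall>x\<in>carrier (adj_tangent R P A). adj_tangent_map R P A A (\<lambda>a. a) x = x)) \<and>
     (\<forall>(A :: ('r, 'p, 'a) operad_alg) (B :: ('r, 'p, 'b) operad_alg) f.
        operad_algebra R P A \<and> operad_algebra R P B \<and> f \<in> alg_hom R P A B \<longrightarrow>
        adj_tangent_map R P A B f \<in> alg_hom R P (adj_tangent R P A) (adj_tangent R P B) \<and>
        (\<forall>a\<in>carrier A.
           adj_tangent_map R P A B f (adj_pt R P A a) = adj_pt R P B (f a) \<and>
           adj_tangent_map R P A B f (adj_d R P A a) = adj_d R P B (f a))) \<and>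
     (\<forall>(A :: ('r, 'p, 'a) operad_alg) (B :: ('r, 'p, 'b) operad_alg)
         (C :: ('r, 'p, 'c) operad_alg) f g.
        operad_algebra R P A \<and> operad_algebra R P B \<and> operad_algebra R P C \<and>
        f \<in> alg_hom R P A B \<and> g \<in> alg_hom R P B C \<longrightarrow>
        (\<forall>x\<in>carrier (adj_tangent R P A).
           adj_tangent_map R P A C (g \<circ> f) x
             = adj_tangent_map R P B C g (adj_tangent_map R P A B f x))) \<and>
    \<comment> \<open>the components of the unit and the counit are morphisms\<close>
     (\<forall>A :: ('r, 'p, 'a) operad_alg. operad_algebra R P A \<longrightarrow>
        adj_unit R P A \<in> alg_hom R P A (tangent (adj_tangent R P A)) \<and>
        adj_counit R P A \<in> alg_hom R P (adj_tangent R P (tangent A)) A \<and>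
        (\<forall>a\<in>carrier A. \<forall>b\<in>carrier A.
           adj_counit R P A (adj_pt R P (tangent A) (a, b)) = a \<and>
           adj_counit R P A (adj_d R P (tangent A) (a, b)) = b)) \<and>
    \<comment> \<open>naturality\<close>
     (\<forall>(A :: ('r, 'p, 'a) operad_alg) (B :: ('r, 'p, 'b) operad_alg) f.
        operad_algebra R P A \<and> operad_algebra R P B \<and> f \<in> alg_hom R P A B \<longrightarrow>
        (\<forall>a\<in>carrier A.
           tangent_map (adj_tangent_map R P A B f) (adj_unit R P A a) = adj_unit R P B (f a)) \<and>
        (\<forall>x\<in>carrier (adj_tangent R P (tangent A)).
           f (adj_counit R P A x)
             = adj_counit R P B
                 (adj_tangent_map R P (tangent A) (tangent B) (tangent_map f) x))) \<and>
    \<comment> \<open>triangle identities\<close>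
     (\<forall>A :: ('r, 'p, 'a) operad_alg. operad_algebra R P A \<longrightarrow>
        (\<forall>x\<in>carrier (adj_tangent R P A).
           adj_counit R P (adj_tangent R P A)
             (adj_tangent_map R P A (tangent (adj_tangent R P A)) (adj_unit R P A) x) = x) \<and>
        (\<forall>x\<in>carrier (tangent A).
           tangent_map (adj_counit R P A) (adj_unit R P (tangent A) x) = x))"
proof (intro conjI allI impI ballI, goal_cases)
  case (1 A)
  then show ?case by (rule operad_algebra.tangent_operad_algebra)
next
  case (2 A x)
  then show ?case by (simp add: tangent_map_def)
next
  case (3 A B f)
  then show ?case by (intro tangent_map_alg_hom) auto
next
  case (4 A B C f g x)
  then show ?case by (cases x) (simp add: tangent_map_def)
next
  case (5 A)
  then show ?case by (intro adj_tangent_algebra.adj_tangent_operad_algebra adj_tangent_algebraI)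
next
  case (6 A x)
  then show ?case by (rule adj_tangent_map_id)
next
  case (7 A B f)
  then show ?case by (intro adj_tangent_map(1)) auto
next
  case (8 A B f a)
  then show ?case by (intro adj_tangent_map(2)) auto
next
  case (9 A B f a)
  then show ?case by (intro adj_tangent_map(3)) auto
next
  case (10 A B C f g x)
  then show ?case by (intro adj_tangent_map_compose) auto
next
  case (11 A)
  then show ?case by (intro adj_tangent_algebra.adj_unit_hom adj_tangent_algebraI)
next
  case (12 A)
  then show ?case by (rule adj_counit(1))
next
  case (13 A a b)
  then show ?case by (simp add: adj_counit(2) tangent_simps)
next
  case (14 A a b)
  then show ?case by (simp add: adj_counit(3) tangent_simps)
next
  case (15 A B f a)
  \<comment> \<open>Naturality of the unit is the description of \<open>adj_tangent_map\<close> on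
    the two kinds of generators.\<close>
  then show ?case by (simp add: tangent_map_def adj_unit_def adj_tangent_map)
next
  case (16 A B f x)
  then show ?case by (intro adj_counit_natural) auto
next
  case (17 A x)
  then show ?case by (rule adj_triangle_left)
next
  case (18 A x)
  then show ?case by (rule adj_triangle_right)
qed

end
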